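(* Let $G$ be a Lie group belonging to the family $\mathcal{G}_1$. Then $G$ does not admit any left invariant non-Riemannian $(\alpha,\beta)$-metric of Berwald type which is defined by a left invariant Riemannian metric $g$ and a left invariant vector field $X$ on $G$.
   Context: $\mathcal{G}_1$ is the family of non-commutative Lie groups $G$ with Lie algebra $\mathfrak{g}$ such that for any $x,y\in\mathfrak{g}$ the bracket $[x,y]$ is a linear combination of $x$ and $y$. It is known (Milnor) that for $G\in\mathcal{G}_1$ there exist a commutative ideal $\mathfrak{u}$ of codimension one and an element $b\in\mathfrak{g}$ with $[b,z]=z$ for every $z\in\mathfrak{u}$. A Finsler metric on a manifold $M$ is a function $F:TM\to[0,\infty)$, smooth on $TM\setminus\{0\}$, positively homogeneous of degree one in $y$, with $\left(\frac12\frac{\partial^2F^2}{\partial y^i\partial y^j}\right)$ positive definite on $TM\setminus\{0\}$. On a Lie group, $F$ is left invariant if $F(x,y)=F(e,dl_{x^{-1}}y)$. $F$ is Riemannian if $F^2$ is a quadratic form in $y$ on each tangent space. An $(\alpha,\beta)$-metric defined by $g$ and $X$ is a Finsler metric of the form $F=\alpha\,\phi(\beta/\alpha)$, where $\alpha(x,y)=\sqrt{g(y,y)}$, $\beta(x,y)=g(X(x),y)$, and $\phi:(-b_0,b_0)\to\mathbb{R}^+$ is a $C^\infty$ function satisfying $\phi(s)-s\phi'(s)+(b^2-s^2)\phi''(s)>0$ for $|s|\le b<b_0$, with $\sqrt{g(X,X)}<b_0$. $F$ is of Berwald type if, in standard local coordinates on $TM\setminus\{0\}$, the Christoffel symbols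 $\Gamma^i_{jk}$ of its Chern connection do not depend on $y$.
   Formalization: "Non-commutative" is required of the identity component of G (the same for connected G); for disconnected G the literal claim fails, e.g. O(2) is non-commutative but carries left invariant non-Riemannian Randers metrics of Berwald type. *)

theory Defs
  imports "HOL-Analysis.Analysis" "HOL-Algebra.Group"
begin

section \<open>Smooth maps between open subsets of Euclidean spaces\<close>

fun Ck_on :: "nat \<Rightarrow> 'a::real_normed_vector set \<Rightarrow> ('a \<Rightarrow> 'b::real_normed_vector) \<Rightarrow> bool" where
  "Ck_on 0 S f \<longleftrightarrow> continuous_on S f"
| "Ck_on (Suc k) S f \<longleftrightarrow>
     (\<forall>x\<in>S. f differentiable (at x)) \<and> (\<forall>v. Ck_on k S (\<lambda>x. frechet_derivative f (at x) v))"

text \<open>Only meant for open \<open>S\<close> in a finite-dimensional space; then it is \<open>C\<^sup>\<infinity>\<close> on \<open>S\<close>,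
  irrespective of the values of the function outside \<open>S\<close>.\<close>
definition smooth_on :: "'a::real_normed_vector set \<Rightarrow> ('a \<Rightarrow> 'b::real_normed_vector) \<Rightarrow> bool" where
  "smooth_on S f \<longleftrightarrow> (\<forall>k. Ck_on k S f)"


section \<open>Smooth manifolds\<close>

text \<open>A chart is a pair of its domain and its coordinate map; the values of the coordinate map
  outside the domain are irrelevant. A manifold is a topology together with a set of charts
  (an atlas, not required to be maximal); its dimension is \<open>CARD('n)\<close>.\<close>
type_synonym ('a, 'n) chart = "'a set \<times> ('a \<Rightarrow> real^'n)"

abbreviation cdom :: "('a, 'n::finite) chart \<Rightarrow> 'a set" where
  "cdom c \<equiv> fst c"

abbreviation cmap :: "('a, 'n::finite) chart \<Rightarrow> 'a \<Rightarrow> real^'n" where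
  "cmap c \<equiv> snd c"

definition cimg :: "('a, 'n::finite) chart \<Rightarrow> (real^'n) set" where
  "cimg c = cmap c ` cdom c"

definition cinv :: "('a, 'n::finite) chart \<Rightarrow> real^'n \<Rightarrow> 'a" where
  "cinv c = inv_into (cdom c) (cmap c)"

definition charts_at :: "('a, 'n::finite) chart set \<Rightarrow> 'a \<Rightarrow> ('a, 'n) chart set" where
  "charts_at A p = {c \<in> A. p \<in> cdom c}"

definition smooth_manifold :: "'a topology \<Rightarrow> ('a, 'n::finite) chart set \<Rightarrow> bool" where
  "smooth_manifold T A \<longleftrightarrow>
     Hausdorff_space T \<and> second_countable T \<and>
     topspace T = (\<Union>c\<in>A. cdom c) \<and>
     (\<forall>c\<in>A. openin T (cdom c) \<and> open (cimg c) \<and>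
        homeomorphic_map (subtopology T (cdom c)) (top_of_set (cimg c)) (cmap c)) \<and>
     (\<forall>c\<in>A. \<forall>d\<in>A. smooth_on (cmap c ` (cdom c \<inter> cdom d)) (cmap d \<circ> cinv c))"


subsection \<open>Tangent vectors\<close>

text \<open>A tangent vector at \<open>p\<close> is given by its components in all charts around \<open>p\<close>, which have to
  transform by the Jacobian of the change of coordinates. In all other charts its value is
  fixed to be \<open>0\<close>, so that equality of tangent vectors is equality of functions, and vector space
  operations are componentwise.\<close>
type_synonym ('a, 'n) tvec = "('a, 'n) chart \<Rightarrow> real^'n"

definition tangent_space :: "('a, 'n::finite) chart set \<Rightarrow> 'a \<Rightarrow> ('a, 'n) tvec set" where
  "tangent_space A p =
     {v. (\<forall>c. c \<notin> charts_at A p \<longrightarrow> v c = 0) \<and>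
         (\<forall>c\<in>charts_at A p. \<forall>d\<in>charts_at A p.
            v d = frechet_derivative (cmap d \<circ> cinv c) (at (cmap c p)) (v c))}"

text \<open>The tangent vector at \<open>p\<close> whose components in the chart \<open>c\<close> around \<open>p\<close> are \<open>y\<close>.\<close>
definition tvec_of :: "('a, 'n::finite) chart set \<Rightarrow> ('a, 'n) chart \<Rightarrow> 'a \<Rightarrow> real^'n \<Rightarrow> ('a, 'n) tvec" where
  "tvec_of A c p y =
     (\<lambda>d. if d \<in> charts_at A p
          then frechet_derivative (cmap d \<circ> cinv c) (at (cmap c p)) y else 0)"

text \<open>Differential at \<open>p\<close> of a map \<open>f\<close> of the manifold to itself. The result does not depend on
  the chart \<open>c\<close> around \<open>p\<close> that is chosen.\<close>
definition tangent_map ::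
  "('a, 'n::finite) chart set \<Rightarrow> ('a \<Rightarrow> 'a) \<Rightarrow> 'a \<Rightarrow> ('a, 'n) tvec \<Rightarrow> ('a, 'n) tvec" where
  "tangent_map A f p v =
     (let c = (SOME c. c \<in> charts_at A p)
      in (\<lambda>d. if d \<in> charts_at A (f p)
              then frechet_derivative (cmap d \<circ> f \<circ> cinv c) (at (cmap c p)) (v c) else 0))"


subsection \<open>Vector fields\<close>

definition vector_field :: "('a, 'n::finite) chart set \<Rightarrow> ('a \<Rightarrow> ('a, 'n) tvec) \<Rightarrow> bool" where
  "vector_field A X \<longleftrightarrow>
     (\<forall>p\<in>(\<Union>c\<in>A. cdom c). X p \<in> tangent_space A p) \<and>
     (\<forall>c\<in>A. smooth_on (cimg c) (\<lambda>x. X (cinv c x) c))"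

text \<open>In coordinates \<open>[X,Y]\<^sup>i = X\<^sup>j \<partial>\<^sub>j Y\<^sup>i - Y\<^sup>j \<partial>\<^sub>j X\<^sup>i\<close>.\<close>
definition lie_bracket ::
  "('a, 'n::finite) chart set \<Rightarrow> ('a \<Rightarrow> ('a, 'n) tvec) \<Rightarrow> ('a \<Rightarrow> ('a, 'n) tvec) \<Rightarrow> 'a \<Rightarrow> ('a, 'n) tvec" where
  "lie_bracket A X Y p =
     (\<lambda>c. if c \<in> charts_at A p
          then frechet_derivative (\<lambda>x. Y (cinv c x) c) (at (cmap c p)) (X p c)
             - frechet_derivative (\<lambda>x. X (cinv c x) c) (at (cmap c p)) (Y p c)
          else 0)"


section \<open>Lie groups\<close>

definition lie_group ::
  "('a, 'm) monoid_scheme \<Rightarrow> 'a topology \<Rightarrow> ('a, 'n::finite) chart set \<Rightarrow> bool" where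
  "lie_group G T A \<longleftrightarrow>
     group G \<and> smooth_manifold T A \<and> topspace T = carrier G \<and>
     continuous_map (prod_topology T T) T (\<lambda>(p, q). p \<otimes>\<^bsub>G\<^esub> q) \<and>
     continuous_map T T (\<lambda>p. inv\<^bsub>G\<^esub> p) \<and>
     (\<forall>c\<in>A. \<forall>d\<in>A. \<forall>e\<in>A.
        smooth_on {(x, y). x \<in> cimg c \<and> y \<in> cimg d \<and> cinv c x \<otimes>\<^bsub>G\<^esub> cinv d y \<in> cdom e}
          (\<lambda>(x, y). cmap e (cinv c x \<otimes>\<^bsub>G\<^esub> cinv d y))) \<and>
     (\<forall>c\<in>A. \<forall>d\<in>A.
        smooth_on {x \<in> cimg c. inv\<^bsub>G\<^esub> (cinv c x) \<in> cdom d} (\<lambda>x. cmap d (inv\<^bsub>G\<^esub> (cinv c x))))"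

abbreviation ltrans_map ::
  "('a, 'm) monoid_scheme \<Rightarrow> ('a, 'n::finite) chart set \<Rightarrow> 'a \<Rightarrow> 'a \<Rightarrow> ('a, 'n) tvec \<Rightarrow> ('a, 'n) tvec" where
  "ltrans_map G A a p v \<equiv> tangent_map A (\<lambda>q. a \<otimes>\<^bsub>G\<^esub> q) p v"

text \<open>The Lie algebra of the Lie group: the left invariant vector fields.\<close>
definition left_invariant_field ::
  "('a, 'm) monoid_scheme \<Rightarrow> ('a, 'n::finite) chart set \<Rightarrow> ('a \<Rightarrow> ('a, 'n) tvec) \<Rightarrow> bool" where
  "left_invariant_field G A X \<longleftrightarrow>
     vector_field A X \<and>
     (\<forall>a\<in>carrier G. \<forall>p\<in>carrier G. X (a \<otimes>\<^bsub>G\<^esub> p) = ltrans_map G A a p (X p))"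

text \<open>The family \<open>\<G>\<^sub>1\<close>. For a connected group the second clause says that the group is not
  commutative. Without connectedness it has to refer to the identity component: a group such as
  \<open>O(2)\<close> is not commutative but has a commutative Lie algebra.\<close>
definition family_G1 ::
  "('a, 'm) monoid_scheme \<Rightarrow> 'a topology \<Rightarrow> ('a, 'n::finite) chart set \<Rightarrow> bool" where
  "family_G1 G T A \<longleftrightarrow>
     lie_group G T A \<and>
     (\<exists>p\<in>connected_component_of_set T \<one>\<^bsub>G\<^esub>. \<exists>q\<in>connected_component_of_set T \<one>\<^bsub>G\<^esub>.
        p \<otimes>\<^bsub>G\<^esub> q \<noteq> q \<otimes>\<^bsub>G\<^esub> p) \<and>
     (\<forall>X Y. left_invariant_field G A X \<longrightarrow> left_invariant_field G A Y \<longrightarrow>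
        (\<exists>r s. \<forall>p\<in>carrier G. lie_bracket A X Y p = (\<lambda>c. r *\<^sub>R X p c + s *\<^sub>R Y p c)))"


section \<open>Finsler metrics\<close>

subsection \<open>Local expressions\<close>

text \<open>Partial derivatives of a function of \<open>(x, y)\<close>, the standard local coordinates on the
  tangent bundle.\<close>
definition pdx :: "'n::finite \<Rightarrow> ((real^'n) \<times> (real^'n) \<Rightarrow> real) \<Rightarrow> (real^'n) \<times> (real^'n) \<Rightarrow> real" where
  "pdx k f z = frechet_derivative f (at z) (axis k 1, 0)"

definition pdy :: "'n::finite \<Rightarrow> ((real^'n) \<times> (real^'n) \<Rightarrow> real) \<Rightarrow> (real^'n) \<times> (real^'n) \<Rightarrow> real" where
  "pdy k f z = frechet_derivative f (at z) (0, axis k 1)"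

text \<open>In the following, \<open>L\<close> is the local expression of a Finsler metric \<open>F\<close>.\<close>

definition fund :: "((real^'n::finite) \<times> (real^'n) \<Rightarrow> real) \<Rightarrow> 'n \<Rightarrow> 'n \<Rightarrow> (real^'n) \<times> (real^'n) \<Rightarrow> real" where
  "fund L i j z = 1 / 2 * pdy i (pdy j (\<lambda>w. (L w)\<^sup>2)) z"

definition fund_inv :: "((real^'n::finite) \<times> (real^'n) \<Rightarrow> real) \<Rightarrow> 'n \<Rightarrow> 'n \<Rightarrow> (real^'n) \<times> (real^'n) \<Rightarrow> real" where
  "fund_inv L i j z = matrix_inv (\<chi> a b. fund L a b z) $ i $ j"

text \<open>The formal Christoffel symbols \<open>\<gamma>\<^sup>i\<^sub>j\<^sub>k\<close> of \<open>g\<^sub>i\<^sub>j\<close>.\<close>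
definition formal_christoffel ::
  "((real^'n::finite) \<times> (real^'n) \<Rightarrow> real) \<Rightarrow> 'n \<Rightarrow> 'n \<Rightarrow> 'n \<Rightarrow> (real^'n) \<times> (real^'n) \<Rightarrow> real" where
  "formal_christoffel L i j k z =
     (\<Sum>l\<in>UNIV. fund_inv L i l z *
        (pdx k (fund L l j) z + pdx j (fund L l k) z - pdx l (fund L j k) z)) / 2"

definition cartan_tensor ::
  "((real^'n::finite) \<times> (real^'n) \<Rightarrow> real) \<Rightarrow> 'n \<Rightarrow> 'n \<Rightarrow> 'n \<Rightarrow> (real^'n) \<times> (real^'n) \<Rightarrow> real" where
  "cartan_tensor L i j k z = 1 / 2 * pdy k (fund L i j) z"

text \<open>The nonlinear connection
  \<open>N\<^sup>i\<^sub>j = \<gamma>\<^sup>i\<^sub>j\<^sub>k y\<^sup>k - C\<^sup>i\<^sub>j\<^sub>k \<gamma>\<^sup>k\<^sub>r\<^sub>s y\<^sup>r y\<^sup>s\<close>.\<close>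
definition nonlin_conn ::
  "((real^'n::finite) \<times> (real^'n) \<Rightarrow> real) \<Rightarrow> 'n \<Rightarrow> 'n \<Rightarrow> (real^'n) \<times> (real^'n) \<Rightarrow> real" where
  "nonlin_conn L i j z =
     (\<Sum>k\<in>UNIV. formal_christoffel L i j k z * snd z $ k) -
     (\<Sum>k\<in>UNIV. \<Sum>l\<in>UNIV. \<Sum>r\<in>UNIV. \<Sum>s\<in>UNIV.
        fund_inv L i l z * cartan_tensor L l j k z *
        formal_christoffel L k r s z * snd z $ r * snd z $ s)"

text \<open>The horizontal derivative \<open>\<delta>/\<delta>x\<^sup>k = \<partial>/\<partial>x\<^sup>k - N\<^sup>s\<^sub>k \<partial>/\<partial>y\<^sup>s\<close>.\<close>
definition horiz_deriv ::
  "((real^'n::finite) \<times> (real^'n) \<Rightarrow> real) \<Rightarrow> 'n \<Rightarrow> ((real^'n) \<times> (real^'n) \<Rightarrow> real) \<Rightarrow>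
   (real^'n) \<times> (real^'n) \<Rightarrow> real" where
  "horiz_deriv L k f z = pdx k f z - (\<Sum>s\<in>UNIV. nonlin_conn L s k z * pdy s f z)"

text \<open>The Christoffel symbols \<open>\<Gamma>\<^sup>i\<^sub>j\<^sub>k\<close> of the Chern connection (torsion free and almost
  compatible with \<open>g\<^sub>i\<^sub>j\<close>).\<close>
definition chern_christoffel ::
  "((real^'n::finite) \<times> (real^'n) \<Rightarrow> real) \<Rightarrow> 'n \<Rightarrow> 'n \<Rightarrow> 'n \<Rightarrow> (real^'n) \<times> (real^'n) \<Rightarrow> real" where
  "chern_christoffel L i j k z =
     (\<Sum>l\<in>UNIV. fund_inv L i l z *
        (horiz_deriv L k (fund L l j) z + horiz_deriv L j (fund L l k) z
         - horiz_deriv L l (fund L j k) z)) / 2"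


subsection \<open>Metrics on manifolds\<close>

text \<open>A metric is applied to a point and a tangent vector at that point.\<close>

definition local_expr ::
  "('a, 'n::finite) chart set \<Rightarrow> ('a \<Rightarrow> ('a, 'n) tvec \<Rightarrow> real) \<Rightarrow> ('a, 'n) chart \<Rightarrow>
   (real^'n) \<times> (real^'n) \<Rightarrow> real" where
  "local_expr A F c = (\<lambda>(x, y). F (cinv c x) (tvec_of A c (cinv c x) y))"

definition finsler_metric ::
  "('a, 'n::finite) chart set \<Rightarrow> ('a \<Rightarrow> ('a, 'n) tvec \<Rightarrow> real) \<Rightarrow> bool" where
  "finsler_metric A F \<longleftrightarrow>
     (\<forall>p\<in>(\<Union>c\<in>A. cdom c). \<forall>v\<in>tangent_space A p.
        F p v \<ge> 0 \<and> (\<forall>t>0. F p (\<lambda>c. t *\<^sub>R v c) = t * F p v)) \<and>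
     (\<forall>c\<in>A. smooth_on (cimg c \<times> (UNIV - {0})) (local_expr A F c) \<and>
        (\<forall>x\<in>cimg c. \<forall>y. y \<noteq> 0 \<longrightarrow>
           (\<forall>w. w \<noteq> 0 \<longrightarrow>
              (\<Sum>i\<in>UNIV. \<Sum>j\<in>UNIV. fund (local_expr A F c) i j (x, y) * w $ i * w $ j) > 0)))"

definition riemannian_finsler ::
  "('a, 'n::finite) chart set \<Rightarrow> ('a \<Rightarrow> ('a, 'n) tvec \<Rightarrow> real) \<Rightarrow> bool" where
  "riemannian_finsler A F \<longleftrightarrow>
     (\<forall>c\<in>A. \<forall>p\<in>cdom c. \<exists>Q :: real^'n^'n. \<forall>v\<in>tangent_space A p.
        (F p v)\<^sup>2 = v c \<bullet> (Q *v v c))"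

definition berwald_type ::
  "('a, 'n::finite) chart set \<Rightarrow> ('a \<Rightarrow> ('a, 'n) tvec \<Rightarrow> real) \<Rightarrow> bool" where
  "berwald_type A F \<longleftrightarrow>
     (\<forall>c\<in>A. \<forall>i j k. \<forall>x\<in>cimg c. \<forall>y y'. y \<noteq> 0 \<longrightarrow> y' \<noteq> 0 \<longrightarrow>
        chern_christoffel (local_expr A F c) i j k (x, y) =
        chern_christoffel (local_expr A F c) i j k (x, y'))"

definition left_invariant_finsler ::
  "('a, 'm) monoid_scheme \<Rightarrow> ('a, 'n::finite) chart set \<Rightarrow> ('a \<Rightarrow> ('a, 'n) tvec \<Rightarrow> real) \<Rightarrow> bool" where
  "left_invariant_finsler G A F \<longleftrightarrow>
     (\<forall>p\<in>carrier G. \<forall>v\<in>tangent_space A p.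
        F p v = F \<one>\<^bsub>G\<^esub> (ltrans_map G A (inv\<^bsub>G\<^esub> p) p v))"

definition riemannian_metric ::
  "('a, 'n::finite) chart set \<Rightarrow> ('a \<Rightarrow> ('a, 'n) tvec \<Rightarrow> ('a, 'n) tvec \<Rightarrow> real) \<Rightarrow> bool" where
  "riemannian_metric A g \<longleftrightarrow>
     (\<forall>p\<in>(\<Union>c\<in>A. cdom c). \<forall>u\<in>tangent_space A p. \<forall>v\<in>tangent_space A p.
        g p u v = g p v u \<and> (u \<noteq> (\<lambda>c. 0) \<longrightarrow> g p u u > 0) \<and>
        (\<forall>w\<in>tangent_space A p. \<forall>r s.
           g p (\<lambda>c. r *\<^sub>R u c + s *\<^sub>R v c) w = r * g p u w + s * g p v w)) \<and>
     (\<forall>c\<in>A. \<forall>y z. smooth_on (cimg c)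
        (\<lambda>x. g (cinv c x) (tvec_of A c (cinv c x) y) (tvec_of A c (cinv c x) z)))"

definition left_invariant_riemannian ::
  "('a, 'm) monoid_scheme \<Rightarrow> ('a, 'n::finite) chart set \<Rightarrow>
   ('a \<Rightarrow> ('a, 'n) tvec \<Rightarrow> ('a, 'n) tvec \<Rightarrow> real) \<Rightarrow> bool" where
  "left_invariant_riemannian G A g \<longleftrightarrow>
     riemannian_metric A g \<and>
     (\<forall>p\<in>carrier G. \<forall>u\<in>tangent_space A p. \<forall>v\<in>tangent_space A p.
        g p u v = g \<one>\<^bsub>G\<^esub> (ltrans_map G A (inv\<^bsub>G\<^esub> p) p u) (ltrans_map G A (inv\<^bsub>G\<^esub> p) p v))"

text \<open>The Finsler metric \<open>F = \<alpha> \<phi>(\<beta>/\<alpha>)\<close> with \<open>\<alpha>(y) = sqrt (g(y,y))\<close> and \<open>\<beta>(y) = g(X,y)\<close>. The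
  quotient \<open>\<beta>/\<alpha>\<close> makes sense for \<open>y \<noteq> 0\<close> only; \<open>F\<close> vanishes at \<open>y = 0\<close> by homogeneity.\<close>
definition alpha_beta_metric ::
  "('a, 'n::finite) chart set \<Rightarrow> ('a \<Rightarrow> ('a, 'n) tvec \<Rightarrow> ('a, 'n) tvec \<Rightarrow> real) \<Rightarrow>
   ('a \<Rightarrow> ('a, 'n) tvec) \<Rightarrow> ('a \<Rightarrow> ('a, 'n) tvec \<Rightarrow> real) \<Rightarrow> bool" where
  "alpha_beta_metric A g X F \<longleftrightarrow>
     riemannian_metric A g \<and> vector_field A X \<and> finsler_metric A F \<and>
     (\<exists>(b0::real) (\<phi> :: real \<Rightarrow> real).
        b0 > 0 \<and>
        smooth_on {-b0<..<b0} \<phi> \<and> (\<forall>s\<in>{-b0<..<b0}. \<phi> s > 0) \<and>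
        (\<forall>s b. \<bar>s\<bar> \<le> b \<and> b < b0 \<longrightarrow>
           \<phi> s - s * deriv \<phi> s + (b\<^sup>2 - s\<^sup>2) * deriv (deriv \<phi>) s > 0) \<and>
        (\<forall>p\<in>(\<Union>c\<in>A. cdom c). sqrt (g p (X p) (X p)) < b0) \<and>
        (\<forall>p\<in>(\<Union>c\<in>A. cdom c). \<forall>v\<in>tangent_space A p - {\<lambda>c. 0}.
           F p v = sqrt (g p v v) * \<phi> (g p (X p) v / sqrt (g p v v))))"

end

theory Submission
  imports Defs
begin

text \<open>A Berwald metric is constant along the horizontal lifts of a torsion free linear connection.
  At the identity, comparing this connection with the flat one given by the left invariant fields
  yields operators \<open>D u\<close> with \<open>D u v - D v u = [u, v]\<close> that are infinitesimal isometries of the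
  norm \<open>F\<close>. If \<open>F\<close> is an \<open>(\<alpha>, \<beta>)\<close>-norm but not Euclidean, its infinitesimal isometries are
  \<open>g\<close>-skew and take values orthogonal to \<open>X\<close>; otherwise they force an ODE on \<open>\<phi>\<close> whose solutions make \<open>F\<^sup>2\<close>
  quadratic. Then \<open>D u X = 0\<close>, and since \<open>[u, v]\<close> is a combination of \<open>u\<close> and \<open>v\<close>, all
  brackets vanish. A primitive of the Maurer-Cartan form then shows that the group operation is
  commutative near the identity, hence on the identity component.\<close>

section \<open>Calculus\<close>

text \<open>Left translation back to the identity is \<open>coframe x\<close>, so left invariance
  reads \<open>E (x, y) = E (base, coframe x y)\<close>, and \<open>dcoframe\<close> computes the
  x-derivative of \<open>E\<close> at \<open>base\<close>. For a Berwald metric a symmetric bilinear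
  map \<open>\<Gamma>\<close>, built from the Christoffel symbols, computes the same derivative.
  \<open>D\<close> is the difference of the two; \<open>\<Gamma>\<close> cancels in D u v - D v u,
  and the Maurer-Cartan equation identifies the rest with the bracket. The excluded shape \<phi>^2 =
  C (1 - k s^2) with s = \<beta>/\<alpha> means F^2 = C (\<alpha>^2 - k \<beta>^2). It includes the
  case X = 0, so X is not 0. Why X decides everything: for u orthogonal to X, [u, X] = - D X u is
  orthogonal to u and to X, yet a combination of them, hence 0. So X is central, and the bracket
  condition for u and v + X confines [u, v] to the line of u, and by antisymmetry to that of v. The
  obstacle on the group side is that non-commutativity is assumed of group elements, so the
  vanishing of brackets has to be integrated; a primitive of the coframe takes the place of flows
  and of the exponential map.\<close>

abbreviation FD :: "('a::real_normed_vector \<Rightarrow> 'b::real_normed_vector) \<Rightarrow> 'a \<Rightarrow> 'a \<Rightarrow> 'b" where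
  "FD f x \<equiv> frechet_derivative f (at x)"

lemma FD_eqI: "(f has_derivative f') (at x) \<Longrightarrow> FD f x = f'"
  by (simp add: frechet_derivative_at[symmetric])

lemma has_derivative_FD: "f differentiable (at x) \<Longrightarrow> (f has_derivative FD f x) (at x)"
  by (simp add: frechet_derivative_works)

lemma linear_FD: "f differentiable (at x) \<Longrightarrow> linear (FD f x)"
  using has_derivative_FD has_derivative_linear by blast

lemma FD_cong_open:
  assumes "open S" "x \<in> S" "\<And>z. z \<in> S \<Longrightarrow> f z = g z"
  shows "FD f x = FD g x"
proof -
  \<comment> \<open>\<open>frechet_derivative\<close> is a choice among all derivatives, so it is
    enough that both functions have the same ones; the equality also holds where neither is
    differentiable.\<close>
  have "(f has_derivative f') (at x) \<longleftrightarrow> (g has_derivative f') (at x)" for f'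
    using assms has_derivative_transform_within_open[of f f' x UNIV S g]
      has_derivative_transform_within_open[of g f' x UNIV S f] by auto
  then show ?thesis
    unfolding frechet_derivative_def by simp
qed

section \<open>Closure properties of the classes C^k\<close>

lemma Ck_on_cong:
  assumes "open S" "\<And>z. z \<in> S \<Longrightarrow> f z = g z" "Ck_on k S f"
  shows "Ck_on k S g"
  using assms(2,3)
proof (induction k arbitrary: f g)
  case 0
  then show ?case by (simp cong: continuous_on_cong)
next
  case (Suc k)
  have "g differentiable (at x)" if "x \<in> S" for x
  proof -
    have "f differentiable (at x)" using Suc.prems that by simp
    then obtain f' where "(f has_derivative f') (at x)" by (auto simp: differentiable_def)
    then have "(g has_derivative f') (at x)"
      using has_derivative_transform_within_open[OF _ assms(1) that] Suc.prems(1) by blast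
    then show ?thesis by (auto simp: differentiable_def)
  qed
  moreover have "Ck_on k S (\<lambda>x. FD g x v)" for v
  proof (rule Suc.IH)
    show "Ck_on k S (\<lambda>x. FD f x v)" using Suc.prems by simp
    show "FD f z v = FD g z v" if "z \<in> S" for z
      using FD_cong_open[OF assms(1) that] Suc.prems(1) by metis
  qed
  ultimately show ?case by simp
qed

lemma Ck_on_SucD: "Ck_on (Suc k) S f \<Longrightarrow> Ck_on k S f"
proof (induction k arbitrary: f)
  case 0
  then show ?case
    by (auto intro!: continuous_at_imp_continuous_on differentiable_imp_continuous_within)
next
  case (Suc k)
  show ?case
    using Suc.prems Suc.IH by (metis Ck_on.simps(2))
qed

lemma Ck_on_subset: "Ck_on k S f \<Longrightarrow> S' \<subseteq> S \<Longrightarrow> Ck_on k S' f"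
proof (induction k arbitrary: f)
  case 0
  then show ?case by (auto intro: continuous_on_subset)
next
  case (Suc k)
  then show ?case by (meson Ck_on.simps(2) subsetD)
qed

lemma Ck_on_Suc_differentiable: "Ck_on (Suc k) S f \<Longrightarrow> x \<in> S \<Longrightarrow> f differentiable (at x)"
  by simp

lemma Ck_on_FD: "Ck_on (Suc k) S f \<Longrightarrow> Ck_on k S (\<lambda>x. FD f x v)"
  by simp

lemma smooth_on_FD: "smooth_on S f \<Longrightarrow> smooth_on S (\<lambda>x. FD f x v)"
  unfolding smooth_on_def using Ck_on_FD by blast

lemma smooth_on_differentiable: "smooth_on S f \<Longrightarrow> x \<in> S \<Longrightarrow> f differentiable (at x)"
  unfolding smooth_on_def using Ck_on_Suc_differentiable by blast

lemma smooth_on_subset: "smooth_on S f \<Longrightarrow> S' \<subseteq> S \<Longrightarrow> smooth_on S' f"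
  unfolding smooth_on_def using Ck_on_subset by blast

lemma smooth_on_cong:
  "open S \<Longrightarrow> (\<And>z. z \<in> S \<Longrightarrow> f z = g z) \<Longrightarrow> smooth_on S f \<Longrightarrow> smooth_on S g"
  unfolding smooth_on_def using Ck_on_cong by blast

lemma Ck_on_add:
  assumes "open S" "Ck_on k S f" "Ck_on k S g"
  shows "Ck_on k S (\<lambda>x. f x + g x)"
  using assms(2,3)
proof (induction k arbitrary: f g)
  case 0
  then show ?case by (auto intro: continuous_on_add)
next
  case (Suc k)
  have "Ck_on k S (\<lambda>x. FD (\<lambda>x. f x + g x) x v)" for v
  proof (rule Ck_on_cong[OF assms(1)])
    show "Ck_on k S (\<lambda>x. FD f x v + FD g x v)" using Suc by simp
    show "FD f z v + FD g z v = FD (\<lambda>x. f x + g x) z v" if "z \<in> S" for z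
      using Suc.prems that
      by (subst FD_eqI[OF has_derivative_add[OF has_derivative_FD has_derivative_FD]]) auto
  qed
  then show ?case using Suc.prems by (auto intro: differentiable_add)
qed

lemma Ck_on_mult:
  fixes f g :: "'a::real_normed_vector \<Rightarrow> real"
  assumes "open S" "Ck_on k S f" "Ck_on k S g"
  shows "Ck_on k S (\<lambda>x. f x * g x)"
  using assms(2,3)
proof (induction k arbitrary: f g)
  case 0
  then show ?case by (auto intro: continuous_on_mult)
next
  case (Suc k)
  have "Ck_on k S (\<lambda>x. FD (\<lambda>x. f x * g x) x v)" for v
  proof (rule Ck_on_cong[OF assms(1)])
    show "Ck_on k S (\<lambda>x. f x * FD g x v + FD f x v * g x)"
      using Suc by (intro Ck_on_add[OF assms(1)] Suc.IH) (auto dest: Ck_on_SucD simp del: Ck_on.simps intro: Ck_on_FD)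
    show "f z * FD g z v + FD f z v * g z = FD (\<lambda>x. f x * g x) z v" if "z \<in> S" for z
      using Suc.prems that
      by (subst FD_eqI[OF has_derivative_mult[OF has_derivative_FD has_derivative_FD]]) auto
  qed
  then show ?case using Suc.prems by (auto intro: differentiable_mult)
qed

lemma smooth_on_mult:
  fixes f g :: "'a::real_normed_vector \<Rightarrow> real"
  shows "open S \<Longrightarrow> smooth_on S f \<Longrightarrow> smooth_on S g \<Longrightarrow> smooth_on S (\<lambda>x. f x * g x)"
  unfolding smooth_on_def using Ck_on_mult by blast

text \<open>Meant for slices of functions on a product. For an affine substitution the derivative in
  direction \<open>v\<close> is again such a substitution into the derivative of \<open>f\<close> in
  the fixed direction \<open>l v\<close>, so the induction never meets a product of
  derivatives.\<close>

lemma Ck_on_affine: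
  assumes "open S" "bounded_linear l" "Ck_on k S f"
  shows "Ck_on k {x. l x + c \<in> S} (\<lambda>x. f (l x + c))"
  using assms(3)
proof (induction k arbitrary: f)
  case 0
  then show ?case
    by (auto intro!: continuous_on_compose2[of S f] continuous_intros
        bounded_linear.continuous_on[OF assms(2)])
next
  case (Suc k)
  have op: "open {x. l x + c \<in> S}"
    by (rule open_vimage[OF assms(1), of "\<lambda>x. l x + c", unfolded vimage_def])
      (intro continuous_intros bounded_linear.continuous_on[OF assms(2)])
  have der: "((\<lambda>x. f (l x + c)) has_derivative (\<lambda>v. FD f (l z + c) (l v))) (at z)"
    if "l z + c \<in> S" for z
  proof -
    have "((\<lambda>x. l x + c) has_derivative l) (at z)"
      by (auto intro!: derivative_eq_intros bounded_linear_imp_has_derivative[OF assms(2)])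
    moreover have "(f has_derivative FD f (l z + c)) (at (l z + c))"
      using Suc.prems that by (auto intro: has_derivative_FD)
    ultimately show ?thesis
      using has_derivative_compose by blast
  qed
  have "Ck_on k {x. l x + c \<in> S} (\<lambda>x. FD (\<lambda>x. f (l x + c)) x v)" for v
  proof (rule Ck_on_cong[OF op])
    show "Ck_on k {x. l x + c \<in> S} (\<lambda>x. FD f (l x + c) (l v))"
      using Suc.IH[of "\<lambda>x. FD f x (l v)"] Suc.prems by simp
    show "FD f (l z + c) (l v) = FD (\<lambda>x. f (l x + c)) z v" if "z \<in> {x. l x + c \<in> S}" for z
      using FD_eqI[OF der] that by simp
  qed
  then show ?case using der by (auto simp: differentiable_def)
qed

lemma smooth_on_affine:
  "open S \<Longrightarrow> bounded_linear l \<Longrightarrow> smooth_on S f \<Longrightarrow>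
    smooth_on {x. l x + c \<in> S} (\<lambda>x. f (l x + c))"
  unfolding smooth_on_def using Ck_on_affine by blast

lemma smooth_on_slice1:
  fixes f :: "'a::real_normed_vector \<times> 'b::real_normed_vector \<Rightarrow> 'c::real_normed_vector"
  assumes "open S" "smooth_on S f"
  shows "smooth_on {x. (x, b) \<in> S} (\<lambda>x. f (x, b))"
proof -
  have "bounded_linear (\<lambda>x::'a. (x, 0::'b))"
    by (intro bounded_linear_Pair bounded_linear_ident bounded_linear_zero)
  from smooth_on_affine[OF assms(1) this assms(2), of "(0, b)"] show ?thesis by simp
qed

lemma smooth_on_slice2:
  fixes f :: "'a::real_normed_vector \<times> 'b::real_normed_vector \<Rightarrow> 'c::real_normed_vector"
  assumes "open S" "smooth_on S f"
  shows "smooth_on {x. (a, x) \<in> S} (\<lambda>x. f (a, x))"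
proof -
  have "bounded_linear (\<lambda>x::'b. (0::'a, x))"
    by (intro bounded_linear_Pair bounded_linear_ident bounded_linear_zero)
  from smooth_on_affine[OF assms(1) this assms(2), of "(a, 0)"] show ?thesis by simp
qed

section \<open>Continuity and symmetry of derivatives, Poincare lemma\<close>

lemma linear_expand_Basis:
  fixes f :: "'a::euclidean_space \<Rightarrow> 'b::real_vector"
  assumes "linear f" shows "f v = (\<Sum>b\<in>Basis. (v \<bullet> b) *\<^sub>R f b)"
  by (metis (no_types, lifting) assms euclidean_representation linear_scale linear_sum sum.cong)

text \<open>\<open>Ck_on\<close> gives continuity in the point for each fixed direction only.
  Expanding the direction in the finite basis makes it joint.\<close>

lemma continuous_on_FD:
  fixes f :: "'a::euclidean_space \<Rightarrow> 'b::real_normed_vector"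
  assumes "Ck_on (Suc 0) S f"
  shows "continuous_on (S \<times> UNIV) (\<lambda>(x, v). FD f x v)"
proof -
  have "continuous_on (S \<times> UNIV) (\<lambda>z. \<Sum>b\<in>Basis. (snd z \<bullet> b) *\<^sub>R FD f (fst z) b)"
    using assms by (auto intro!: continuous_intros continuous_on_compose2[of S "\<lambda>x. FD f x _" _ fst])
  moreover have "(\<Sum>b\<in>Basis. (snd z \<bullet> b) *\<^sub>R FD f (fst z) b) = (case z of (x, v) \<Rightarrow> FD f x v)"
    if "z \<in> S \<times> UNIV" for z
    using that assms linear_expand_Basis[OF linear_FD, of f "fst z" "snd z"] by auto
  ultimately show ?thesis by (simp cong: continuous_on_cong)
qed

text \<open>The mean value theorem twice: along \<open>v\<close> for the difference of
  \<open>f\<close> over the step in \<open>w\<close>, and along \<open>w\<close> for the resulting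
  derivative. The second difference itself is symmetric in \<open>v\<close> and \<open>w\<close>,
  which is what \<open>FD_FD_commute\<close> exploits.\<close>

lemma second_difference_mvt:
  fixes f :: "'a::real_normed_vector \<Rightarrow> real"
  assumes C2: "Ck_on (Suc (Suc 0)) S f" and t: "t > 0"
    and box: "\<And>a b. 0 \<le> a \<Longrightarrow> a \<le> t \<Longrightarrow> 0 \<le> b \<Longrightarrow> b \<le> t \<Longrightarrow> x + a *\<^sub>R v + b *\<^sub>R w \<in> S"
  obtains a b where "0 \<le> a" "a \<le> t" "0 \<le> b" "b \<le> t"
    "f (x + t *\<^sub>R v + t *\<^sub>R w) - f (x + t *\<^sub>R v) - f (x + t *\<^sub>R w) + f x =
     t * t * FD (\<lambda>z. FD f z v) (x + a *\<^sub>R v + b *\<^sub>R w) w"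
proof -
  have df: "(f has_derivative FD f z) (at z)" if "z \<in> S" for z
    using C2 that by (auto intro: has_derivative_FD)
  have dh: "((\<lambda>z. FD f z v) has_derivative FD (\<lambda>z. FD f z v) z) (at z)" if "z \<in> S" for z
    using C2 that by (intro has_derivative_FD) auto
  define g where "g a = f (x + a *\<^sub>R v + t *\<^sub>R w) - f (x + a *\<^sub>R v)" for a
  have lin: "linear (FD f z)" "linear (FD (\<lambda>z. FD f z v) z)" if "z \<in> S" for z
    using df[OF that] dh[OF that] has_derivative_linear by auto
  have dg: "(g has_real_derivative FD f (x + a *\<^sub>R v + t *\<^sub>R w) v - FD f (x + a *\<^sub>R v) v) (at a)"
    if "0 \<le> a" "a \<le> t" for a
  proof -
    have m: "x + a *\<^sub>R v + t *\<^sub>R w \<in> S" "x + a *\<^sub>R v \<in> S"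
      using box[of a t] box[of a 0] that t by auto
    note l = lin(1)[OF m(1)] lin(1)[OF m(2)]
    have c: "((\<lambda>a. x + a *\<^sub>R v + t *\<^sub>R w) has_derivative (\<lambda>h. h *\<^sub>R v)) (at a)"
      "((\<lambda>a. x + a *\<^sub>R v) has_derivative (\<lambda>h. h *\<^sub>R v)) (at a)"
      by (auto intro!: derivative_eq_intros)
    have "((\<lambda>a. f (x + a *\<^sub>R v + t *\<^sub>R w)) has_derivative
        (\<lambda>h. FD f (x + a *\<^sub>R v + t *\<^sub>R w) (h *\<^sub>R v))) (at a)"
      "((\<lambda>a. f (x + a *\<^sub>R v)) has_derivative (\<lambda>h. FD f (x + a *\<^sub>R v) (h *\<^sub>R v))) (at a)"
      using has_derivative_compose[OF c(1) df[OF m(1)]] has_derivative_compose[OF c(2) df[OF m(2)]] .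
    from has_derivative_diff[OF this] show ?thesis
      unfolding g_def has_field_derivative_def
      by (simp add: linear_scale[OF l(1)] linear_scale[OF l(2)] right_diff_distrib[symmetric] mult_commute_abs)
  qed
  obtain a where a: "a > 0" "a < t"
    "g t - g 0 = t * (FD f (x + a *\<^sub>R v + t *\<^sub>R w) v - FD f (x + a *\<^sub>R v) v)"
    using MVT2[of 0 t g, OF t dg] by auto
  define k where "k b = FD f (x + a *\<^sub>R v + b *\<^sub>R w) v" for b
  have dk: "(k has_real_derivative FD (\<lambda>z. FD f z v) (x + a *\<^sub>R v + b *\<^sub>R w) w) (at b)"
    if "0 \<le> b" "b \<le> t" for b
  proof -
    have m: "x + a *\<^sub>R v + b *\<^sub>R w \<in> S" using box a that by auto
    have "((\<lambda>b. x + a *\<^sub>R v + b *\<^sub>R w) has_derivative (\<lambda>h. h *\<^sub>R w)) (at b)"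
      by (auto intro!: derivative_eq_intros)
    from has_derivative_compose[OF this dh[OF m]] show ?thesis
      unfolding k_def has_field_derivative_def
      by (simp add: linear_scale[OF lin(2)[OF m]] mult_commute_abs)
  qed
  obtain b where b: "b > 0" "b < t"
    "k t - k 0 = t * FD (\<lambda>z. FD f z v) (x + a *\<^sub>R v + b *\<^sub>R w) w"
    using MVT2[of 0 t k, OF t dk] by auto
  show ?thesis
  proof (rule that[of a b])
    have "g t - g 0 = t * (k t - k 0)" using a(3) by (simp add: k_def)
    then show "f (x + t *\<^sub>R v + t *\<^sub>R w) - f (x + t *\<^sub>R v) - f (x + t *\<^sub>R w) + f x =
      t * t * FD (\<lambda>z. FD f z v) (x + a *\<^sub>R v + b *\<^sub>R w) w"
      using b(3) by (simp add: g_def)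
  qed (use a b in auto)
qed

lemma FD_FD_commute:
  fixes f :: "'a::real_normed_vector \<Rightarrow> real"
  assumes S: "open S" "x \<in> S" and C2: "Ck_on (Suc (Suc 0)) S f"
  shows "FD (\<lambda>z. FD f z v) x w = FD (\<lambda>z. FD f z w) x v"
proof (rule ccontr)
  let ?P = "\<lambda>z. FD (\<lambda>z. FD f z v) z w" and ?Q = "\<lambda>z. FD (\<lambda>z. FD f z w) z v"
  assume ne: "?P x \<noteq> ?Q x"
  \<comment> \<open>Half the gap: values within \<open>e\<close> of \<open>?P x\<close> and of
    \<open>?Q x\<close> respectively cannot coincide.\<close>
  define e where "e = \<bar>?P x - ?Q x\<bar> / 2"
  have e: "e > 0" using ne by (simp add: e_def)
  have cont: "continuous_on S ?P" "continuous_on S ?Q" using C2 by auto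
  obtain d1 where d1: "d1 > 0" "\<And>z. z \<in> S \<Longrightarrow> dist z x < d1 \<Longrightarrow> dist (?P z) (?P x) < e"
    using cont(1)[unfolded continuous_on_iff, rule_format, OF S(2) e] by blast
  obtain d2 where d2: "d2 > 0" "\<And>z. z \<in> S \<Longrightarrow> dist z x < d2 \<Longrightarrow> dist (?Q z) (?Q x) < e"
    using cont(2)[unfolded continuous_on_iff, rule_format, OF S(2) e] by blast
  obtain r where r: "r > 0" "ball x r \<subseteq> S" using S open_contains_ball by blast
  define d where "d = Min {d1, d2, r}"
  have d: "d > 0" "d \<le> d1" "d \<le> d2" "d \<le> r" using d1 d2 r by (auto simp: d_def)
  \<comment> \<open>Keeps the whole parallelogram with sides \<open>t\<close> v and \<open>t\<close>
    w inside the ball of radius \<open>d\<close>; the summand 1 makes the bound strict and the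
    denominator nonzero.\<close>
  define t where "t = d / (norm v + norm w + 1)"
  have M: "norm v + norm w + 1 > 0" by (smt (verit) norm_ge_zero)
  have t: "t > 0" using d M by (simp add: t_def)
  have near: "dist (x + a *\<^sub>R v + b *\<^sub>R w) x < d"
    if "0 \<le> a" "a \<le> t" "0 \<le> b" "b \<le> t" for a b
  proof -
    have "dist (x + a *\<^sub>R v + b *\<^sub>R w) x \<le> a * norm v + b * norm w"
      using that norm_triangle_ineq[of "a *\<^sub>R v" "b *\<^sub>R w"] by (simp add: dist_norm add.assoc)
    also have "\<dots> \<le> t * norm v + t * norm w"
      using that by (intro add_mono mult_right_mono) auto
    also have "\<dots> < t * (norm v + norm w + 1)" using t by (simp add: algebra_simps)
    also have "\<dots> = d" using M by (simp add: t_def)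
    finally show ?thesis .
  qed
  have inS: "x + a *\<^sub>R v + b *\<^sub>R w \<in> S" if "0 \<le> a" "a \<le> t" "0 \<le> b" "b \<le> t" for a b
    using near[OF that] d(4) r(2) by (force simp: dist_commute)
  obtain a b where ab: "0 \<le> a" "a \<le> t" "0 \<le> b" "b \<le> t"
    "f (x + t *\<^sub>R v + t *\<^sub>R w) - f (x + t *\<^sub>R v) - f (x + t *\<^sub>R w) + f x =
     t * t * ?P (x + a *\<^sub>R v + b *\<^sub>R w)"
    using second_difference_mvt[OF C2 t inS] by blast
  have inS': "x + a *\<^sub>R w + b *\<^sub>R v \<in> S" if "0 \<le> a" "a \<le> t" "0 \<le> b" "b \<le> t" for a b
    using inS[of b a] that by (simp add: add.assoc add.commute[of "a *\<^sub>R w"])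
  obtain a' b' where ab': "0 \<le> a'" "a' \<le> t" "0 \<le> b'" "b' \<le> t"
    "f (x + t *\<^sub>R w + t *\<^sub>R v) - f (x + t *\<^sub>R w) - f (x + t *\<^sub>R v) + f x =
     t * t * ?Q (x + a' *\<^sub>R w + b' *\<^sub>R v)"
    using second_difference_mvt[OF C2 t inS'] by blast
  have sw: "x + a' *\<^sub>R w + b' *\<^sub>R v = x + b' *\<^sub>R v + a' *\<^sub>R w"
    "x + t *\<^sub>R w + t *\<^sub>R v = x + t *\<^sub>R v + t *\<^sub>R w" by (simp_all add: algebra_simps)
  have "t * t * ?P (x + a *\<^sub>R v + b *\<^sub>R w) = t * t * ?Q (x + b' *\<^sub>R v + a' *\<^sub>R w)"
    using ab(5) ab'(5) unfolding sw by linarith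
  then have eq: "?P (x + a *\<^sub>R v + b *\<^sub>R w) = ?Q (x + b' *\<^sub>R v + a' *\<^sub>R w)" using t by simp
  have "dist (?P (x + a *\<^sub>R v + b *\<^sub>R w)) (?P x) < e"
    using d1(2)[OF inS] near ab d(2) by force
  moreover have "dist (?Q (x + b' *\<^sub>R v + a' *\<^sub>R w)) (?Q x) < e"
    using d2(2)[OF inS] near ab' d(3) by force
  ultimately show False using eq unfolding dist_real_def e_def by argo
qed

text \<open>The primitive is the integral over t in [0, 1] of \<open>\<theta>\<close> at p + t (x -
  p), applied to x - p. After differentiation under the integral, closedness turns the integrand
  into the t-derivative of t times \<open>\<theta>\<close> at p + t (x - p) applied to h, which
  integrates to \<open>\<theta> x h\<close>.\<close>

lemma closed_form_exact_on_ball: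
  fixes \<theta> :: "'a::euclidean_space \<Rightarrow> 'a \<Rightarrow> 'b::euclidean_space"
  assumes lin: "\<And>x. x \<in> ball p r \<Longrightarrow> linear (\<theta> x)"
    and der: "\<And>x v. x \<in> ball p r \<Longrightarrow> ((\<lambda>x. \<theta> x v) has_derivative (\<lambda>h. D x h v)) (at x)"
    and cont: "\<And>h v. continuous_on (ball p r) (\<lambda>x. D x h v)"
    and closed: "\<And>x h v. x \<in> ball p r \<Longrightarrow> D x h v = D x v h"
  obtains \<eta> where "\<And>x. x \<in> ball p r \<Longrightarrow> (\<eta> has_derivative \<theta> x) (at x)"
proof -
  define \<gamma> where "\<gamma> x t = p + t *\<^sub>R (x - p)" for x and t :: real
  have \<gamma>: "\<gamma> x t \<in> ball p r" if "x \<in> ball p r" "t \<in> {0..1}" for x t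
  proof -
    have "t * norm (x - p) \<le> 1 * norm (x - p)" using that by (intro mult_right_mono) auto
    then show ?thesis using that by (simp add: \<gamma>_def dist_norm norm_minus_commute)
  qed
  have linD: "linear (\<lambda>h. D x h v)" "linear (D x v)" if "x \<in> ball p r" for x v
  proof -
    show "linear (\<lambda>h. D x h v)" using has_derivative_linear[OF der[OF that]] .
    moreover have "D x v = (\<lambda>h. D x h v)" using closed[OF that] by auto
    ultimately show "linear (D x v)" by simp
  qed
  have cth: "continuous_on (ball p r) (\<lambda>x. \<theta> x v)" for v
    using der by (meson continuous_at_imp_continuous_on has_derivative_continuous)
  define f where "f x t = \<theta> (\<gamma> x t) (x - p)" for x t
  \<comment> \<open>\<open>leibniz_rule\<close> takes the x-derivative of the integrand as a
    continuous family of bounded linear maps, hence the \<open>Blinfun\<close>.\<close>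
  define fx where "fx x t = Blinfun (\<lambda>h. t *\<^sub>R D (\<gamma> x t) h (x - p) + \<theta> (\<gamma> x t) h)" for x t
  have fx: "blinfun_apply (fx x t) = (\<lambda>h. t *\<^sub>R D (\<gamma> x t) h (x - p) + \<theta> (\<gamma> x t) h)"
    if "x \<in> ball p r" "t \<in> {0..1}" for x t
    unfolding fx_def
    by (intro bounded_linear_Blinfun_apply bounded_linear_add bounded_linear_scaleR_right[THEN bounded_linear_compose])
      (use lin[OF \<gamma>[OF that]] linD[OF \<gamma>[OF that]] in \<open>auto simp: linear_conv_bounded_linear\<close>)
  have cg: "continuous_on (ball p r \<times> {0..1}) (\<lambda>(x, t). \<gamma> x t)"
    unfolding \<gamma>_def by (auto simp: split_beta intro!: continuous_intros)
  have cgt: "continuous_on {0..1} (\<gamma> x)" for x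
    unfolding \<gamma>_def by (auto intro!: continuous_intros)
  have fderiv: "((\<lambda>x. f x t) has_derivative blinfun_apply (fx x t)) (at x within ball p r)"
    if x: "x \<in> ball p r" and t: "t \<in> cbox 0 1" for x t
  proof -
    have t': "t \<in> {0..1}" using t by simp
    \<comment> \<open>The variable occurs both in the base point and in the argument of the form;
      the basis expansion separates the two occurrences, so that the product rule applies.\<close>
    have f_eq: "f z t = (\<Sum>b\<in>Basis. ((z - p) \<bullet> b) *\<^sub>R \<theta> (\<gamma> z t) b)" if "z \<in> ball p r" for z
      unfolding f_def by (rule linear_expand_Basis[OF lin[OF \<gamma>[OF that t']]])
    have g': "((\<lambda>z. \<gamma> z t) has_derivative (\<lambda>h. t *\<^sub>R h)) (at x)"
      unfolding \<gamma>_def by (auto intro!: derivative_eq_intros)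
    have th: "((\<lambda>z. \<theta> (\<gamma> z t) b) has_derivative (\<lambda>h. t *\<^sub>R D (\<gamma> x t) h b)) (at x)" for b
      using has_derivative_compose[OF g' der[OF \<gamma>[OF x t']]]
      by (simp add: linear_scale[OF linD(1)[OF \<gamma>[OF x t']]])
    have "((\<lambda>z. \<Sum>b\<in>Basis. ((z - p) \<bullet> b) *\<^sub>R \<theta> (\<gamma> z t) b) has_derivative
       (\<lambda>h. \<Sum>b\<in>Basis. ((x - p) \<bullet> b) *\<^sub>R (t *\<^sub>R D (\<gamma> x t) h b) + (h \<bullet> b) *\<^sub>R \<theta> (\<gamma> x t) b)) (at x)"
      by (auto intro!: derivative_eq_intros th)
    moreover have "(\<Sum>b\<in>Basis. ((x - p) \<bullet> b) *\<^sub>R (t *\<^sub>R D (\<gamma> x t) h b) + (h \<bullet> b) *\<^sub>R \<theta> (\<gamma> x t) b)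
        = blinfun_apply (fx x t) h" for h
      unfolding fx[OF x t'] linear_expand_Basis[OF linD(2)[OF \<gamma>[OF x t']], of h "x - p"]
        linear_expand_Basis[OF lin[OF \<gamma>[OF x t']], of h]
      by (simp add: sum.distrib scaleR_sum_right mult.commute)
    ultimately have "((\<lambda>z. \<Sum>b\<in>Basis. ((z - p) \<bullet> b) *\<^sub>R \<theta> (\<gamma> z t) b) has_derivative
       blinfun_apply (fx x t)) (at x)" by (simp only:)
    then have "((\<lambda>x. f x t) has_derivative blinfun_apply (fx x t)) (at x)"
      by (rule has_derivative_transform_within_open[OF _ open_ball x]) (simp add: f_eq)
    then show ?thesis by (rule has_derivative_at_withinI)
  qed
  have cfx: "continuous_on (ball p r \<times> cbox 0 1) (\<lambda>(x, t). fx x t)"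
  proof (rule continuous_on_blinfun_componentwise)
    fix i :: 'a assume "i \<in> Basis"
    have "continuous_on (ball p r \<times> {0..1})
      (\<lambda>z. snd z *\<^sub>R (\<Sum>b\<in>Basis. ((fst z - p) \<bullet> b) *\<^sub>R D (case z of (x, t) \<Rightarrow> \<gamma> x t) i b)
         + \<theta> (case z of (x, t) \<Rightarrow> \<gamma> x t) i)"
      by (intro continuous_intros continuous_on_compose2[OF cont cg] continuous_on_compose2[OF cth cg])
        (auto intro!: \<gamma>)
    moreover have "snd z *\<^sub>R (\<Sum>b\<in>Basis. ((fst z - p) \<bullet> b) *\<^sub>R D (case z of (x, t) \<Rightarrow> \<gamma> x t) i b)
         + \<theta> (case z of (x, t) \<Rightarrow> \<gamma> x t) i = blinfun_apply (case z of (x, t) \<Rightarrow> fx x t) i"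
      if "z \<in> ball p r \<times> {0..1}" for z
    proof -
      obtain x t where z: "z = (x, t)" "x \<in> ball p r" "t \<in> {0..1}" using \<open>z \<in> _\<close> by auto
      show ?thesis
        by (simp only: z(1) prod.case fst_conv snd_conv fx[OF z(2,3)]
            linear_expand_Basis[OF linD(2)[OF \<gamma>[OF z(2,3)]], of i "x - p"])
    qed
    ultimately show "continuous_on (ball p r \<times> cbox 0 1) (\<lambda>z. blinfun_apply (case z of (x, t) \<Rightarrow> fx x t) i)"
      by (simp cong: continuous_on_cong)
  qed
  have fint: "f x integrable_on cbox 0 1" if x: "x \<in> ball p r" for x
  proof (rule integrable_continuous)
    show "continuous_on (cbox 0 1) (f x)"
      unfolding f_def by (auto intro!: continuous_on_compose2[OF cth cgt] \<gamma>[OF x])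
  qed
  have main: "((\<lambda>x. integral (cbox 0 1) (f x)) has_derivative \<theta> x) (at x)" if x: "x \<in> ball p r" for x
  proof -
    have cfx1: "continuous_on (cbox 0 1) (fx x)"
      using continuous_on_compose2[OF cfx continuous_on_Pair[OF continuous_on_const continuous_on_id], of x "cbox 0 1"] x
      by (auto simp: image_subset_iff)
    have "blinfun_apply (integral (cbox 0 1) (fx x)) h = \<theta> x h" for h
    proof -
      have "blinfun_apply (integral (cbox 0 1) (fx x)) h = integral (cbox 0 1) (\<lambda>t. blinfun_apply (fx x t) h)"
        by (rule blinfun_apply_integral[OF integrable_continuous[OF cfx1]])
      moreover have "((\<lambda>t. blinfun_apply (fx x t) h) has_integral (1 *\<^sub>R \<theta> (\<gamma> x 1) h - 0 *\<^sub>R \<theta> (\<gamma> x 0) h)) {0..1}"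
      proof (rule fundamental_theorem_of_calculus)
        fix t :: real assume t: "t \<in> {0..1}"
        have "((\<lambda>t. \<gamma> x t) has_derivative (\<lambda>s. s *\<^sub>R (x - p))) (at t)"
          unfolding \<gamma>_def by (auto intro!: derivative_eq_intros)
        from has_derivative_compose[OF this der[OF \<gamma>[OF x t], of h]]
        have "((\<lambda>t. \<theta> (\<gamma> x t) h) has_derivative (\<lambda>s. s *\<^sub>R D (\<gamma> x t) (x - p) h)) (at t)"
          by (simp add: linear_scale[OF linD(1)[OF \<gamma>[OF x t]]])
        then have "((\<lambda>t. t *\<^sub>R \<theta> (\<gamma> x t) h) has_derivative (\<lambda>s. t *\<^sub>R s *\<^sub>R D (\<gamma> x t) (x - p) h + s *\<^sub>R \<theta> (\<gamma> x t) h)) (at t)"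
          by (auto intro!: derivative_eq_intros)
        then have "((\<lambda>t. t *\<^sub>R \<theta> (\<gamma> x t) h) has_vector_derivative blinfun_apply (fx x t) h) (at t)"
          unfolding has_vector_derivative_def fx[OF x t] closed[OF \<gamma>[OF x t], of h]
          by (simp add: algebra_simps)
        then show "((\<lambda>t. t *\<^sub>R \<theta> (\<gamma> x t) h) has_vector_derivative blinfun_apply (fx x t) h) (at t within {0..1})"
          by (rule has_vector_derivative_at_within)
      qed simp
      ultimately show ?thesis by (auto simp: \<gamma>_def integral_unique)
    qed
    then have "blinfun_apply (integral (cbox 0 1) (fx x)) = \<theta> x" by auto
    with leibniz_rule[OF fderiv fint cfx x convex_ball]
    have "((\<lambda>x. integral (cbox 0 1) (f x)) has_derivative \<theta> x) (at x within ball p r)" by simp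
    then show ?thesis using at_within_open[OF x open_ball] by simp
  qed
  show ?thesis using that main by blast
qed

section \<open>Berwald metrics in local coordinates\<close>

lemma Ck_on_const: "Ck_on k S (\<lambda>x. c)"
  by (induction k arbitrary: c) auto

lemma smooth_on_const: "smooth_on S (\<lambda>x. c)"
  unfolding smooth_on_def using Ck_on_const by blast

lemma vec_expand: "(v::real^'n::finite) = (\<Sum>i\<in>UNIV. v $ i *\<^sub>R axis i 1)"
  using basis_expansion[of v] by (simp add: scalar_mult_eq_scaleR)

lemma linear_snd_expand:
  fixes f :: "'a::real_vector \<times> (real^'n::finite) \<Rightarrow> real"
  assumes "linear f" shows "f (0, v) = (\<Sum>i\<in>UNIV. v $ i * f (0, axis i 1))"
proof -
  have "linear (\<lambda>v. f (0, v))"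
    using linear_compose[OF _ assms, of "\<lambda>v. (0, v)"] by (simp add: o_def linear_iff)
  from linear_sum[OF this, of "\<lambda>i. v $ i *\<^sub>R axis i 1" UNIV] linear_scale[OF this]
  have "f (0, \<Sum>i\<in>UNIV. v $ i *\<^sub>R axis i 1) = (\<Sum>i\<in>UNIV. v $ i * f (0, axis i 1))" by simp
  then show ?thesis by (simp only: vec_expand[symmetric])
qed

lemma linear_fst_expand:
  fixes f :: "(real^'n::finite) \<times> 'a::real_vector \<Rightarrow> real"
  assumes "linear f" shows "f (v, 0) = (\<Sum>i\<in>UNIV. v $ i * f (axis i 1, 0))"
proof -
  have "linear (\<lambda>v. f (v, 0))"
    using linear_compose[OF _ assms, of "\<lambda>v. (v, 0)"] by (simp add: o_def linear_iff)
  from linear_sum[OF this, of "\<lambda>i. v $ i *\<^sub>R axis i 1" UNIV] linear_scale[OF this]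
  have "f (\<Sum>i\<in>UNIV. v $ i *\<^sub>R axis i 1, 0) = (\<Sum>i\<in>UNIV. v $ i * f (axis i 1, 0))" by simp
  then show ?thesis by (simp only: vec_expand[symmetric])
qed

section \<open>The energy of a Finsler metric in one chart and its Euler identities\<close>

locale local_finsler =
  fixes L :: "(real^'n::finite) \<times> (real^'n) \<Rightarrow> real" and U :: "(real^'n) set"
  assumes open_U: "open U"
    and smooth_L: "smooth_on (U \<times> (UNIV - {0})) L"
    and homogeneous: "\<And>x y t. x \<in> U \<Longrightarrow> y \<noteq> 0 \<Longrightarrow> t > 0 \<Longrightarrow> L (x, t *\<^sub>R y) = t * L (x, y)"
    and pos_def: "\<And>x y w. x \<in> U \<Longrightarrow> y \<noteq> 0 \<Longrightarrow> w \<noteq> 0 \<Longrightarrow>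
      (\<Sum>i\<in>UNIV. \<Sum>j\<in>UNIV. fund L i j (x, y) * w $ i * w $ j) > 0"
begin

definition E :: "(real^'n) \<times> (real^'n) \<Rightarrow> real" where "E = (\<lambda>z. (L z)\<^sup>2)"

abbreviation (input) "S \<equiv> U \<times> (UNIV - {0 :: real^'n})"

lemma open_S: "open S"
  using open_U by (intro open_Times open_Diff) auto

lemma smooth_E: "smooth_on S E"
  using smooth_on_mult[OF open_S smooth_L smooth_L] by (simp add: E_def power2_eq_square)

lemma pdy_FD: "pdy k f = (\<lambda>z. FD f z (0, axis k 1))"
  by (simp add: pdy_def fun_eq_iff)

lemma fund_eq: "fund L i j = (\<lambda>z. 1/2 * FD (pdy j E) z (0, axis i 1))"
  by (simp add: fund_def E_def pdy_FD fun_eq_iff)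

lemma smooth_pdy: "smooth_on S f \<Longrightarrow> smooth_on S (pdy k f)"
  unfolding pdy_FD by (rule smooth_on_FD)

lemma smooth_fund: "smooth_on S (fund L i j)"
  unfolding fund_eq
  by (intro smooth_on_mult[OF open_S] smooth_on_const smooth_on_FD smooth_pdy smooth_E)

lemma deriv_smooth: "smooth_on S f \<Longrightarrow> z \<in> S \<Longrightarrow> (f has_derivative FD f z) (at z)"
  by (intro has_derivative_FD smooth_on_differentiable)

text \<open>The derivative at t = 1 of E (x, t y) = t^2 E (x, y).\<close>

lemma euler: assumes "z \<in> S" shows "(\<Sum>j\<in>UNIV. snd z $ j * pdy j E z) = 2 * E z"
proof -
  obtain x y where z: "z = (x, y)" "x \<in> U" "y \<noteq> 0" using assms by auto
  have "((\<lambda>t. (x, t *\<^sub>R y)) has_derivative (\<lambda>h. (0, h *\<^sub>R y))) (at (1::real))"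
    by (auto intro!: derivative_eq_intros)
  from has_derivative_compose[OF this, of E "FD E z"] deriv_smooth[OF smooth_E assms]
  have d1: "((\<lambda>t. E (x, t *\<^sub>R y)) has_derivative (\<lambda>h. FD E z (0, h *\<^sub>R y))) (at 1)"
    by (simp add: z)
  have "((\<lambda>t. t\<^sup>2 * E z) has_derivative (\<lambda>h. 2 * h * E z)) (at (1::real))"
    by (auto intro!: derivative_eq_intros)
  then have "((\<lambda>t. E (x, t *\<^sub>R y)) has_derivative (\<lambda>h. 2 * h * E z)) (at 1)"
    by (rule has_derivative_transform_within_open[of _ _ _ _ "{0<..}"])
      (use z homogeneous in \<open>auto simp: E_def power_mult_distrib\<close>)
  from fun_cong[OF has_derivative_unique[OF d1 this], of 1]
  have "FD E z (0, y) = 2 * E z" by simp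
  then show ?thesis
    using linear_snd_expand[OF has_derivative_linear[OF deriv_smooth[OF smooth_E assms]], of y]
    by (simp add: pdy_def z)
qed

lemma FD_eq_on_S:
  assumes "z \<in> S" "(f has_derivative f') (at z)" "(g has_derivative g') (at z)"
    and "\<And>w. w \<in> S \<Longrightarrow> f w = g w"
  shows "f' v = g' v"
  using has_derivative_unique[OF assms(3) has_derivative_transform_within_open[OF assms(2) open_S assms(1,4)]]
  by simp

lemma contraction_deriv:
  assumes z: "z \<in> S" and f: "\<And>j. smooth_on S (f j)"
  shows "((\<lambda>z. \<Sum>j\<in>UNIV. snd z $ j * f j z) has_derivative
    (\<lambda>v. \<Sum>j\<in>UNIV. snd z $ j * FD (f j) z v + snd v $ j * f j z)) (at z)"
proof -
  have "((\<lambda>z. snd z $ j) has_derivative (\<lambda>v. snd v $ j)) (at z)" for j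
    by (intro bounded_linear_imp_has_derivative bounded_linear_compose[OF bounded_linear_vec_nth]
        bounded_linear_snd)
  then show ?thesis
    using has_derivative_mult[OF _ deriv_smooth[OF f z]] by (intro has_derivative_sum) blast
qed

text \<open>The direction \<open>v\<close> may be vertical or horizontal: the vertical case gives
  \<open>fund_contract\<close>, the horizontal one is used in \<open>pdx_E\<close>.\<close>

lemma euler_deriv:
  assumes z: "z \<in> S"
  shows "(\<Sum>j\<in>UNIV. snd z $ j * FD (pdy j E) z v + snd v $ j * pdy j E z) = 2 * FD E z v"
proof -
  have "((\<lambda>z. 2 * E z) has_derivative (\<lambda>v. 2 * FD E z v)) (at z)"
    by (intro has_derivative_mult_right deriv_smooth smooth_E z)
  from FD_eq_on_S[OF z contraction_deriv[OF z smooth_pdy[OF smooth_E]] this] show ?thesis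
    using euler by auto
qed

lemma axis_sum: "(\<Sum>j\<in>UNIV. axis i (1::real) $ j * f j) = f i"
  by (simp add: axis_def if_distrib[of "\<lambda>x. x * _"] cong: if_cong)

lemma fund_contract:
  assumes z: "z \<in> S"
  shows "(\<Sum>j\<in>UNIV. snd z $ j * fund L i j z) = pdy i E z / 2"
  using euler_deriv[OF z, of "(0, axis i 1)"]
  by (simp add: sum.distrib axis_sum fund_eq sum_divide_distrib[symmetric] pdy_def[of i])

lemma fund_contract_deriv:
  assumes z: "z \<in> S"
  shows "(\<Sum>j\<in>UNIV. snd z $ j * FD (fund L i j) z v + snd v $ j * fund L i j z) = FD (pdy i E) z v / 2"
proof -
  have "((\<lambda>z. 1/2 * pdy i E z) has_derivative (\<lambda>v. 1/2 * FD (pdy i E) z v)) (at z)"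
    by (intro has_derivative_mult_right deriv_smooth smooth_pdy smooth_E z)
  from FD_eq_on_S[OF z contraction_deriv[OF z smooth_fund] this] show ?thesis
    using fund_contract by auto
qed

lemma fund_sym: "z \<in> S \<Longrightarrow> fund L i j z = fund L j i z"
  using FD_FD_commute[OF open_S, of z E "(0, axis j 1)" "(0, axis i 1)"] smooth_E
  by (simp add: fund_eq pdy_FD smooth_on_def del: Ck_on.simps)

lemma FD_fund_sym: "z \<in> S \<Longrightarrow> FD (fund L i j) z = FD (fund L j i) z"
  by (rule FD_cong_open[OF open_S]) (auto intro: fund_sym)

lemma pdy_fund:
  assumes z: "z \<in> S" shows "pdy k (fund L i j) z = 1/2 * FD (\<lambda>z. FD (pdy j E) z (0, axis i 1)) z (0, axis k 1)"
proof -
  have "(fund L i j has_derivative (\<lambda>v. 1/2 * FD (\<lambda>z. FD (pdy j E) z (0, axis i 1)) z v)) (at z)"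
    unfolding fund_eq by (intro has_derivative_mult_right deriv_smooth smooth_on_FD smooth_pdy smooth_E z)
  from FD_eqI[OF this] show ?thesis by (simp add: pdy_def)
qed

lemma pdy_fund_swap: "z \<in> S \<Longrightarrow> pdy k (fund L i j) z = pdy i (fund L k j) z"
  using FD_FD_commute[OF open_S, of z "pdy j E" "(0, axis i 1)" "(0, axis k 1)"] smooth_pdy[OF smooth_E, of j]
  by (simp add: pdy_fund smooth_on_def del: Ck_on.simps)

lemma pdy_fund_sym: "z \<in> S \<Longrightarrow> pdy k (fund L i j) z = pdy k (fund L j i) z"
  by (simp add: pdy_def FD_fund_sym)

text \<open>The fundamental tensor is homogeneous of degree 0 in y, so its y-derivative, symmetric
  in all three indices, is annihilated by y in every slot. Concretely, differentiating
  \<open>fund_contract\<close> in y produces the same term \<open>fund L i k\<close> on both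
  sides.\<close>

lemma cartan_contract:
  assumes z: "z \<in> S"
  shows "(\<Sum>j\<in>UNIV. snd z $ j * pdy k (fund L i j) z) = 0"
    "(\<Sum>j\<in>UNIV. snd z $ j * pdy k (fund L j i) z) = 0"
    "(\<Sum>j\<in>UNIV. snd z $ j * pdy j (fund L i k) z) = 0"
proof -
  have *: "(\<Sum>j\<in>UNIV. snd z $ j * pdy k (fund L i j) z) = 0" for i k
    using fund_contract_deriv[OF z, of i "(0, axis k 1)"] fund_sym[OF z, of i k]
    by (simp add: sum.distrib axis_sum fund_eq[of k i] pdy_def[of k "fund L i _"])
  then show "(\<Sum>j\<in>UNIV. snd z $ j * pdy k (fund L i j) z) = 0" .
  show "(\<Sum>j\<in>UNIV. snd z $ j * pdy k (fund L j i) z) = 0"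
    using *[of k i] pdy_fund_sym[OF z, of k i] by simp
  have "pdy j (fund L i k) z = pdy i (fund L k j) z" for j
    using pdy_fund_swap[OF z, of j i k] pdy_fund_sym[OF z, of i j k] by simp
  then show "(\<Sum>j\<in>UNIV. snd z $ j * pdy j (fund L i k) z) = 0"
    using *[of i k] by simp
qed

lemma pdx_E:
  assumes z: "z \<in> S"
  shows "pdx k E z = (\<Sum>i\<in>UNIV. \<Sum>j\<in>UNIV. snd z $ i * snd z $ j * pdx k (fund L i j) z)"
proof -
  have "(\<Sum>i\<in>UNIV. snd z $ i * FD (pdy i E) z (axis k 1, 0)) = 2 * pdx k E z"
    using euler_deriv[OF z, of "(axis k 1, 0)"] by (simp add: pdx_def)
  moreover have "FD (pdy i E) z (axis k 1, 0) = 2 * (\<Sum>j\<in>UNIV. snd z $ j * pdx k (fund L i j) z)" for i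
    using fund_contract_deriv[OF z, of i "(axis k 1, 0)"] by (simp add: pdx_def)
  ultimately have "2 * pdx k E z = 2 * (\<Sum>i\<in>UNIV. snd z $ i * (\<Sum>j\<in>UNIV. snd z $ j * pdx k (fund L i j) z))"
    by (simp add: sum_distrib_left mult.assoc mult.left_commute)
  then have "pdx k E z = (\<Sum>i\<in>UNIV. snd z $ i * (\<Sum>j\<in>UNIV. snd z $ j * pdx k (fund L i j) z))"
    by linarith
  then show ?thesis by (simp add: sum_distrib_left mult.assoc)
qed

text \<open>Positive definiteness makes the kernel trivial. As \<open>matrix_inv\<close> is a choice
  of a two-sided inverse, the existence of one has to be established before the choice can be
  used.\<close>

lemma fund_fund_inv:
  assumes z: "z \<in> S"
  shows "(\<Sum>s\<in>UNIV. fund L i s z * fund_inv L s l z) = (if i = l then 1 else 0)"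
proof -
  let ?M = "\<chi> a b. fund L a b z"
  obtain x y where xy: "z = (x, y)" "x \<in> U" "y \<noteq> 0" using z by auto
  have "w = 0" if "?M *v w = 0" for w
  proof (rule ccontr)
    assume "w \<noteq> 0"
    from pos_def[OF xy(2,3) this] have "(\<Sum>i\<in>UNIV. w $ i * (?M *v w) $ i) > 0"
      by (simp add: matrix_vector_mult_def xy(1) sum_distrib_left mult.commute mult.left_commute)
    then show False using that by simp
  qed
  then obtain B where "B ** ?M = mat 1" using matrix_left_invertible_ker by blast
  then have "\<exists>B. ?M ** B = mat 1 \<and> B ** ?M = mat 1" using matrix_left_right_inverse by blast
  then have "?M ** matrix_inv ?M = mat 1" unfolding matrix_inv_def by (rule someI2_ex) simp
  then have "(?M ** matrix_inv ?M) $ i $ l = mat 1 $ i $ l" by simp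
  then show ?thesis by (simp add: matrix_matrix_mult_def fund_inv_def mat_def)
qed

section \<open>Nonlinear and Chern connections with lowered indices\<close>

text \<open>The prefix \<open>low_\<close> marks the version of a symbol whose upper index is lowered by \<open>g\<^sub>i\<^sub>j\<close>;
  \<open>spray k\<close> is \<open>2G\<^sup>k\<close> in the usual notation.\<close>
definition low_christoffel :: "'n \<Rightarrow> 'n \<Rightarrow> 'n \<Rightarrow> (real^'n) \<times> (real^'n) \<Rightarrow> real" where
  "low_christoffel l j k z =
    (pdx k (fund L l j) z + pdx j (fund L l k) z - pdx l (fund L j k) z) / 2"

definition spray :: "'n \<Rightarrow> (real^'n) \<times> (real^'n) \<Rightarrow> real" where
  "spray k z = (\<Sum>r\<in>UNIV. \<Sum>s\<in>UNIV. formal_christoffel L k r s z * snd z $ r * snd z $ s)"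

definition low_conn :: "'n \<Rightarrow> 'n \<Rightarrow> (real^'n) \<times> (real^'n) \<Rightarrow> real" where
  "low_conn l j z = (\<Sum>k\<in>UNIV. low_christoffel l j k z * snd z $ k)
     - (\<Sum>k\<in>UNIV. cartan_tensor L l j k z * spray k z)"

lemma formal_christoffel_low:
  "formal_christoffel L i j k z = (\<Sum>l\<in>UNIV. fund_inv L i l z * low_christoffel l j k z)"
  by (simp add: formal_christoffel_def low_christoffel_def sum_divide_distrib)

lemma nonlin_conn_low: "nonlin_conn L i j z = (\<Sum>l\<in>UNIV. fund_inv L i l z * low_conn l j z)"
proof -
  have "(\<Sum>k\<in>UNIV. formal_christoffel L i j k z * snd z $ k)
      = (\<Sum>l\<in>UNIV. fund_inv L i l z * (\<Sum>k\<in>UNIV. low_christoffel l j k z * snd z $ k))"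
    unfolding formal_christoffel_low sum_distrib_left sum_distrib_right
    by (subst sum.swap) (simp add: mult.assoc)
  moreover have "(\<Sum>k\<in>UNIV. \<Sum>l\<in>UNIV. \<Sum>r\<in>UNIV. \<Sum>s\<in>UNIV.
        fund_inv L i l z * cartan_tensor L l j k z * formal_christoffel L k r s z * snd z $ r * snd z $ s)
      = (\<Sum>l\<in>UNIV. fund_inv L i l z * (\<Sum>k\<in>UNIV. cartan_tensor L l j k z * spray k z))"
    unfolding spray_def sum_distrib_left
    by (subst sum.swap) (simp add: mult.assoc)
  ultimately show ?thesis
    by (simp add: nonlin_conn_def low_conn_def right_diff_distrib sum_subtractf)
qed

text \<open>Contraction with y kills the Cartan term of the nonlinear connection and leaves the
  formal Christoffel symbols contracted twice with y.\<close>

lemma nonlin_conn_contract: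
  assumes z: "z \<in> S"
  shows "(\<Sum>k\<in>UNIV. snd z $ k * nonlin_conn L i k z) = spray i z"
proof -
  have "(\<Sum>k\<in>UNIV. snd z $ k * (\<Sum>m\<in>UNIV. cartan_tensor L l k m z * spray m z)) = 0" for l
  proof -
    have "(\<Sum>k\<in>UNIV. snd z $ k * (\<Sum>m\<in>UNIV. cartan_tensor L l k m z * spray m z))
        = (\<Sum>m\<in>UNIV. (\<Sum>k\<in>UNIV. snd z $ k * pdy m (fund L l k) z) * spray m z / 2)"
      unfolding sum_distrib_left sum_distrib_right sum_divide_distrib cartan_tensor_def
      by (subst sum.swap) (simp add: mult.assoc)
    then show ?thesis by (simp add: cartan_contract(1)[OF z])
  qed
  then have *: "(\<Sum>k\<in>UNIV. snd z $ k * low_conn l k z)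
      = (\<Sum>k\<in>UNIV. \<Sum>m\<in>UNIV. low_christoffel l k m z * snd z $ k * snd z $ m)" for l
    by (simp add: low_conn_def right_diff_distrib sum_subtractf sum_distrib_left mult.assoc mult.left_commute)
  have "(\<Sum>k\<in>UNIV. snd z $ k * nonlin_conn L i k z)
      = (\<Sum>l\<in>UNIV. fund_inv L i l z * (\<Sum>k\<in>UNIV. snd z $ k * low_conn l k z))"
    unfolding nonlin_conn_low sum_distrib_left by (subst sum.swap) (simp add: mult.left_commute)
  also have "\<dots> = (\<Sum>l\<in>UNIV. \<Sum>k\<in>UNIV. \<Sum>m\<in>UNIV. fund_inv L i l z * low_christoffel l k m z * snd z $ k * snd z $ m)"
    unfolding * by (simp add: sum_distrib_left mult.assoc)
  also have "\<dots> = (\<Sum>k\<in>UNIV. \<Sum>l\<in>UNIV. \<Sum>m\<in>UNIV. fund_inv L i l z * low_christoffel l k m z * snd z $ k * snd z $ m)"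
    by (rule sum.swap)
  also have "\<dots> = (\<Sum>k\<in>UNIV. \<Sum>m\<in>UNIV. \<Sum>l\<in>UNIV. fund_inv L i l z * low_christoffel l k m z * snd z $ k * snd z $ m)"
    by (intro sum.cong refl sum.swap)
  also have "\<dots> = spray i z"
    unfolding spray_def formal_christoffel_low by (simp add: sum_distrib_right)
  finally show ?thesis .
qed

definition low_chern :: "'n \<Rightarrow> 'n \<Rightarrow> 'n \<Rightarrow> (real^'n) \<times> (real^'n) \<Rightarrow> real" where
  "low_chern l j k z =
    (horiz_deriv L k (fund L l j) z + horiz_deriv L j (fund L l k) z - horiz_deriv L l (fund L j k) z) / 2"

lemma chern_low:
  "chern_christoffel L i j k z = (\<Sum>l\<in>UNIV. fund_inv L i l z * low_chern l j k z)"
  by (simp add: chern_christoffel_def low_chern_def sum_divide_distrib)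

text \<open>Of the three horizontal derivatives, the vertical parts of the last two are killed by
  contraction with y (\<open>cartan_contract\<close>). In the first one y turns the nonlinear
  connection into the spray, which reproduces the Cartan term of \<open>low_conn\<close>.\<close>

lemma low_chern_contract:
  assumes z: "z \<in> S"
  shows "(\<Sum>k\<in>UNIV. low_chern l j k z * snd z $ k) = low_conn l j z"
proof -
  have a: "(\<Sum>k\<in>UNIV. snd z $ k * (\<Sum>s\<in>UNIV. nonlin_conn L s k z * pdy s (fund L l j) z))
      = (\<Sum>s\<in>UNIV. pdy s (fund L l j) z * spray s z)"
    unfolding nonlin_conn_contract[OF z, symmetric] sum_distrib_left
    by (subst sum.swap) (simp add: mult.left_commute mult.commute)
  have b: "(\<Sum>k\<in>UNIV. snd z $ k * (\<Sum>s\<in>UNIV. nonlin_conn L s i z * pdy s (fund L m k) z)) = 0" for i m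
  proof -
    have "(\<Sum>k\<in>UNIV. snd z $ k * (\<Sum>s\<in>UNIV. nonlin_conn L s i z * pdy s (fund L m k) z))
        = (\<Sum>s\<in>UNIV. nonlin_conn L s i z * (\<Sum>k\<in>UNIV. snd z $ k * pdy s (fund L m k) z))"
      unfolding sum_distrib_left by (subst sum.swap) (simp add: mult.left_commute)
    then show ?thesis by (simp add: cartan_contract(1)[OF z])
  qed
  have "2 * (\<Sum>k\<in>UNIV. low_chern l j k z * snd z $ k)
      = (\<Sum>k\<in>UNIV. snd z $ k * horiz_deriv L k (fund L l j) z)
      + (\<Sum>k\<in>UNIV. snd z $ k * horiz_deriv L j (fund L l k) z)
      - (\<Sum>k\<in>UNIV. snd z $ k * horiz_deriv L l (fund L j k) z)"
    unfolding low_chern_def sum.distrib[symmetric] sum_subtractf[symmetric] sum_distrib_left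
    by (rule sum.cong) (auto simp: field_simps)
  also have "\<dots> = (\<Sum>k\<in>UNIV. snd z $ k * pdx k (fund L l j) z)
      + (\<Sum>k\<in>UNIV. snd z $ k * pdx j (fund L l k) z)
      - (\<Sum>k\<in>UNIV. snd z $ k * pdx l (fund L j k) z)
      - (\<Sum>s\<in>UNIV. pdy s (fund L l j) z * spray s z)"
    unfolding horiz_deriv_def right_diff_distrib sum_subtractf a b by simp
  also have "\<dots> = 2 * low_conn l j z"
  proof -
    have "(\<Sum>k\<in>UNIV. snd z $ k * pdx k (fund L l j) z)
      + (\<Sum>k\<in>UNIV. snd z $ k * pdx j (fund L l k) z)
      - (\<Sum>k\<in>UNIV. snd z $ k * pdx l (fund L j k) z) = 2 * (\<Sum>k\<in>UNIV. low_christoffel l j k z * snd z $ k)"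
      unfolding low_christoffel_def sum.distrib[symmetric] sum_subtractf[symmetric] sum_distrib_left
      by (rule sum.cong) (auto simp: field_simps)
    moreover have "(\<Sum>s\<in>UNIV. pdy s (fund L l j) z * spray s z)
        = 2 * (\<Sum>k\<in>UNIV. cartan_tensor L l j k z * spray k z)"
      by (simp add: cartan_tensor_def sum_distrib_left)
    ultimately show ?thesis by (simp add: low_conn_def)
  qed
  finally show ?thesis by simp
qed

text \<open>The reason why Christoffel symbols that are independent of y give a nonlinear connection
  that is linear in y.\<close>

lemma nonlin_conn_chern:
  assumes z: "z \<in> S"
  shows "nonlin_conn L i j z = (\<Sum>k\<in>UNIV. chern_christoffel L i j k z * snd z $ k)"
  unfolding nonlin_conn_low low_chern_contract[OF z, symmetric] chern_low sum_distrib_left sum_distrib_right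
  by (subst sum.swap) (simp add: mult.assoc)

lemma chern_sym: "z \<in> S \<Longrightarrow> chern_christoffel L i j k z = chern_christoffel L i k j z"
  unfolding chern_low low_chern_def horiz_deriv_def pdx_def pdy_def
  by (simp add: FD_fund_sym[of z j k] add.commute)

text \<open>The horizontal derivative of \<open>E\<close> is 0. Since \<open>pdy s E\<close> is 2
  g_js y^j, the right side is 2 y^j times the lowered connection. The Cartan part drops out, and two
  of the three derivatives in the lowered Christoffel symbol cancel because y^j y^m is symmetric;
  the survivor is \<open>pdx_E\<close>.\<close>

lemma horizontally_constant:
  assumes z: "z \<in> S"
  shows "pdx k E z = (\<Sum>s\<in>UNIV. nonlin_conn L s k z * pdy s E z)"
proof -
  let ?y = "\<lambda>i. snd z $ i"
  have lower: "(\<Sum>s\<in>UNIV. fund L j s z * nonlin_conn L s k z) = low_conn j k z" for j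
  proof -
    have "(\<Sum>s\<in>UNIV. fund L j s z * nonlin_conn L s k z)
        = (\<Sum>l\<in>UNIV. (\<Sum>s\<in>UNIV. fund L j s z * fund_inv L s l z) * low_conn l k z)"
      unfolding nonlin_conn_low sum_distrib_left sum_distrib_right
      by (subst sum.swap) (simp add: mult.assoc)
    then show ?thesis
      by (simp add: fund_fund_inv[OF z] if_distrib[of "\<lambda>x. x * _"] cong: if_cong)
  qed
  have "pdy s E z = 2 * (\<Sum>j\<in>UNIV. ?y j * fund L j s z)" for s
    using fund_contract[OF z, of s] fund_sym[OF z, of s] by simp
  then have "(\<Sum>s\<in>UNIV. nonlin_conn L s k z * pdy s E z)
      = (\<Sum>s\<in>UNIV. nonlin_conn L s k z * (2 * (\<Sum>j\<in>UNIV. ?y j * fund L j s z)))" by simp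
  also have "\<dots> = 2 * (\<Sum>j\<in>UNIV. ?y j * (\<Sum>s\<in>UNIV. fund L j s z * nonlin_conn L s k z))"
    unfolding sum_distrib_left by (subst sum.swap) (simp add: mult_ac)
  also have "\<dots> = 2 * (\<Sum>j\<in>UNIV. ?y j * low_conn j k z)" unfolding lower ..
  also have "(\<Sum>j\<in>UNIV. ?y j * low_conn j k z)
      = (\<Sum>j\<in>UNIV. \<Sum>m\<in>UNIV. ?y j * ?y m * low_christoffel j k m z)"
  proof -
    have "(\<Sum>j\<in>UNIV. ?y j * (\<Sum>m\<in>UNIV. cartan_tensor L j k m z * spray m z))
        = (\<Sum>m\<in>UNIV. (\<Sum>j\<in>UNIV. ?y j * pdy m (fund L j k) z) * spray m z / 2)"
      unfolding sum_distrib_left sum_distrib_right sum_divide_distrib cartan_tensor_def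
      by (subst sum.swap) (simp add: mult.assoc)
    also have "\<dots> = 0" by (simp add: cartan_contract(2)[OF z])
    finally show ?thesis
      by (simp add: low_conn_def right_diff_distrib sum_subtractf sum_distrib_left mult_ac)
  qed
  also have "2 * \<dots> = (\<Sum>j\<in>UNIV. \<Sum>m\<in>UNIV. ?y j * ?y m * pdx m (fund L j k) z)
      + (\<Sum>j\<in>UNIV. \<Sum>m\<in>UNIV. ?y j * ?y m * pdx k (fund L j m) z)
      - (\<Sum>j\<in>UNIV. \<Sum>m\<in>UNIV. ?y j * ?y m * pdx j (fund L k m) z)"
    unfolding low_christoffel_def sum.distrib[symmetric] sum_subtractf[symmetric] sum_distrib_left
    by (intro sum.cong refl) (auto simp: field_simps)
  also have "(\<Sum>j\<in>UNIV. \<Sum>m\<in>UNIV. ?y j * ?y m * pdx m (fund L j k) z)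
      = (\<Sum>j\<in>UNIV. \<Sum>m\<in>UNIV. ?y j * ?y m * pdx j (fund L k m) z)"
    by (subst sum.swap) (simp add: mult.commute pdx_def FD_fund_sym[OF z, of k])
  finally show ?thesis using pdx_E[OF z] by simp
qed

text \<open>The symbols are read off at one direction and, by the Berwald condition, serve for all
  of them. The last property is \<open>horizontally_constant\<close> with the nonlinear connection
  written as \<open>\<Gamma>\<close>.\<close>

lemma berwald_connection:
  assumes x: "x \<in> U"
    and berwald: "\<And>i j k y y'. y \<noteq> 0 \<Longrightarrow> y' \<noteq> 0 \<Longrightarrow>
      chern_christoffel L i j k (x, y) = chern_christoffel L i j k (x, y')"
  obtains \<Gamma> :: "real^'n \<Rightarrow> real^'n \<Rightarrow> real^'n"
  where "\<And>u. linear (\<Gamma> u)" "\<And>u v. \<Gamma> u v = \<Gamma> v u"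
    "\<And>u y. y \<noteq> 0 \<Longrightarrow> FD E (x, y) (u, 0) = FD E (x, y) (0, \<Gamma> u y)"
proof -
  \<comment> \<open>Any nonzero direction would do; here it is the vector with all components
    1.\<close>
  define y0 :: "real^'n" where "y0 = 1"
  have y0: "y0 \<noteq> 0" by (simp add: y0_def)
  define c where "c i j k = chern_christoffel L i j k (x, y0)" for i j k
  define \<Gamma> where "\<Gamma> u v = (\<chi> s. \<Sum>k\<in>UNIV. u $ k * (\<Sum>j\<in>UNIV. c s k j * v $ j))" for u v :: "real^'n"
  have csym: "c i j k = c i k j" for i j k
    unfolding c_def using x y0 by (intro chern_sym) auto
  show ?thesis
  proof (rule that[of \<Gamma>])
    show "linear (\<Gamma> u)" for u
      by (rule linearI)
        (auto simp: \<Gamma>_def vec_eq_iff distrib_left sum.distrib sum_distrib_left mult_ac)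
    show "\<Gamma> u v = \<Gamma> v u" for u v
    proof -
      have "(\<Sum>k\<in>UNIV. u $ k * (\<Sum>j\<in>UNIV. c s k j * v $ j)) = (\<Sum>k\<in>UNIV. v $ k * (\<Sum>j\<in>UNIV. c s k j * u $ j))" for s
        unfolding sum_distrib_left using csym[of s] by (subst sum.swap) (simp add: mult_ac)
      then show ?thesis by (simp add: \<Gamma>_def)
    qed
    show "FD E (x, y) (u, 0) = FD E (x, y) (0, \<Gamma> u y)" if y: "y \<noteq> 0" for u y
    proof -
      have z: "(x, y) \<in> S" using x y by simp
      have lin: "linear (FD E (x, y))"
        using has_derivative_linear[OF deriv_smooth[OF smooth_E z]] .
      have N: "nonlin_conn L s k (x, y) = (\<Sum>j\<in>UNIV. c s k j * y $ j)" for s k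
        using nonlin_conn_chern[OF z] berwald[OF y y0] by (simp add: c_def)
      have "FD E (x, y) (u, 0) = (\<Sum>k\<in>UNIV. u $ k * pdx k E (x, y))"
        using linear_fst_expand[OF lin, of u] by (simp add: pdx_def)
      also have "\<dots> = (\<Sum>s\<in>UNIV. (\<Gamma> u y) $ s * pdy s E (x, y))"
        unfolding horizontally_constant[OF z] N \<Gamma>_def vec_lambda_beta sum_distrib_left[of "_ $ _"]
        by (subst sum.swap) (simp add: sum_distrib_left sum_distrib_right mult_ac)
      also have "\<dots> = FD E (x, y) (0, \<Gamma> u y)"
        using linear_snd_expand[OF lin, of "\<Gamma> u y"] by (simp add: pdy_def)
      finally show ?thesis .
    qed
  qed
qed

end

section \<open>The infinitesimal symmetries of an (alpha, beta)-norm\<close>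

text \<open>\<open>phi_conv\<close> is the convexity condition of an (\<alpha>, \<beta>)-metric at b
  = |s|, where the second derivative drops out.\<close>

locale alpha_beta_norm =
  fixes B :: "'a::real_normed_vector \<Rightarrow> 'a \<Rightarrow> real" and X :: 'a and \<phi> :: "real \<Rightarrow> real" and b0 :: real
  assumes bil: "bounded_bilinear B"
    and B_sym: "\<And>u v. B u v = B v u"
    and B_pos: "\<And>u. u \<noteq> 0 \<Longrightarrow> B u u > 0"
    and phi_diff: "\<And>s. \<bar>s\<bar> < b0 \<Longrightarrow> \<phi> differentiable (at s)"
    and phi_pos: "\<And>s. \<bar>s\<bar> < b0 \<Longrightarrow> \<phi> s > 0"
    and phi_conv: "\<And>s. \<bar>s\<bar> < b0 \<Longrightarrow> \<phi> s - s * deriv \<phi> s > 0"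
    and X_small: "sqrt (B X X) < b0"
begin

interpretation bounded_bilinear B by (rule bil)

lemma B_nonneg: "B u u \<ge> 0"
  using B_pos[of u] zero_left by (cases "u = 0") auto

lemma B_eq_0_iff: "B u u = 0 \<longleftrightarrow> u = 0"
  using B_pos[of u] zero_left by force

definition ratio :: "'a \<Rightarrow> real" where "ratio y = B X y / sqrt (B y y)"

lemma cauchy_schwarz: "(B X y)\<^sup>2 \<le> B X X * B y y"
proof (cases "y = 0")
  case False
  then have y: "B y y > 0" by (rule B_pos)
  have "0 \<le> B (B y y *\<^sub>R X - B X y *\<^sub>R y) (B y y *\<^sub>R X - B X y *\<^sub>R y)" by (rule B_nonneg)
  also have "\<dots> = B y y * (B X X * B y y - (B X y)\<^sup>2)"
    by (simp add: diff_left diff_right scaleR_left scaleR_right B_sym[of y X] algebra_simps power2_eq_square)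
  finally show ?thesis using y by (simp add: zero_le_mult_iff)
qed (simp add: zero_right)

lemma ratio_bound: "\<bar>ratio y\<bar> \<le> sqrt (B X X)"
proof (cases "y = 0")
  case False
  have "\<bar>B X y\<bar> = sqrt ((B X y)\<^sup>2)" by simp
  also have "\<dots> \<le> sqrt (B X X) * sqrt (B y y)"
    using real_sqrt_le_mono[OF cauchy_schwarz[of y]] by (simp add: real_sqrt_mult)
  finally show ?thesis using B_pos[OF False] by (simp add: ratio_def pos_divide_le_eq)
qed (simp add: ratio_def zero_right B_nonneg)

lemma ratio_small: "\<bar>ratio y\<bar> < b0"
  using ratio_bound X_small by (rule le_less_trans)

lemma square_norm_derivative:
  assumes y: "y \<noteq> 0"
  shows "((\<lambda>y. (sqrt (B y y) * \<phi> (ratio y))\<^sup>2) has_derivative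
    (\<lambda>z. 2 * \<phi> (ratio y) * ((\<phi> (ratio y) - ratio y * deriv \<phi> (ratio y)) * B y z
       + sqrt (B y y) * deriv \<phi> (ratio y) * B X z))) (at y)"
proof -
  let ?a = "B y y" and ?s = "ratio y"
  have a: "?a > 0" using B_pos[OF y] .
  have dB: "((\<lambda>y. B y y) has_derivative (\<lambda>z. 2 * B y z)) (at y)"
    using FDERIV[OF has_derivative_ident has_derivative_ident, of y UNIV] B_sym[of _ y] by simp
  have dX: "((\<lambda>y. B X y) has_derivative (\<lambda>z. B X z)) (at y)"
    by (rule bounded_linear_imp_has_derivative[OF bounded_linear_right])
  have dq: "((\<lambda>y. sqrt (B y y)) has_derivative (\<lambda>z. B y z / sqrt ?a)) (at y)"
    using has_derivative_real_sqrt[OF a dB] by (simp add: field_simps)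
  have ds: "(ratio has_derivative (\<lambda>z. (B X z * sqrt ?a - B X y * (B y z / sqrt ?a)) / ?a)) (at y)"
    unfolding ratio_def
    by (rule has_derivative_eq_rhs[OF has_derivative_divide'[OF dX dq]]) (use a in auto)
  have "(\<phi> has_derivative (\<lambda>h. deriv \<phi> ?s * h)) (at ?s)"
    using phi_diff[OF ratio_small[of y]] DERIV_deriv_iff_real_differentiable
    by (simp add: has_field_derivative_def)
  from has_derivative_compose[OF ds this]
  have dphi: "((\<lambda>y. \<phi> (ratio y)) has_derivative
     (\<lambda>z. deriv \<phi> ?s * ((B X z * sqrt ?a - B X y * (B y z / sqrt ?a)) / ?a))) (at y)" .
  have sq: "sqrt ?a * sqrt ?a = ?a" "sqrt ?a > 0" using a by auto
  have "2 * (sqrt ?a * \<phi> ?s) * (sqrt ?a * (deriv \<phi> ?s * ((B X z * sqrt ?a - B X y * (B y z / sqrt ?a)) / ?a))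
       + B y z / sqrt ?a * \<phi> ?s) = 2 * \<phi> ?s * ((\<phi> ?s - ?s * deriv \<phi> ?s) * B y z + sqrt ?a * deriv \<phi> ?s * B X z)"
    for z
  proof -
    have bx: "B X y = ?s * sqrt ?a" using sq by (simp add: ratio_def)
    define q where "q = sqrt ?a"
    have q: "?a = q * q" "q > 0" using sq by (simp_all add: q_def)
    show ?thesis unfolding bx q_def[symmetric] unfolding q(1) using q(2) by (simp add: field_simps)
  qed
  moreover have "F * G + G * F = 2 * F * G" for F G :: real by algebra
  ultimately show ?thesis
    unfolding power2_eq_square
    by (intro has_derivative_eq_rhs[OF has_derivative_mult[OF has_derivative_mult[OF dq dphi] has_derivative_mult[OF dq dphi]]])
      (simp only:)
qed

text \<open>The derivative of F^2 at \<open>y\<close> in the direction \<open>A y\<close>, as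
  computed in \<open>square_norm_derivative\<close>, with the positive factor 2 \<phi>
  removed.\<close>

definition infinitesimal_isometry :: "('a \<Rightarrow> 'a) \<Rightarrow> bool" where
  "infinitesimal_isometry A \<longleftrightarrow> linear A \<and> (\<forall>y. y \<noteq> 0 \<longrightarrow>
     (\<phi> (ratio y) - ratio y * deriv \<phi> (ratio y)) * B y (A y)
       + sqrt (B y y) * deriv \<phi> (ratio y) * B X (A y) = 0)"

text \<open>If some \<open>B X (A y)\<close> is not \<open>0\<close>, this happens for a vector \<open>z\<close> orthogonal to \<open>X\<close>. Subtracting the
  identities for \<open>A\<close> at \<open>t X + r z\<close> and \<open>t X - r z\<close>, which have the same ratio \<open>s\<close>, leaves the ODE
  \<open>\<phi>' = - k s (\<phi> - s \<phi>')\<close>, so \<open>\<phi>\<^sup>2 / (1 - k s\<^sup>2)\<close> is constant.\<close>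
lemma isometry_dichotomy:
  assumes A: "infinitesimal_isometry A"
    and non_quadratic: "\<nexists>C k. \<forall>s. \<bar>s\<bar> \<le> sqrt (B X X) \<longrightarrow> (\<phi> s)\<^sup>2 = C * (1 - k * s\<^sup>2)"
  shows "B X (A y) = 0" "B y (A y) = 0"
proof -
  let ?b = "sqrt (B X X)" and ?P = "\<lambda>s. \<phi> s - s * deriv \<phi> s"
  have lin: "linear A" and eq: "?P (ratio y) * B y (A y) + sqrt (B y y) * deriv \<phi> (ratio y) * B X (A y) = 0"
    if "y \<noteq> 0" for y
    using A that by (auto simp: infinitesimal_isometry_def)
  have linA: "linear A" using A by (simp add: infinitesimal_isometry_def)
  \<comment> \<open>For X = 0 the only admissible s is 0, and a constant (k = 0) would fit.\<close>
  have X: "X \<noteq> 0"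
  proof
    assume "X = 0"
    then have "\<forall>s. \<bar>s\<bar> \<le> ?b \<longrightarrow> (\<phi> s)\<^sup>2 = (\<phi> 0)\<^sup>2 * (1 - 0 * s\<^sup>2)" by (simp add: zero_left)
    then show False using non_quadratic by blast
  qed
  then have BX: "B X X > 0" "?b > 0" using B_pos by auto
  \<comment> \<open>At y = X the ratio s equals \<open>sqrt (B X X)\<close>, so the two terms with
    \<phi>' cancel and only \<phi> times \<open>B X (A X)\<close> remains.\<close>
  have AX: "B X (A X) = 0"
  proof -
    have r: "ratio X = ?b" using BX by (simp add: ratio_def real_div_sqrt)
    have "\<phi> ?b * B X (A X) = 0" using eq[OF X] unfolding r by (simp add: algebra_simps)
    then show ?thesis using phi_pos[of ?b] X_small BX(2) by auto
  qed
  have main: "B X (A y) = 0" for y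
  proof (rule ccontr)
    assume ne: "B X (A y) \<noteq> 0"
    \<comment> \<open>The component of \<open>y\<close> orthogonal to \<open>X\<close>. Removing the
      multiple of \<open>X\<close> does not change \<open>B X (A y)\<close>, since
      \<open>A X\<close> is orthogonal to \<open>X\<close>.\<close>
    define z where "z = y - (B X y / B X X) *\<^sub>R X"
    have zX: "B X z = 0" using BX by (simp add: z_def diff_right scaleR_right)
    then have zX': "B z X = 0" using B_sym by simp
    have Az: "A z = A y - (B X y / B X X) *\<^sub>R A X"
      by (simp add: z_def linear_diff[OF linA] linear_scale[OF linA])
    define l where "l = B X (A z)"
    have l: "l \<noteq> 0" using ne by (simp add: l_def Az diff_right scaleR_right AX)
    have z: "z \<noteq> 0" using l linear_0[OF linA] by (auto simp: l_def zero_right)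
    \<comment> \<open>The coefficient of t e in B y (A y) for y = t X + e z. The constant
      \<open>k\<close> is what is left after solving for \<phi>' with t = s / B X X.\<close>
    define \<kappa> where "\<kappa> = B X (A z) + B z (A X)"
    define k where "k = \<kappa> / (B X X * l)"
    have ode: "deriv \<phi> s = - k * s * ?P s" if s: "\<bar>s\<bar> < ?b" for s
    proof -
      \<comment> \<open>\<open>t\<close> and \<open>r\<close> are chosen so that t X + r z and t X -
        r z have B-norm 1 and product s with \<open>X\<close>.\<close>
      define t where "t = s / B X X"
      define r where "r = sqrt ((1 - s\<^sup>2 / B X X) / B z z)"
      have "s\<^sup>2 < B X X"
        using power_strict_mono[OF s, of 2] BX(1) by simp
      then have r: "r > 0" "r\<^sup>2 * B z z = 1 - s\<^sup>2 / B X X"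
        using BX B_pos[OF z] by (auto simp: r_def field_simps)
      have norm1: "B (t *\<^sub>R X + e *\<^sub>R z) (t *\<^sub>R X + e *\<^sub>R z) = 1" if "e\<^sup>2 = r\<^sup>2" for e
      proof -
        have "B (t *\<^sub>R X + e *\<^sub>R z) (t *\<^sub>R X + e *\<^sub>R z) = t\<^sup>2 * B X X + e\<^sup>2 * B z z"
          by (simp add: add_left add_right scaleR_left scaleR_right zX zX' power2_eq_square)
        then show ?thesis using BX r(2) that by (simp add: t_def power2_eq_square)
      qed
      have rat: "ratio (t *\<^sub>R X + e *\<^sub>R z) = s" if "e\<^sup>2 = r\<^sup>2" for e
        using BX unfolding ratio_def norm1[OF that] by (simp add: add_right scaleR_right zX t_def)
      have eqn: "?P s * (t * e * \<kappa> + e\<^sup>2 * B z (A z)) + deriv \<phi> s * (e * l) = 0" if "e\<^sup>2 = r\<^sup>2" for e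
      proof -
        have ne: "t *\<^sub>R X + e *\<^sub>R z \<noteq> 0" using norm1[OF that] by (auto simp: zero_left)
        have "A (t *\<^sub>R X + e *\<^sub>R z) = t *\<^sub>R A X + e *\<^sub>R A z"
          by (simp add: linear_add[OF linA] linear_scale[OF linA])
        then show ?thesis using eq[OF ne] unfolding rat[OF that] norm1[OF that]
          by (simp add: add_left add_right scaleR_left scaleR_right AX \<kappa>_def l_def algebra_simps power2_eq_square)
      qed
      have "?P s * t * \<kappa> * r + deriv \<phi> s * l * r = 0"
        using eqn[of r] eqn[of "-r"] by (simp add: algebra_simps)
      then have "r * (?P s * t * \<kappa> + deriv \<phi> s * l) = 0" by (simp add: algebra_simps)
      then have "?P s * t * \<kappa> + deriv \<phi> s * l = 0" using r(1) by simp
      then have "deriv \<phi> s * l = - (?P s * t * \<kappa>)" by linarith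
      then have "deriv \<phi> s = - (?P s * t * \<kappa>) / l" using l by (metis nonzero_mult_div_cancel_right)
      also have "\<dots> = - k * s * ?P s" by (simp add: k_def t_def)
      finally show ?thesis .
    qed
    have small: "\<bar>s\<bar> < b0" if "\<bar>s\<bar> \<le> ?b" for s using that X_small by linarith
    \<comment> \<open>Inserting the ODE into \<phi> = \<open>?P\<close> + s \<phi>'. As \<phi> and
      \<open>?P\<close> are positive, so is 1 - k s^2, and one may divide by it.\<close>
    have fac: "\<phi> s = ?P s * (1 - k * s\<^sup>2)" "deriv \<phi> s * (1 - k * s\<^sup>2) = - k * s * \<phi> s"
      if "\<bar>s\<bar> < ?b" for s
    proof -
      define p where "p = ?P s"
      have d: "deriv \<phi> s = - k * s * p" unfolding p_def by (rule ode[OF that])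
      have "\<phi> s = p + s * deriv \<phi> s" by (simp add: p_def)
      then have f: "\<phi> s = p * (1 - k * s\<^sup>2)" unfolding d by (simp add: algebra_simps power2_eq_square)
      then show "\<phi> s = ?P s * (1 - k * s\<^sup>2)" by (simp only: p_def)
      show "deriv \<phi> s * (1 - k * s\<^sup>2) = - k * s * \<phi> s" unfolding d f by simp
    qed
    have pos: "1 - k * s\<^sup>2 > 0" if "\<bar>s\<bar> < ?b" for s
      using fac(1)[OF that] phi_pos[OF small, of s] phi_conv[OF small, of s] that
        zero_less_mult_pos[of "?P s" "1 - k * s\<^sup>2"] by simp
    have dphi: "(\<phi> has_real_derivative deriv \<phi> s) (at s)" if "\<bar>s\<bar> \<le> ?b" for s
      using phi_diff[OF small[OF that]] DERIV_deriv_iff_real_differentiable by blast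
    have "((\<lambda>s. (\<phi> s)\<^sup>2 / (1 - k * s\<^sup>2)) has_real_derivative 0) (at s)" if s: "\<bar>s\<bar> < ?b" for s
    proof -
      have "2 * \<phi> s * deriv \<phi> s * (1 - k * s\<^sup>2) - (\<phi> s)\<^sup>2 * (- (k * (2 * s)))
          = 2 * \<phi> s * (deriv \<phi> s * (1 - k * s\<^sup>2)) + 2 * k * s * (\<phi> s)\<^sup>2" by simp
      also have "\<dots> = 0" unfolding fac(2)[OF s] by (simp add: power2_eq_square)
      finally have "2 * \<phi> s * deriv \<phi> s * (1 - k * s\<^sup>2) - (\<phi> s)\<^sup>2 * (- (k * (2 * s))) = 0" .
      note zero = this
      have d1: "((\<lambda>s. (\<phi> s)\<^sup>2) has_real_derivative 2 * \<phi> s * deriv \<phi> s) (at s)"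
        using DERIV_power[OF dphi, of s 2] s by (simp add: mult_ac)
      have d2: "((\<lambda>s. 1 - k * s\<^sup>2) has_real_derivative - (k * (2 * s))) (at s)"
        by (auto intro!: derivative_eq_intros)
      have "1 - k * s\<^sup>2 \<noteq> 0" using pos[OF s] by simp
      from DERIV_divide[OF d1 d2 this] show ?thesis unfolding zero by simp
    qed
    note zero_deriv = this
    have "((\<lambda>s. (\<phi> s)\<^sup>2 / (1 - k * s\<^sup>2)) has_derivative (\<lambda>h. 0)) (at s within {-?b<..<?b})"
      if "s \<in> {-?b<..<?b}" for s
    proof -
      have "\<bar>s\<bar> < ?b" using that by auto
      from has_derivative_at_withinI[OF zero_deriv[OF this, unfolded has_field_derivative_def]]
      show ?thesis by (simp only: lambda_zero)
    qed
    note zero_within = this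
    have open_eq: "(\<phi> s)\<^sup>2 - (\<phi> 0)\<^sup>2 * (1 - k * s\<^sup>2) = 0" if s: "s \<in> {-?b<..<?b}" for s
    proof -
      have "\<bar>s\<bar> < ?b" "0 \<in> {-?b<..<?b}" using s BX(2) by auto
      have "(\<phi> s)\<^sup>2 / (1 - k * s\<^sup>2) = (\<phi> 0)\<^sup>2 / (1 - k * 0\<^sup>2)"
        by (rule has_derivative_zero_unique[OF convex_real_interval(8) zero_within s \<open>0 \<in> _\<close>])
      then show ?thesis using pos[OF \<open>\<bar>s\<bar> < ?b\<close>] by (simp add: divide_eq_eq)
    qed
    \<comment> \<open>At |s| = \<open>?b\<close> the radius r is 0 and the ODE was not obtained
      there; continuity carries the identity to the two end points.\<close>
    have cont: "continuous_on {-?b..?b} (\<lambda>s. (\<phi> s)\<^sup>2 - (\<phi> 0)\<^sup>2 * (1 - k * s\<^sup>2))"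
    proof -
      have "isCont \<phi> s" if "s \<in> {-?b..?b}" for s
      proof -
        have "\<bar>s\<bar> \<le> ?b" using that by auto
        from DERIV_isCont[OF dphi[OF this]] show ?thesis .
      qed
      then have "continuous_on {-?b..?b} \<phi>" by (intro continuous_at_imp_continuous_on ballI)
      then show ?thesis by (intro continuous_intros)
    qed
    have cl: "closure {-?b<..<?b} = {-?b..?b}" using BX(2) by (simp add: closure_greaterThanLessThan)
    have "(\<phi> s)\<^sup>2 - (\<phi> 0)\<^sup>2 * (1 - k * s\<^sup>2) = 0" if "\<bar>s\<bar> \<le> ?b" for s
    proof -
      have "s \<in> {-?b..?b}" using that by auto
      from continuous_constant_on_closure[of "{-?b<..<?b}", unfolded cl, OF cont open_eq this]
      show ?thesis .
    qed
    then have "\<forall>s. \<bar>s\<bar> \<le> ?b \<longrightarrow> (\<phi> s)\<^sup>2 = (\<phi> 0)\<^sup>2 * (1 - k * s\<^sup>2)" by simp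
    then show False using non_quadratic by blast
  qed
  show "B X (A y) = 0" by (rule main)
  show "B y (A y) = 0"
  proof (cases "y = 0")
    case False
    have "?P (ratio y) * B y (A y) = 0" using eq[OF False] unfolding main[of y] by simp
    then show ?thesis using phi_conv[OF ratio_small[of y]] by simp
  qed (simp add: zero_left)
qed

text \<open>Polarising \<open>skew\<close> and using \<open>perp\<close>, A u X is orthogonal to
  every vector, hence 0. So [u, X] = - A X u is orthogonal to X and to u, and as a combination of
  the two it vanishes for u orthogonal to X. Thus X is central; this leaves too little room for any
  other bracket.\<close>

lemma brackets_vanish:
  assumes X: "X \<noteq> 0"
    and lin1: "\<And>v. linear (\<lambda>u. A u v)" and lin2: "\<And>u. linear (A u)"
    and perp: "\<And>u y. B X (A u y) = 0" and skew: "\<And>u y. B y (A u y) = 0"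
    and comb: "\<And>u v. \<exists>r s. A u v - A v u = r *\<^sub>R u + s *\<^sub>R v"
  shows "A u v = A v u"
proof -
  define br where "br u v = A u v - A v u" for u v
  have br_add: "br u (v + w) = br u v + br u w" and br_scale: "br u (c *\<^sub>R v) = c *\<^sub>R br u v"
    and br_anti: "br v u = - br u v" for u v w c
    by (simp_all add: br_def linear_add[OF lin1] linear_add[OF lin2] linear_scale[OF lin1]
        linear_scale[OF lin2] algebra_simps)
  have AX: "A u X = 0" for u
  proof -
    have "B y (A u X) = 0" for y
      using skew[of "X + y" u] skew[of y u] skew[of X u] perp
      by (simp add: linear_add[OF lin2] add_left add_right)
    then show ?thesis using B_eq_0_iff by blast
  qed
  have perpX: "br u X = 0" if u: "B X u = 0" for u
  proof -
    obtain r s where rs: "br u X = r *\<^sub>R u + s *\<^sub>R X" using comb[of u X] by (auto simp: br_def)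
    have eq: "- A X u = r *\<^sub>R u + s *\<^sub>R X" using rs by (simp add: br_def AX)
    have uX: "B u X = 0" using u B_sym by simp
    have "B u (- A X u) = r * B u u" unfolding eq by (simp add: add_right scaleR_right uX)
    then have "r * B u u = 0" by (simp add: minus_right skew)
    then have r: "r *\<^sub>R u = 0" using B_eq_0_iff by auto
    have "B X (- A X u) = s * B X X" unfolding eq by (simp add: add_right scaleR_right u)
    then have "s * B X X = 0" by (simp add: minus_right perp)
    then have "s = 0" using X B_eq_0_iff by auto
    then show ?thesis using rs r by simp
  qed
  have brX: "br u X = 0" for u
  proof -
    define z where "z = u - (B X u / B X X) *\<^sub>R X"
    have "B X z = 0" using B_pos[OF X] by (simp add: z_def diff_right scaleR_right)
    then have "br z X = 0" by (rule perpX)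
    moreover have "u = z + (B X u / B X X) *\<^sub>R X" by (simp add: z_def)
    moreover have "br X X = 0" by (simp add: br_def)
    ultimately have "br X u = 0" using br_add[of X z "(B X u / B X X) *\<^sub>R X"] br_scale[of X _ X] br_anti[of X z] by simp
    then show ?thesis using br_anti[of u X] by simp
  qed
  have brX': "br X u = 0" for u using brX[of u] br_anti[of u X] by simp
  \<comment> \<open>Since X is central, [u, v] = [u, v + X] has two expressions as a combination.
    Either the second one has no v + X term, or X lies in the span of u and v, say X = \<alpha> u +
    \<beta> v. In that case [u, X] = \<beta> [u, v] and [v, X] = \<alpha> [v, u] are 0, while
    \<alpha> and \<beta> are not both 0.\<close>
  have alt: "br u v = 0 \<or> (\<exists>r. br u v = r *\<^sub>R u)" for u v
  proof -
    obtain r s where 1: "br u v = r *\<^sub>R u + s *\<^sub>R v" using comb[of u v] by (auto simp: br_def)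
    obtain r' s' where 2: "br u (v + X) = r' *\<^sub>R u + s' *\<^sub>R (v + X)" using comb[of u "v + X"] by (auto simp: br_def)
    have 3: "br u (v + X) = br u v" by (simp add: br_add brX)
    show ?thesis
    proof (cases "s' = 0")
      case True
      then show ?thesis using 2 3 by auto
    next
      case False
      have "s' *\<^sub>R X = (r - r') *\<^sub>R u + (s - s') *\<^sub>R v"
        using 1 2 3 by (simp add: algebra_simps)
      then have "(1 / s') *\<^sub>R s' *\<^sub>R X = (1 / s') *\<^sub>R ((r - r') *\<^sub>R u + (s - s') *\<^sub>R v)" by simp
      then have "X = ((r - r') / s') *\<^sub>R u + ((s - s') / s') *\<^sub>R v"
        using False by (simp add: scaleR_add_right)
      then obtain \<alpha> \<beta> where X_eq: "X = \<alpha> *\<^sub>R u + \<beta> *\<^sub>R v" by blast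
      have "br u X = \<beta> *\<^sub>R br u v" unfolding X_eq by (simp add: br_add br_scale) (simp add: br_def)
      moreover have "br v X = \<alpha> *\<^sub>R br v u" unfolding X_eq by (simp add: br_add br_scale) (simp add: br_def)
      ultimately have "\<beta> *\<^sub>R br u v = 0" "\<alpha> *\<^sub>R br u v = 0" using brX br_anti[of v u] by auto
      then show ?thesis using X X_eq by auto
    qed
  qed
  \<comment> \<open>A nonzero bracket would be a multiple of u and also of v, so u and v would be
    proportional and their bracket 0.\<close>
  have "br u v = 0"
  proof (rule ccontr)
    assume ne: "br u v \<noteq> 0"
    then have "br v u \<noteq> 0" using br_anti[of v u] by simp
    then obtain r r' where rr: "br u v = r *\<^sub>R u" "br v u = r' *\<^sub>R v" using alt ne by blast
    have eq: "r *\<^sub>R u = - (r' *\<^sub>R v)" using rr br_anti[of u v] by simp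
    have "r' \<noteq> 0" using rr \<open>br v u \<noteq> 0\<close> by auto
    then have "v = (- 1 / r') *\<^sub>R (r *\<^sub>R u)" unfolding eq by simp
    then have "v = (- r / r') *\<^sub>R u" by simp
    then have "br u v = (- r / r') *\<^sub>R br u u" using br_scale by metis
    then show False using ne by (simp add: br_def)
  qed
  then show ?thesis by (simp add: br_def)
qed

end

section \<open>Differentials in charts\<close>

locale manifold =
  fixes T :: "'a topology" and A :: "('a, 'n::finite) chart set"
  assumes smooth_manifold: "smooth_manifold T A"
begin

lemma topspace_eq: "topspace T = (\<Union>c\<in>A. cdom c)"
  and cdom_open: "c \<in> A \<Longrightarrow> openin T (cdom c)"
  and cimg_open: "c \<in> A \<Longrightarrow> open (cimg c)"
  and chart_homeo: "c \<in> A \<Longrightarrow> homeomorphic_map (subtopology T (cdom c)) (top_of_set (cimg c)) (cmap c)"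
  and transition_smooth: "c \<in> A \<Longrightarrow> d \<in> A \<Longrightarrow> smooth_on (cmap c ` (cdom c \<inter> cdom d)) (cmap d \<circ> cinv c)"
  using smooth_manifold unfolding smooth_manifold_def by auto

lemma cdom_subset: "c \<in> A \<Longrightarrow> cdom c \<subseteq> topspace T"
  using topspace_eq by auto

lemma cmap_inj: "c \<in> A \<Longrightarrow> inj_on (cmap c) (cdom c)"
  using homeomorphic_imp_injective_map[OF chart_homeo] cdom_subset by (simp add: Int_absorb1)

lemma cinv_cmap [simp]: "c \<in> A \<Longrightarrow> p \<in> cdom c \<Longrightarrow> cinv c (cmap c p) = p"
  by (simp add: cinv_def cmap_inj)

lemma cmap_cinv [simp]: "x \<in> cimg c \<Longrightarrow> cmap c (cinv c x) = x"
  by (auto simp: cinv_def cimg_def f_inv_into_f)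

lemma cinv_in [simp]: "x \<in> cimg c \<Longrightarrow> cinv c x \<in> cdom c"
  by (auto simp: cinv_def cimg_def inv_into_into)

lemma cmap_in [simp]: "p \<in> cdom c \<Longrightarrow> cmap c p \<in> cimg c"
  by (simp add: cimg_def)

lemma cinv_topspace: "c \<in> A \<Longrightarrow> x \<in> cimg c \<Longrightarrow> cinv c x \<in> topspace T"
  using cdom_subset cinv_in by blast

lemma charts_atD: "c \<in> charts_at A p \<Longrightarrow> c \<in> A" "c \<in> charts_at A p \<Longrightarrow> p \<in> cdom c"
  by (simp_all add: charts_at_def)

lemma charts_at_nonempty: "p \<in> topspace T \<Longrightarrow> \<exists>c. c \<in> charts_at A p"
  using topspace_eq by (auto simp: charts_at_def)

lemma cinv_continuous: "c \<in> A \<Longrightarrow> continuous_map (top_of_set (cimg c)) T (cinv c)"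
proof -
  assume c: "c \<in> A"
  obtain g where g: "homeomorphic_maps (subtopology T (cdom c)) (top_of_set (cimg c)) (cmap c) g"
    using chart_homeo[OF c] homeomorphic_map_maps by blast
  have "continuous_map (top_of_set (cimg c)) (subtopology T (cdom c)) g"
    using g by (simp add: homeomorphic_maps_def)
  then have "continuous_map (top_of_set (cimg c)) T g"
    by (simp add: continuous_map_in_subtopology)
  moreover have "g x = cinv c x" if "x \<in> topspace (top_of_set (cimg c))" for x
  proof -
    obtain p where p: "p \<in> cdom c" "x = cmap c p" using \<open>x \<in> _\<close> by (auto simp: cimg_def)
    have "g (cmap c p) = p"
      using g p(1) cdom_subset[OF c] by (auto simp: homeomorphic_maps_def)
    then show ?thesis using p c by simp
  qed
  ultimately show ?thesis by (rule continuous_map_eq)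
qed

lemma cmap_continuous: "c \<in> A \<Longrightarrow> continuous_map (subtopology T (cdom c)) euclidean (cmap c)"
  using homeomorphic_imp_continuous_map[OF chart_homeo] by (simp add: continuous_map_in_subtopology)

lemma open_chart_preimage:
  assumes "c \<in> A" "continuous_map T T f" "openin T W"
  shows "open {x \<in> cimg c. f (cinv c x) \<in> W}"
proof -
  have "continuous_map (top_of_set (cimg c)) T (f \<circ> cinv c)"
    using continuous_map_compose[OF cinv_continuous assms(2)] assms(1) .
  from openin_continuous_map_preimage[OF this assms(3)]
  have "openin (top_of_set (cimg c)) {x \<in> cimg c. f (cinv c x) \<in> W}" by simp
  then show ?thesis using openin_open_trans cimg_open[OF assms(1)] by blast
qed

lemma open_chart_preimage2:
  assumes c: "c \<in> A" and d: "d \<in> A" and f: "continuous_map (prod_topology T T) T f" and W: "openin T W"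
  shows "open {z \<in> cimg c \<times> cimg d. f (cinv c (fst z), cinv d (snd z)) \<in> W}"
proof -
  let ?P = "prod_topology (top_of_set (cimg c)) (top_of_set (cimg d))"
  have "continuous_map ?P (prod_topology T T) (\<lambda>z. (cinv c (fst z), cinv d (snd z)))"
    by (intro continuous_map_pairedI continuous_map_compose[OF continuous_map_fst cinv_continuous[OF c], unfolded o_def]
        continuous_map_compose[OF continuous_map_snd cinv_continuous[OF d], unfolded o_def])
  from continuous_map_compose[OF this f]
  have "continuous_map ?P T (\<lambda>z. f (cinv c (fst z), cinv d (snd z)))" by (simp add: o_def)
  from openin_continuous_map_preimage[OF this W]
  have "openin ?P {z \<in> cimg c \<times> cimg d. f (cinv c (fst z), cinv d (snd z)) \<in> W}" by simp
  moreover have "?P = top_of_set (cimg c \<times> cimg d)"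
    by (simp add: prod_topology_subtopology_eu)
  ultimately show ?thesis
    using openin_open_trans[OF _ open_Times[OF cimg_open[OF c] cimg_open[OF d]]] by simp
qed

text \<open>The differential between two named charts, in contrast to \<open>tangent_map\<close>,
  which chooses its source chart.\<close>

definition jac :: "('a \<Rightarrow> 'a) \<Rightarrow> ('a, 'n) chart \<Rightarrow> ('a, 'n) chart \<Rightarrow> 'a \<Rightarrow> real^'n \<Rightarrow> real^'n" where
  "jac f c d p = FD (cmap d \<circ> f \<circ> cinv c) (cmap c p)"

definition differentiable_map :: "('a \<Rightarrow> 'a) \<Rightarrow> bool" where
  "differentiable_map f \<longleftrightarrow> continuous_map T T f \<and>
     (\<forall>p c d. c \<in> charts_at A p \<longrightarrow> d \<in> charts_at A (f p) \<longrightarrow>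
        (cmap d \<circ> f \<circ> cinv c) differentiable (at (cmap c p)))"

lemma jac_has_derivative:
  assumes "differentiable_map f" "c \<in> charts_at A p" "d \<in> charts_at A (f p)"
  shows "((cmap d \<circ> f \<circ> cinv c) has_derivative jac f c d p) (at (cmap c p))"
  unfolding jac_def
  by (rule has_derivative_FD) (use assms in \<open>unfold differentiable_map_def, blast\<close>)

lemma jac_linear:
  "differentiable_map f \<Longrightarrow> c \<in> charts_at A p \<Longrightarrow> d \<in> charts_at A (f p) \<Longrightarrow> linear (jac f c d p)"
  using jac_has_derivative has_derivative_linear by blast

lemma jac_compose:
  assumes f: "differentiable_map f" and h: "differentiable_map h"
    and c: "c \<in> charts_at A p" and d: "d \<in> charts_at A (f p)" and e: "e \<in> charts_at A (h (f p))"
  shows "jac (h \<circ> f) c e p = jac h d e (f p) \<circ> jac f c d p"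
proof -
  have cA: "c \<in> A" "p \<in> cdom c" using c charts_atD by auto
  have dA: "d \<in> A" "f p \<in> cdom d" using d charts_atD by auto
  have 1: "((cmap d \<circ> f \<circ> cinv c) has_derivative jac f c d p) (at (cmap c p))"
    by (rule jac_has_derivative[OF f c d])
  have "(cmap d \<circ> f \<circ> cinv c) (cmap c p) = cmap d (f p)" using cA by simp
  then have "((cmap e \<circ> h \<circ> cinv d) has_derivative jac h d e (f p)) (at ((cmap d \<circ> f \<circ> cinv c) (cmap c p)))"
    using jac_has_derivative[OF h d e] by simp
  from diff_chain_at[OF 1 this]
  have 2: "((cmap e \<circ> h \<circ> cinv d \<circ> (cmap d \<circ> f \<circ> cinv c)) has_derivative jac h d e (f p) \<circ> jac f c d p) (at (cmap c p))" .
  have fc: "continuous_map T T f" using f by (simp add: differentiable_map_def)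
  \<comment> \<open>The intermediate chart may be inserted only where \<open>f\<close> lands in
    \<open>cdom d\<close>; continuity of \<open>f\<close> makes this an open set around the
    point.\<close>
  have "((cmap e \<circ> (h \<circ> f) \<circ> cinv c) has_derivative jac h d e (f p) \<circ> jac f c d p) (at (cmap c p))"
    by (rule has_derivative_transform_within_open[OF 2 open_chart_preimage[OF cA(1) fc cdom_open[OF dA(1)]]])
      (use cA dA in auto)
  then show ?thesis unfolding jac_def[of "h \<circ> f"] by (rule FD_eqI)
qed

lemma jac_cong:
  assumes c: "c \<in> charts_at A p" and eq: "\<And>q. q \<in> topspace T \<Longrightarrow> f q = f' q"
  shows "jac f c d p = jac f' c d p"
  unfolding jac_def
  by (rule FD_cong_open[OF cimg_open[of c]]) (use c eq charts_atD cinv_topspace in auto)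

lemma jac_id_same: "c \<in> charts_at A p \<Longrightarrow> jac id c c p = id"
  unfolding jac_def
  by (rule FD_eqI, rule has_derivative_transform_within_open[OF has_derivative_id cimg_open[of c]])
    (use charts_atD in \<open>auto simp: id_def\<close>)

lemma differentiable_map_id: "differentiable_map id"
  unfolding differentiable_map_def
proof (intro conjI allI impI)
  fix p c d assume c: "c \<in> charts_at A p" and d: "d \<in> charts_at A (id p)"
  then have "cmap c p \<in> cmap c ` (cdom c \<inter> cdom d)" by (auto simp: charts_at_def)
  from smooth_on_differentiable[OF transition_smooth this]
  show "(cmap d \<circ> id \<circ> cinv c) differentiable (at (cmap c p))"
    using c d charts_atD by auto
qed (simp add: id_def)

section \<open>Tangent vectors and differentials by components\<close>

lemma tvec_of_apply: "d \<in> charts_at A p \<Longrightarrow> tvec_of A c p y d = jac id c d p y"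
  by (simp add: tvec_of_def jac_def)

lemma tvec_of_self [simp]: "c \<in> charts_at A p \<Longrightarrow> tvec_of A c p y c = y"
  by (simp add: tvec_of_apply jac_id_same)

lemma tangent_space_jac:
  "v \<in> tangent_space A p \<longleftrightarrow> (\<forall>c. c \<notin> charts_at A p \<longrightarrow> v c = 0) \<and>
     (\<forall>c\<in>charts_at A p. \<forall>d\<in>charts_at A p. v d = jac id c d p (v c))"
  by (simp add: tangent_space_def jac_def)

lemma tangent_space_apply:
  "v \<in> tangent_space A p \<Longrightarrow> c \<in> charts_at A p \<Longrightarrow> d \<in> charts_at A p \<Longrightarrow> v d = jac id c d p (v c)"
  unfolding tangent_space_jac by blast

lemma jac_id_compose:
  "c \<in> charts_at A p \<Longrightarrow> d \<in> charts_at A p \<Longrightarrow> e \<in> charts_at A p \<Longrightarrow>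
    jac id d e p (jac id c d p y) = jac id c e p y"
  using jac_compose[OF differentiable_map_id differentiable_map_id, of c p d e] by simp

lemma tvec_of_tangent: "c \<in> charts_at A p \<Longrightarrow> tvec_of A c p y \<in> tangent_space A p"
  by (auto simp: tangent_space_jac tvec_of_apply jac_id_compose) (simp add: tvec_of_def)

lemma tangent_eq_tvec_of:
  "v \<in> tangent_space A p \<Longrightarrow> c \<in> charts_at A p \<Longrightarrow> v = tvec_of A c p (v c)"
proof
  fix d assume v: "v \<in> tangent_space A p" and c: "c \<in> charts_at A p"
  show "v d = tvec_of A c p (v c) d"
  proof (cases "d \<in> charts_at A p")
    case True
    then show ?thesis using tangent_space_apply[OF v c True] tvec_of_apply[OF True] by metis
  next
    case False
    moreover have "v d = 0" using v False unfolding tangent_space_def by blast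
    ultimately show ?thesis by (simp add: tvec_of_def)
  qed
qed

lemma tangent_eqI:
  "v \<in> tangent_space A p \<Longrightarrow> w \<in> tangent_space A p \<Longrightarrow> c \<in> charts_at A p \<Longrightarrow> v c = w c \<Longrightarrow> v = w"
  by (metis tangent_eq_tvec_of)

lemma tvec_of_linear:
  assumes c: "c \<in> charts_at A p"
  shows "tvec_of A c p (r *\<^sub>R y + s *\<^sub>R z) = (\<lambda>d. r *\<^sub>R tvec_of A c p y d + s *\<^sub>R tvec_of A c p z d)"
proof
  fix d
  show "tvec_of A c p (r *\<^sub>R y + s *\<^sub>R z) d = r *\<^sub>R tvec_of A c p y d + s *\<^sub>R tvec_of A c p z d"
  proof (cases "d \<in> charts_at A p")
    case True
    have "linear (jac id c d p)" using jac_linear[OF differentiable_map_id c] True by simp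
    then show ?thesis by (simp add: tvec_of_apply[OF True] linear_add linear_scale)
  qed (simp add: tvec_of_def)
qed

lemma tvec_of_scale:
  "c \<in> charts_at A p \<Longrightarrow> tvec_of A c p (r *\<^sub>R y) = (\<lambda>d. r *\<^sub>R tvec_of A c p y d)"
  using tvec_of_linear[of c p r y 0 0] by simp

lemma tvec_of_zero: "c \<in> charts_at A p \<Longrightarrow> tvec_of A c p 0 = (\<lambda>d. 0)"
  using tvec_of_scale[of c p 0 0] by simp

text \<open>The chart chosen inside \<open>tangent_map\<close> is exchanged for \<open>c\<close> by
  the chain rule for \<open>f\<close> after the identity.\<close>

lemma tangent_map_apply:
  assumes f: "differentiable_map f" and v: "v \<in> tangent_space A p"
    and c: "c \<in> charts_at A p" and d: "d \<in> charts_at A (f p)"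
  shows "tangent_map A f p v d = jac f c d p (v c)"
proof -
  define c' where "c' = (SOME c. c \<in> charts_at A p)"
  have c': "c' \<in> charts_at A p" unfolding c'_def using c by (rule someI)
  have "jac f c d p = jac f c' d p \<circ> jac id c c' p"
    using jac_compose[OF differentiable_map_id f c, of c' d] c' d by simp
  moreover have "v c' = jac id c c' p (v c)" using v c c' by (rule tangent_space_apply)
  ultimately have "jac f c d p (v c) = jac f c' d p (v c')" by simp
  then show ?thesis using d by (simp add: tangent_map_def Let_def c'_def[symmetric] jac_def)
qed

lemma tangent_map_tangent:
  assumes f: "differentiable_map f" and v: "v \<in> tangent_space A p" and p: "p \<in> topspace T"
  shows "tangent_map A f p v \<in> tangent_space A (f p)"
proof -
  obtain c where c: "c \<in> charts_at A p" using charts_at_nonempty[OF p] by blast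
  have "jac id d e (f p) (jac f c d p y) = jac f c e p y"
    if "d \<in> charts_at A (f p)" "e \<in> charts_at A (f p)" for d e y
    using jac_compose[OF f differentiable_map_id c that(1), of e] that(2) by simp
  then show ?thesis
    by (auto simp: tangent_space_jac tangent_map_apply[OF f v c]) (simp add: tangent_map_def Let_def)
qed

lemma tangent_map_tvec_of:
  assumes f: "differentiable_map f" and p: "p \<in> topspace T"
    and c: "c \<in> charts_at A p" and d: "d \<in> charts_at A (f p)"
  shows "tangent_map A f p (tvec_of A c p y) = tvec_of A d (f p) (jac f c d p y)"
  by (rule tangent_eqI[OF tangent_map_tangent[OF f tvec_of_tangent[OF c] p] tvec_of_tangent[OF d] d])
    (simp add: tangent_map_apply[OF f tvec_of_tangent[OF c] c d] c d)

end

section \<open>Left translations\<close>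

text \<open>The fixed chart \<open>c\<close> around the identity identifies the Lie algebra with
  \<open>real^'n\<close>: a left invariant field is named by its components in \<open>c\<close> at
  the identity.\<close>

locale lie_group_chart = group G + manifold T A
  for G :: "('a, 'm) monoid_scheme" (structure) and T :: "'a topology" and A :: "('a, 'n::finite) chart set" +
  fixes c :: "('a, 'n) chart"
  assumes lie_group: "lie_group G T A"
    and c_at_one: "c \<in> charts_at A \<one>"
begin

lemma topspace_carrier: "topspace T = carrier G"
  and mult_continuous: "continuous_map (prod_topology T T) T (\<lambda>(p, q). p \<otimes> q)"
  and inv_continuous: "continuous_map T T (\<lambda>p. inv p)"
  and mult_smooth: "d \<in> A \<Longrightarrow> e \<in> A \<Longrightarrow> f \<in> A \<Longrightarrow>
     smooth_on {(x, y). x \<in> cimg d \<and> y \<in> cimg e \<and> cinv d x \<otimes> cinv e y \<in> cdom f}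
          (\<lambda>(x, y). cmap f (cinv d x \<otimes> cinv e y))"
  and inv_smooth: "d \<in> A \<Longrightarrow> e \<in> A \<Longrightarrow>
     smooth_on {x \<in> cimg d. inv (cinv d x) \<in> cdom e} (\<lambda>x. cmap e (inv (cinv d x)))"
  using lie_group unfolding lie_group_def by auto

lemma cA: "c \<in> A" and one_cdom: "\<one> \<in> cdom c"
  using c_at_one charts_atD by auto

lemma cinv_carrier: "d \<in> A \<Longrightarrow> x \<in> cimg d \<Longrightarrow> cinv d x \<in> carrier G"
  using cinv_topspace topspace_carrier by auto

lemma charts_carrier: "d \<in> charts_at A p \<Longrightarrow> p \<in> carrier G"
  using charts_atD cdom_subset topspace_carrier by blast

lemma cinv_chart: "d \<in> A \<Longrightarrow> x \<in> cimg d \<Longrightarrow> d \<in> charts_at A (cinv d x)"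
  by (simp add: charts_at_def)

lemma mult_domain_open:
  assumes "d \<in> A" "e \<in> A" "f \<in> A"
  shows "open {(x, y). x \<in> cimg d \<and> y \<in> cimg e \<and> cinv d x \<otimes> cinv e y \<in> cdom f}"
proof -
  have "{(x, y). x \<in> cimg d \<and> y \<in> cimg e \<and> cinv d x \<otimes> cinv e y \<in> cdom f}
      = {z \<in> cimg d \<times> cimg e. (case (cinv d (fst z), cinv e (snd z)) of (p, q) \<Rightarrow> p \<otimes> q) \<in> cdom f}"
    by auto
  then show ?thesis
    using open_chart_preimage2[OF assms(1,2) mult_continuous cdom_open[OF assms(3)]] by simp
qed

abbreviation lt :: "'a \<Rightarrow> 'a \<Rightarrow> 'a" where "lt a \<equiv> (\<lambda>q. a \<otimes> q)"

lemma lt_continuous: assumes "a \<in> carrier G" shows "continuous_map T T (lt a)"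
proof -
  have "continuous_map T (prod_topology T T) (\<lambda>q. (a, q))"
    using assms topspace_carrier by (intro continuous_map_pairedI) auto
  from continuous_map_compose[OF this mult_continuous] show ?thesis by (simp add: o_def)
qed

lemma lt_smooth:
  assumes a: "a \<in> carrier G" and d: "d \<in> A" and e: "e \<in> A"
  shows "smooth_on {x \<in> cimg d. a \<otimes> cinv d x \<in> cdom e} (cmap e \<circ> lt a \<circ> cinv d)"
proof -
  obtain f where "f \<in> charts_at A a" using charts_at_nonempty[of a] a topspace_carrier by blast
  then have f: "f \<in> A" "a \<in> cdom f" using charts_atD by auto
  from smooth_on_slice2[OF mult_domain_open[OF f(1) d e] mult_smooth[OF f(1) d e], of "cmap f a"]
  show ?thesis using f by (simp add: o_def)
qed

lemma lt_differentiable: assumes a: "a \<in> carrier G" shows "differentiable_map (lt a)"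
  unfolding differentiable_map_def
proof (intro conjI allI impI)
  show "continuous_map T T (lt a)" using lt_continuous[OF a] .
  fix p d e assume d: "d \<in> charts_at A p" and e: "e \<in> charts_at A (a \<otimes> p)"
  then show "(cmap e \<circ> lt a \<circ> cinv d) differentiable (at (cmap d p))"
    using charts_atD by (intro smooth_on_differentiable[OF lt_smooth[OF a]]) auto
qed

lemma jac_lt_compose:
  assumes a: "a \<in> carrier G" "b \<in> carrier G"
    and d: "d \<in> charts_at A p" and e: "e \<in> charts_at A (b \<otimes> p)" and f: "f \<in> charts_at A (a \<otimes> (b \<otimes> p))"
  shows "jac (lt a) e f (b \<otimes> p) (jac (lt b) d e p y) = jac (lt (a \<otimes> b)) d f p y"
proof -
  have "jac (lt a \<circ> lt b) d f p = jac (lt a) e f (b \<otimes> p) \<circ> jac (lt b) d e p"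
    by (rule jac_compose[OF lt_differentiable lt_differentiable]) (use assms in auto)
  moreover have "jac (lt a \<circ> lt b) d f p = jac (lt (a \<otimes> b)) d f p"
    by (rule jac_cong[OF d]) (use a topspace_carrier in \<open>auto simp: m_assoc\<close>)
  ultimately show ?thesis by (metis comp_apply)
qed

lemma jac_lt_one: assumes d: "d \<in> charts_at A p" shows "jac (lt \<one>) d d p y = y"
proof -
  have "jac (lt \<one>) d d p = jac id d d p"
    by (rule jac_cong[OF d]) (use topspace_carrier in auto)
  then show ?thesis using jac_id_same[OF d] by simp
qed

section \<open>Left invariant frame and coframe in the chart at the identity\<close>

definition base :: "real^'n" where "base = cmap c \<one>"

lemma base_in: "base \<in> cimg c" and cinv_base [simp]: "cinv c base = \<one>"
  using cA one_cdom by (simp_all add: base_def)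

definition frame :: "real^'n \<Rightarrow> real^'n \<Rightarrow> real^'n" where
  "frame x u = jac (lt (cinv c x)) c c \<one> u"

text \<open>The Maurer-Cartan form in coordinates, inverse to \<open>frame x\<close>.\<close>

definition coframe :: "real^'n \<Rightarrow> real^'n \<Rightarrow> real^'n" where
  "coframe x u = jac (lt (inv (cinv c x))) c c (cinv c x) u"

definition left_field :: "real^'n \<Rightarrow> 'a \<Rightarrow> ('a, 'n) tvec" where
  "left_field u p = tangent_map A (lt p) \<one> (tvec_of A c \<one> u)"

lemma one_topspace: "\<one> \<in> topspace T" using topspace_carrier by simp

lemma left_field_tangent: "p \<in> carrier G \<Longrightarrow> left_field u p \<in> tangent_space A p"
  using tangent_map_tangent[OF lt_differentiable tvec_of_tangent[OF c_at_one] one_topspace, of p u]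
  by (simp add: left_field_def)

lemma left_field_apply:
  assumes d: "d \<in> charts_at A p" shows "left_field u p d = jac (lt p) c d \<one> u"
  using tangent_map_apply[OF lt_differentiable tvec_of_tangent[OF c_at_one] c_at_one, of p d u]
    charts_carrier[OF d] d c_at_one by (simp add: left_field_def)

lemma left_field_chart: "x \<in> cimg c \<Longrightarrow> left_field u (cinv c x) c = frame x u"
  using left_field_apply cinv_chart[OF cA] by (simp add: frame_def)

text \<open>The field is the partial derivative of the product in its second argument at the
  identity, so joint smoothness of the multiplication gives smoothness in the first
  argument.\<close>

lemma left_field_smooth:
  assumes d: "d \<in> A" shows "smooth_on (cimg d) (\<lambda>x. left_field u (cinv d x) d)"
proof -
  let ?S = "{(x, y). x \<in> cimg d \<and> y \<in> cimg c \<and> cinv d x \<otimes> cinv c y \<in> cdom d}"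
  let ?M = "\<lambda>(x, y). cmap d (cinv d x \<otimes> cinv c y)"
  have op: "open ?S" by (rule mult_domain_open[OF d cA d])
  have sm: "smooth_on ?S ?M" by (rule mult_smooth[OF d cA d])
  have mem: "(x, base) \<in> ?S" if "x \<in> cimg d" for x
    using that base_in cinv_carrier[OF d that] by simp
  have "smooth_on (cimg d) (\<lambda>x. FD ?M (x, base) (0, u))"
    by (rule smooth_on_subset[OF smooth_on_slice1[OF op smooth_on_FD[OF sm]]]) (use mem in blast)
  then show ?thesis
  proof (rule smooth_on_cong[OF cimg_open[OF d], rotated])
    fix x assume x: "x \<in> cimg d"
    have "((\<lambda>y. (x, y)) has_derivative (\<lambda>h. (0, h))) (at base)"
      by (auto intro!: derivative_eq_intros)
    from has_derivative_compose[OF this has_derivative_FD[OF smooth_on_differentiable[OF sm mem[OF x]]]]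
    have "((cmap d \<circ> lt (cinv d x) \<circ> cinv c) has_derivative (\<lambda>h. FD ?M (x, base) (0, h))) (at (cmap c \<one>))"
      by (simp add: o_def base_def)
    from fun_cong[OF FD_eqI[OF this], of u, symmetric] show "FD ?M (x, base) (0, u) = left_field u (cinv d x) d"
      unfolding left_field_apply[OF cinv_chart[OF d x]] jac_def .
  qed
qed

lemma left_field_vector_field: "vector_field A (left_field u)"
  unfolding vector_field_def
  using left_field_tangent left_field_smooth topspace_eq topspace_carrier by auto

lemma left_field_invariant: "left_invariant_field G A (left_field u)"
  unfolding left_invariant_field_def
proof (intro conjI ballI left_field_vector_field)
  fix a p assume a: "a \<in> carrier G" and p: "p \<in> carrier G"
  then have ap: "a \<otimes> p \<in> carrier G" by simp
  obtain d where d: "d \<in> charts_at A (a \<otimes> p)" using charts_at_nonempty ap topspace_carrier by blast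
  obtain e where e: "e \<in> charts_at A p" using charts_at_nonempty p topspace_carrier by blast
  show "left_field u (a \<otimes> p) = tangent_map A (lt a) p (left_field u p)"
  proof (rule tangent_eqI[OF left_field_tangent[OF ap] tangent_map_tangent[OF lt_differentiable[OF a] left_field_tangent[OF p]] d])
    show "p \<in> topspace T" using p topspace_carrier by simp
    have "tangent_map A (lt a) p (left_field u p) d = jac (lt a) e d p (jac (lt p) c e \<one> u)"
      using tangent_map_apply[OF lt_differentiable[OF a] left_field_tangent[OF p] e d]
      by (simp add: left_field_apply[OF e])
    also have "\<dots> = jac (lt (a \<otimes> p)) c d \<one> u"
      using jac_lt_compose[OF a p c_at_one, of e d u] p d e by simp
    finally show "left_field u (a \<otimes> p) d = tangent_map A (lt a) p (left_field u p) d"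
      by (simp add: left_field_apply[OF d])
  qed
qed

lemma frame_linear: "x \<in> cimg c \<Longrightarrow> linear (frame x)"
  unfolding frame_def using jac_linear[OF lt_differentiable c_at_one, of "cinv c x" c]
    cinv_chart[OF cA] cinv_carrier[OF cA] by simp

lemma coframe_linear: "x \<in> cimg c \<Longrightarrow> linear (coframe x)"
  unfolding coframe_def using jac_linear[OF lt_differentiable cinv_chart[OF cA], of "inv (cinv c x)" x c]
    c_at_one cinv_carrier[OF cA] by simp

lemma coframe_frame: "x \<in> cimg c \<Longrightarrow> coframe x (frame x u) = u"
  using jac_lt_compose[OF _ _ c_at_one, of "inv (cinv c x)" "cinv c x" c c u]
    cinv_chart[OF cA, of x] cinv_carrier[OF cA, of x] c_at_one jac_lt_one[OF c_at_one]
  by (simp add: coframe_def frame_def)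

lemma frame_coframe: "x \<in> cimg c \<Longrightarrow> frame x (coframe x u) = u"
  using jac_lt_compose[OF _ _ cinv_chart[OF cA, of x], of "cinv c x" "inv (cinv c x)" c c u]
    cinv_chart[OF cA, of x] cinv_carrier[OF cA, of x] c_at_one jac_lt_one[OF cinv_chart[OF cA, of x]]
  by (simp add: coframe_def frame_def)

lemma frame_base: "frame base u = u"
  using jac_lt_one[OF c_at_one] by (simp add: frame_def)

lemma coframe_base: "coframe base u = u"
  using jac_lt_one[OF c_at_one] by (simp add: coframe_def)

lemma frame_smooth: "smooth_on (cimg c) (\<lambda>x. frame x u)"
  by (rule smooth_on_cong[OF cimg_open[OF cA] _ left_field_smooth[OF cA]]) (simp add: left_field_chart)

section \<open>Multiplication in coordinates and the derivative of the coframe\<close>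

definition mult_dom :: "((real^'n) \<times> (real^'n)) set" where
  "mult_dom = {(x, y). x \<in> cimg c \<and> y \<in> cimg c \<and> cinv c x \<otimes> cinv c y \<in> cdom c}"

definition mult :: "(real^'n) \<times> (real^'n) \<Rightarrow> real^'n" where
  "mult = (\<lambda>(x, y). cmap c (cinv c x \<otimes> cinv c y))"

lemma mult_dom_open: "open mult_dom" and mult_smooth_on: "smooth_on mult_dom mult"
  unfolding mult_dom_def mult_def using mult_domain_open[OF cA cA cA] mult_smooth[OF cA cA cA] by auto

lemma cinv_mult: "(x, y) \<in> mult_dom \<Longrightarrow> cinv c (mult (x, y)) = cinv c x \<otimes> cinv c y"
  using cA by (auto simp: mult_def mult_dom_def)

lemma mult_has_derivative:
  assumes "(x, y) \<in> mult_dom"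
  shows "((\<lambda>y. mult (x, y)) has_derivative jac (lt (cinv c x)) c c (cinv c y)) (at y)"
proof -
  have xy: "x \<in> cimg c" "y \<in> cimg c" "cinv c x \<otimes> cinv c y \<in> cdom c"
    using assms by (auto simp: mult_dom_def)
  from jac_has_derivative[OF lt_differentiable cinv_chart[OF cA xy(2)], of "cinv c x" c]
  show ?thesis using xy cA cinv_carrier[OF cA] by (simp add: mult_def o_def charts_at_def)
qed

lemma jac_mult: "(x, y) \<in> mult_dom \<Longrightarrow> jac (lt (cinv c x)) c c (cinv c y) u = FD mult (x, y) (0, u)"
proof -
  assume xy: "(x, y) \<in> mult_dom"
  have "((\<lambda>y. (x, y)) has_derivative (\<lambda>h. (0, h))) (at y)"
    by (auto intro!: derivative_eq_intros)
  from has_derivative_compose[OF this has_derivative_FD[OF smooth_on_differentiable[OF mult_smooth_on xy]]]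
  have "((\<lambda>y. mult (x, y)) has_derivative (\<lambda>h. FD mult (x, y) (0, h))) (at y)" .
  from fun_cong[OF has_derivative_unique[OF mult_has_derivative[OF xy] this], of u] show ?thesis .
qed

text \<open>On this set \<open>coframe x\<close> is a partial derivative of \<open>mult\<close> at
  (\<open>inversion x\<close>, \<open>x\<close>), which is how it is differentiated in
  \<open>x\<close>.\<close>

definition nbhd :: "(real^'n) set" where "nbhd = {x \<in> cimg c. inv (cinv c x) \<in> cdom c}"

definition inversion :: "real^'n \<Rightarrow> real^'n" where "inversion x = cmap c (inv (cinv c x))"

lemma nbhd_open: "open nbhd"
  unfolding nbhd_def by (rule open_chart_preimage[OF cA inv_continuous cdom_open[OF cA]])

lemma base_nbhd: "base \<in> nbhd"
  using base_in one_cdom by (simp add: nbhd_def)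

lemma nbhd_cimg: "x \<in> nbhd \<Longrightarrow> x \<in> cimg c"
  by (simp add: nbhd_def)

lemma inversion_smooth: "smooth_on nbhd inversion"
  unfolding nbhd_def inversion_def using inv_smooth[OF cA cA] .

lemma inversion_mult_dom: "x \<in> nbhd \<Longrightarrow> (inversion x, x) \<in> mult_dom"
  using cA one_cdom cinv_carrier[OF cA, of x] by (auto simp: nbhd_def inversion_def mult_dom_def)

lemma coframe_mult: "x \<in> nbhd \<Longrightarrow> coframe x u = FD mult (inversion x, x) (0, u)"
  using jac_mult[OF inversion_mult_dom, of x u] cA by (simp add: coframe_def nbhd_def inversion_def)

text \<open>The derivative of the coframe by the chain rule. Argument order: the direction
  \<open>h\<close> of differentiation, and after it the vector \<open>u\<close> to which the form is
  applied.\<close>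

definition dcoframe :: "real^'n \<Rightarrow> real^'n \<Rightarrow> real^'n \<Rightarrow> real^'n" where
  "dcoframe x h u = FD (\<lambda>z. FD mult z (0, u)) (inversion x, x) (FD inversion x h, h)"

lemma coframe_has_derivative:
  assumes x: "x \<in> nbhd"
  shows "((\<lambda>x. coframe x u) has_derivative (\<lambda>h. dcoframe x h u)) (at x)"
proof -
  have i: "(inversion has_derivative FD inversion x) (at x)"
    by (intro has_derivative_FD smooth_on_differentiable[OF inversion_smooth x])
  have "((\<lambda>x. (inversion x, x)) has_derivative (\<lambda>h. (FD inversion x h, h))) (at x)"
    by (intro has_derivative_Pair i has_derivative_ident)
  from has_derivative_compose[OF this has_derivative_FD[OF smooth_on_differentiable[OF
        smooth_on_FD[OF mult_smooth_on] inversion_mult_dom[OF x]]], of "(0, u)"]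
  have "((\<lambda>x. FD mult (inversion x, x) (0, u)) has_derivative (\<lambda>h. dcoframe x h u)) (at x)"
    by (simp add: dcoframe_def)
  then show ?thesis
    by (rule has_derivative_transform_within_open[OF _ nbhd_open x]) (simp add: coframe_mult)
qed

lemma dcoframe_continuous: "continuous_on nbhd (\<lambda>x. dcoframe x h u)"
proof -
  have ci: "continuous_on nbhd inversion" and cdi: "continuous_on nbhd (\<lambda>x. FD inversion x h)"
    using inversion_smooth[unfolded smooth_on_def, rule_format, of 0]
      smooth_on_FD[OF inversion_smooth, of h, unfolded smooth_on_def, rule_format, of 0] by simp_all
  have "Ck_on (Suc 0) mult_dom (\<lambda>z. FD mult z (0, u))"
    using smooth_on_FD[OF mult_smooth_on] unfolding smooth_on_def by blast
  from continuous_on_FD[OF this]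
  have "continuous_on nbhd (\<lambda>x. case ((inversion x, x), (FD inversion x h, h)) of (z, v) \<Rightarrow> FD (\<lambda>z. FD mult z (0, u)) z v)"
    by (rule continuous_on_compose2) (auto intro!: continuous_intros ci cdi inversion_mult_dom)
  then show ?thesis by (simp add: dcoframe_def)
qed

lemma dcoframe_linear1: "x \<in> nbhd \<Longrightarrow> linear (\<lambda>h. dcoframe x h u)"
  using coframe_has_derivative has_derivative_linear by blast

lemma dcoframe_linear2: assumes x: "x \<in> nbhd" shows "linear (dcoframe x h)"
proof -
  have "((\<lambda>x. coframe x (r *\<^sub>R u + s *\<^sub>R v)) has_derivative (\<lambda>h. r *\<^sub>R dcoframe x h u + s *\<^sub>R dcoframe x h v)) (at x)" for r s u v
  proof (rule has_derivative_transform_within_open[OF _ nbhd_open x])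
    show "((\<lambda>x. r *\<^sub>R coframe x u + s *\<^sub>R coframe x v) has_derivative (\<lambda>h. r *\<^sub>R dcoframe x h u + s *\<^sub>R dcoframe x h v)) (at x)"
      by (intro has_derivative_add has_derivative_scaleR_right coframe_has_derivative x)
    show "r *\<^sub>R coframe z u + s *\<^sub>R coframe z v = coframe z (r *\<^sub>R u + s *\<^sub>R v)" if "z \<in> nbhd" for z
      using coframe_linear[OF nbhd_cimg[OF that]] by (simp add: linear_add linear_scale)
  qed
  note this = has_derivative_unique[OF this coframe_has_derivative[OF x], THEN fun_cong, where x = h]
  then have eq: "r *\<^sub>R dcoframe x h u + s *\<^sub>R dcoframe x h v = dcoframe x h (r *\<^sub>R u + s *\<^sub>R v)" for r s u v .
  show ?thesis
  proof (rule linearI)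
    show "dcoframe x h (u + v) = dcoframe x h u + dcoframe x h v" for u v using eq[of 1 u 1 v] by simp
    show "dcoframe x h (r *\<^sub>R u) = r *\<^sub>R dcoframe x h u" for r u using eq[of r u 0 0] by simp
  qed
qed

lemma frame_has_derivative: "x \<in> cimg c \<Longrightarrow> ((\<lambda>x. frame x u) has_derivative FD (\<lambda>x. frame x u) x) (at x)"
  by (intro has_derivative_FD smooth_on_differentiable[OF frame_smooth])

text \<open>The product rule for the constant \<open>coframe x (frame x v)\<close> =
  \<open>v\<close>, with the inner vector expanded in the basis so that it becomes a finite sum of
  products.\<close>

lemma coframe_dframe:
  assumes x: "x \<in> nbhd"
  shows "coframe x (FD (\<lambda>x. frame x v) x h) = - dcoframe x h (frame x v)"
proof -
  have xc: "x \<in> cimg c" by (rule nbhd_cimg[OF x])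
  have fb: "((\<lambda>x. frame x v \<bullet> b) has_derivative (\<lambda>h. FD (\<lambda>x. frame x v) x h \<bullet> b)) (at x)" for b
    by (intro has_derivative_inner_left frame_has_derivative xc)
  have "((\<lambda>x. \<Sum>b\<in>Basis. (frame x v \<bullet> b) *\<^sub>R coframe x b) has_derivative
     (\<lambda>h. \<Sum>b\<in>Basis. (frame x v \<bullet> b) *\<^sub>R dcoframe x h b + (FD (\<lambda>x. frame x v) x h \<bullet> b) *\<^sub>R coframe x b)) (at x)"
    by (intro has_derivative_sum has_derivative_scaleR fb coframe_has_derivative x)
  note d1 = this
  have d2: "((\<lambda>x. \<Sum>b\<in>Basis. (frame x v \<bullet> b) *\<^sub>R coframe x b) has_derivative (\<lambda>h. 0)) (at x)"
  proof (rule has_derivative_transform_within_open[OF has_derivative_const cimg_open[OF cA] xc])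
    fix z assume z: "z \<in> cimg c"
    show "v = (\<Sum>b\<in>Basis. (frame z v \<bullet> b) *\<^sub>R coframe z b)"
      using coframe_frame[OF z, of v] linear_expand_Basis[OF coframe_linear[OF z], of "frame z v"] by simp
  qed
  from fun_cong[OF has_derivative_unique[OF d1 d2], of h]
  have "(\<Sum>b\<in>Basis. (frame x v \<bullet> b) *\<^sub>R dcoframe x h b + (FD (\<lambda>x. frame x v) x h \<bullet> b) *\<^sub>R coframe x b) = 0" .
  then have "dcoframe x h (frame x v) + coframe x (FD (\<lambda>x. frame x v) x h) = 0"
    unfolding linear_expand_Basis[OF dcoframe_linear2[OF x], of h "frame x v"]
      linear_expand_Basis[OF coframe_linear[OF xc], of "FD (\<lambda>x. frame x v) x h"]
    by (simp add: sum.distrib)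
  then show ?thesis by (simp add: add_eq_0_iff)
qed

lemma lie_bracket_left_field:
  assumes x: "x \<in> cimg c"
  shows "lie_bracket A (left_field u) (left_field v) (cinv c x) c =
    FD (\<lambda>x. frame x v) x (frame x u) - FD (\<lambda>x. frame x u) x (frame x v)"
proof -
  have "FD (\<lambda>x. left_field u (cinv c x) c) x = FD (\<lambda>x. frame x u) x" for u
    by (rule FD_cong_open[OF cimg_open[OF cA] x]) (simp add: left_field_chart)
  then show ?thesis
    using cinv_chart[OF cA x] x by (simp add: lie_bracket_def left_field_chart)
qed

text \<open>The Maurer-Cartan equation at the identity: the bracket is minus the exterior derivative
  of the coframe.\<close>

lemma lie_bracket_base:
  "lie_bracket A (left_field u) (left_field v) \<one> c = dcoframe base v u - dcoframe base u v"
  using lie_bracket_left_field[OF base_in, of u v] coframe_dframe[OF base_nbhd]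
  by (simp add: frame_base coframe_base)

end

section \<open>Lie groups with commutative Lie algebra\<close>

context lie_group_chart
begin

text \<open>With \<open>W\<close> inside \<open>H\<close>, each translate a W lies in
  \<open>H\<close> or misses it, according to whether a is in \<open>H\<close>. So \<open>H\<close>
  and its complement are both open, and a connected set through the identity stays in
  \<open>H\<close>.\<close>

lemma component_subset_open_subgroup:
  assumes H: "subgroup H G" and W: "openin T W" "\<one> \<in> W" "W \<subseteq> H"
  shows "connected_component_of_set T \<one> \<subseteq> H"
proof
  fix q assume "q \<in> connected_component_of_set T \<one>"
  then obtain C where C: "connectedin T C" "\<one> \<in> C" "q \<in> C"
    by (auto simp: connected_component_of_def)
  interpret H: subgroup H G by (rule H)
  have nb: "openin T {p \<in> carrier G. inv a \<otimes> p \<in> W}" if "a \<in> carrier G" for a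
    using openin_continuous_map_preimage[OF lt_continuous W(1), of "inv a"] that topspace_carrier by simp
  have coset: "p \<in> H \<longleftrightarrow> a \<in> H" if "a \<in> carrier G" "p \<in> carrier G" "inv a \<otimes> p \<in> W" for a p
  proof -
    have h: "inv a \<otimes> p \<in> H" using that W by auto
    have "p = a \<otimes> (inv a \<otimes> p)" using that by (simp add: m_assoc[symmetric])
    moreover have "a = p \<otimes> inv (inv a \<otimes> p)"
      using that by (simp add: inv_mult_group m_assoc[symmetric])
    ultimately show ?thesis using h H.m_closed H.m_inv_closed by metis
  qed
  have op: "openin T B" if B: "B \<subseteq> carrier G" and sat: "\<And>a p. a \<in> B \<Longrightarrow> p \<in> carrier G \<Longrightarrow> inv a \<otimes> p \<in> W \<Longrightarrow> p \<in> B" for B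
  proof (subst openin_subopen, intro ballI)
    fix a assume a: "a \<in> B"
    then have aG: "a \<in> carrier G" using B by auto
    let ?V = "{p \<in> carrier G. inv a \<otimes> p \<in> W}"
    have "a \<in> ?V" using aG W(2) by simp
    moreover have "?V \<subseteq> B" using sat[OF a] by auto
    ultimately show "\<exists>V. openin T V \<and> a \<in> V \<and> V \<subseteq> B" using nb[OF aG] by blast
  qed
  have "openin T H" by (rule op) (use coset H.subset in blast)+
  moreover have "openin T (carrier G - H)" by (rule op) (use coset in blast)+
  moreover have "C \<subseteq> H \<union> (carrier G - H)"
    using C(1) topspace_carrier by (auto simp: connectedin_def)
  moreover have "H \<inter> (carrier G - H) \<inter> C = {}" by auto
  moreover have "H \<inter> C \<noteq> {}" using C(2) H.one_closed by blast
  ultimately have "(carrier G - H) \<inter> C = {}"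
    using C(1) unfolding connectedin by metis
  then show "q \<in> H" using C(3) C(1) topspace_carrier by (auto simp: connectedin_def)
qed

lemma centralizer_subgroup:
  assumes "Q \<subseteq> carrier G"
  shows "subgroup {p \<in> carrier G. \<forall>q\<in>Q. p \<otimes> q = q \<otimes> p} G"
proof (rule subgroupI)
  fix a assume a: "a \<in> {p \<in> carrier G. \<forall>q\<in>Q. p \<otimes> q = q \<otimes> p}"
  have "inv a \<otimes> q = q \<otimes> inv a" if "q \<in> Q" for q
  proof -
    have q: "q \<in> carrier G" "a \<in> carrier G" "a \<otimes> q = q \<otimes> a" using that assms a by auto
    have "inv a \<otimes> q = inv a \<otimes> (q \<otimes> a) \<otimes> inv a" using q by (simp add: m_assoc)
    also have "\<dots> = inv a \<otimes> (a \<otimes> q) \<otimes> inv a" by (simp add: q(3))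
    also have "\<dots> = q \<otimes> inv a" using q(1,2) by (simp add: m_assoc[symmetric])
    finally show ?thesis .
  qed
  then show "inv a \<in> {p \<in> carrier G. \<forall>q\<in>Q. p \<otimes> q = q \<otimes> p}" using a by auto
  fix b assume b: "b \<in> {p \<in> carrier G. \<forall>q\<in>Q. p \<otimes> q = q \<otimes> p}"
  have "a \<otimes> b \<otimes> q = q \<otimes> (a \<otimes> b)" if "q \<in> Q" for q
  proof -
    have q: "q \<in> carrier G" "a \<in> carrier G" "b \<in> carrier G" "a \<otimes> q = q \<otimes> a" "b \<otimes> q = q \<otimes> b"
      using that assms a b by auto
    have "a \<otimes> b \<otimes> q = a \<otimes> (q \<otimes> b)" using q by (simp add: m_assoc)
    also have "\<dots> = q \<otimes> a \<otimes> b" using q by (simp add: m_assoc[symmetric])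
    finally show ?thesis using q by (simp add: m_assoc)
  qed
  then show "a \<otimes> b \<in> {p \<in> carrier G. \<forall>q\<in>Q. p \<otimes> q = q \<otimes> p}" using a b by auto
next
  have "\<one> \<in> {p \<in> carrier G. \<forall>q\<in>Q. p \<otimes> q = q \<otimes> p}" using assms by auto
  then show "{p \<in> carrier G. \<forall>q\<in>Q. p \<otimes> q = q \<otimes> p} \<noteq> {}" by blast
qed auto

text \<open>The previous lemma is used twice: the centralizer of \<open>W\<close> contains
  \<open>W\<close>, hence the component; so the centralizer of the component contains
  \<open>W\<close>, hence the component.\<close>

lemma component_commutative:
  assumes W: "openin T W" "\<one> \<in> W" and comm: "\<And>p q. p \<in> W \<Longrightarrow> q \<in> W \<Longrightarrow> p \<otimes> q = q \<otimes> p"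
    and p: "p \<in> connected_component_of_set T \<one>" and q: "q \<in> connected_component_of_set T \<one>"
  shows "p \<otimes> q = q \<otimes> p"
proof -
  let ?C = "connected_component_of_set T \<one>"
  have WG: "W \<subseteq> carrier G" using W openin_subset topspace_carrier by blast
  have CG: "?C \<subseteq> carrier G" using connected_component_of_subset_topspace[of T \<one>] unfolding topspace_carrier .
  have 1: "?C \<subseteq> {p \<in> carrier G. \<forall>q\<in>W. p \<otimes> q = q \<otimes> p}"
    by (rule component_subset_open_subgroup[OF centralizer_subgroup[OF WG] W]) (use WG comm in auto)
  have "W \<subseteq> {p \<in> carrier G. \<forall>q\<in>?C. p \<otimes> q = q \<otimes> p}"
  proof
    fix w assume w: "w \<in> W"
    have "w \<otimes> q = q \<otimes> w" if "q \<in> ?C" for q using 1 that w by force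
    then show "w \<in> {p \<in> carrier G. \<forall>q\<in>?C. p \<otimes> q = q \<otimes> p}" using w WG by auto
  qed
  from component_subset_open_subgroup[OF centralizer_subgroup[OF CG] W this] show ?thesis
    using p q by blast
qed

section \<open>Integrating the Maurer-Cartan form to local commutativity\<close>

lemma coframe_mult_invariant:
  assumes xy: "(x, y) \<in> mult_dom"
  shows "coframe (mult (x, y)) (jac (lt (cinv c x)) c c (cinv c y) u) = coframe y u"
proof -
  have m: "x \<in> cimg c" "y \<in> cimg c" "cinv c x \<otimes> cinv c y \<in> cdom c" using xy by (auto simp: mult_dom_def)
  have G: "cinv c x \<in> carrier G" "cinv c y \<in> carrier G" using m cinv_carrier[OF cA] by auto
  \<comment> \<open>Translating by x and back by the inverse of x y is translating back by the
    inverse of y: the form is left invariant.\<close>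
  have e: "inv (cinv c x \<otimes> cinv c y) \<otimes> cinv c x = inv (cinv c y)"
    using G by (simp add: inv_mult_group m_assoc)
  show ?thesis
    unfolding coframe_def cinv_mult[OF xy]
    using jac_lt_compose[OF _ G(1) cinv_chart[OF cA m(2)], of "inv (cinv c x \<otimes> cinv c y)" c c u]
      G m c_at_one cA by (simp add: e charts_at_def)
qed

lemma base_mult_dom: "x \<in> cimg c \<Longrightarrow> (x, base) \<in> mult_dom" "x \<in> cimg c \<Longrightarrow> mult (x, base) = x"
  using base_in cinv_carrier[OF cA, of x] by (auto simp: mult_dom_def mult_def)

text \<open>If the left invariant fields commute, the Maurer-Cartan form (the coframe) is closed, hence
  locally the differential of a map that turns products into sums.\<close>
lemma flat_locally_commutative:
  assumes flat: "\<And>x u v. x \<in> nbhd \<Longrightarrow>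
    FD (\<lambda>x. frame x v) x (frame x u) = FD (\<lambda>x. frame x u) x (frame x v)"
  obtains W where "openin T W" "\<one> \<in> W" "\<And>p q. p \<in> W \<Longrightarrow> q \<in> W \<Longrightarrow> p \<otimes> q = q \<otimes> p"
proof -
  \<comment> \<open>Commuting frame fields make the derivative of the form symmetric on frame
    vectors, and these fill the whole tangent space.\<close>
  have closed: "dcoframe x a b = dcoframe x b a" if x: "x \<in> nbhd" for x a b
  proof -
    have "dcoframe x (frame x u) (frame x v) = dcoframe x (frame x v) (frame x u)" for u v
      using coframe_dframe[OF x, of v "frame x u"] coframe_dframe[OF x, of u "frame x v"] flat[OF x, of v u]
      by simp
    from this[of "coframe x a" "coframe x b"] show ?thesis
      by (simp add: frame_coframe[OF nbhd_cimg[OF x]])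
  qed
  obtain r where r: "r > 0" "ball base r \<subseteq> nbhd" using nbhd_open base_nbhd open_contains_ball by blast
  have rc: "x \<in> cimg c" "x \<in> nbhd" if "x \<in> ball base r" for x using r that nbhd_cimg by auto
  obtain \<eta> where \<eta>: "\<And>x. x \<in> ball base r \<Longrightarrow> (\<eta> has_derivative coframe x) (at x)"
  proof (rule closed_form_exact_on_ball[of base r coframe dcoframe])
    show "continuous_on (ball base r) (\<lambda>x. dcoframe x h v)" for h v
      using dcoframe_continuous r(2) continuous_on_subset by blast
  qed (use rc coframe_linear coframe_has_derivative closed in auto)
  obtain r2 where r2: "r2 > 0" "ball base r2 \<subseteq> ball base r" "inj_on \<eta> (ball base r2)"
  proof (rule has_derivative_locally_injective[of base "ball base r" id coframe \<eta>])
    show "id \<circ> coframe base = id" by (auto simp: coframe_base)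
    show "\<exists>d>0. \<forall>x. dist base x < d \<longrightarrow> onorm (\<lambda>v. coframe x v - coframe base v) < e" if e: "e > 0" for e
    proof -
      \<comment> \<open>A finite sum that bounds the operator norm and vanishes at
        \<open>base\<close>; the required continuity of the derivative thereby reduces to continuity
        of the single columns.\<close>
      define s where "s x = (\<Sum>b\<in>Basis. norm (coframe x b - coframe base b))" for x
      have cc: "continuous_on (ball base r) (\<lambda>x. coframe x b)" for b
        using coframe_has_derivative rc by (meson continuous_at_imp_continuous_on has_derivative_continuous)
      have "continuous_on (ball base r) s" unfolding s_def by (intro continuous_intros cc)
      moreover have b: "base \<in> ball base r" using r by simp
      ultimately obtain d where d: "d > 0" "\<And>x. x \<in> ball base r \<Longrightarrow> dist x base < d \<Longrightarrow> dist (s x) (s base) < e"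
        unfolding continuous_on_iff using e by blast
      have "onorm (\<lambda>v. coframe x v - coframe base v) < e" if x: "dist base x < min d r" for x
      proof -
        have xb: "x \<in> ball base r" "dist x base < d" using x by (auto simp: dist_commute)
        have "linear (\<lambda>v. coframe x v - coframe base v)"
          using coframe_linear[OF rc(1)[OF xb(1)]] coframe_linear[OF base_in] by (intro linear_compose_sub)
        then have "onorm (\<lambda>v. coframe x v - coframe base v) \<le> s x"
          unfolding s_def by (intro onorm_componentwise) (simp add: linear_conv_bounded_linear)
        also have "\<dots> \<le> dist (s x) (s base)" by (simp add: s_def dist_real_def)
        also have "\<dots> < e" by (rule d(2)[OF xb])
        finally show ?thesis .
      qed
      then show ?thesis using d(1) r(1) by (intro exI[of _ "min d r"]) auto
    qed
  qed (use r \<eta> in \<open>auto simp: id_def bounded_linear_ident\<close>)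
  have bd: "(base, base) \<in> mult_dom" and mb: "mult (base, base) = base" using base_mult_dom[OF base_in] by auto
  have "continuous_on mult_dom mult"
    using mult_smooth_on unfolding smooth_on_def by (metis Ck_on.simps(1))
  then have "open {z \<in> mult_dom. mult z \<in> ball base r2}"
    using continuous_open_preimage[OF _ mult_dom_open open_ball, of mult base r2]
    by (simp add: vimage_def Int_def)
  moreover have "(base, base) \<in> {z \<in> mult_dom. mult z \<in> ball base r2}" using bd mb r2 by simp
  \<comment> \<open>Factors close to \<open>base\<close> have their product in the ball on which
    \<open>\<eta>\<close> is injective.\<close>
  ultimately obtain P Q where PQ: "open P" "open Q" "base \<in> P" "base \<in> Q"
      "P \<times> Q \<subseteq> {z \<in> mult_dom. mult z \<in> ball base r2}"
    by (rule open_prod_elim) auto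
  have "open (P \<inter> Q \<inter> ball base r)" "base \<in> P \<inter> Q \<inter> ball base r" using PQ r by auto
  then obtain r1 where r1: "r1 > 0" "ball base r1 \<subseteq> P \<inter> Q \<inter> ball base r" using open_contains_ball by metis
  have dom: "(x, y) \<in> mult_dom" "mult (x, y) \<in> ball base r2" if "x \<in> ball base r1" "y \<in> ball base r1" for x y
    using PQ(5) r1(2) that by blast+
  have rr: "x \<in> ball base r" if "x \<in> ball base r1" for x using r1 that by auto
  \<comment> \<open>For fixed x, left invariance makes \<open>\<eta>\<close> (x y) -
    \<open>\<eta>\<close> y have derivative 0 in y; its constant value is read off at y =
    \<open>base\<close>. The summand \<open>\<eta> base\<close> remains because the primitive is not
    normalised.\<close>
  have hom: "\<eta> (mult (x, y)) = \<eta> x + \<eta> y - \<eta> base" if x: "x \<in> ball base r1" and y: "y \<in> ball base r1" for x y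
  proof -
    have "((\<lambda>y. \<eta> (mult (x, y)) - \<eta> y) has_derivative (\<lambda>h. 0)) (at y within ball base r1)"
      if y: "y \<in> ball base r1" for y
    proof -
      have "mult (x, y) \<in> ball base r" using dom(2)[OF x y] r2(2) by auto
      from has_derivative_compose[OF mult_has_derivative[OF dom(1)[OF x y]] \<eta>[OF this]]
      have "((\<lambda>y. \<eta> (mult (x, y))) has_derivative coframe y) (at y)"
        by (simp add: coframe_mult_invariant[OF dom(1)[OF x y]])
      from has_derivative_diff[OF this \<eta>[OF rr[OF y]]] show ?thesis
        by (simp add: has_derivative_at_withinI)
    qed
    from has_derivative_zero_unique[OF convex_ball this y, of base]
    have "\<eta> (mult (x, y)) - \<eta> y = \<eta> (mult (x, base)) - \<eta> base" using r1(1) by simp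
    then show ?thesis using base_mult_dom(2)[OF rc(1)[OF rr[OF x]]] by (simp add: algebra_simps)
  qed
  \<comment> \<open>The right side of \<open>hom\<close> is symmetric in x and y, and
    \<open>\<eta>\<close> separates the two products.\<close>
  have comm: "cinv c x \<otimes> cinv c y = cinv c y \<otimes> cinv c x" if x: "x \<in> ball base r1" and y: "y \<in> ball base r1" for x y
  proof -
    have "\<eta> (mult (x, y)) = \<eta> (mult (y, x))" unfolding hom[OF x y] hom[OF y x] by simp
    then have "mult (x, y) = mult (y, x)"
      using inj_onD[OF r2(3)] dom(2)[OF x y] dom(2)[OF y x] by blast
    then show ?thesis using cinv_mult[OF dom(1)[OF x y]] cinv_mult[OF dom(1)[OF y x]] by simp
  qed
  define W where "W = {p \<in> cdom c. cmap c p \<in> ball base r1}"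
  show ?thesis
  proof (rule that[of W])
    have "openin (subtopology T (cdom c)) {p \<in> topspace (subtopology T (cdom c)). cmap c p \<in> ball base r1}"
      by (rule openin_continuous_map_preimage[OF cmap_continuous[OF cA]]) simp
    moreover have "{p \<in> topspace (subtopology T (cdom c)). cmap c p \<in> ball base r1} = W"
      using cdom_subset[OF cA] by (auto simp: W_def)
    ultimately show "openin T W" using openin_trans_full cdom_open[OF cA] by metis
    show "\<one> \<in> W" using one_cdom r1(1) by (simp add: W_def base_def)
    show "p \<otimes> q = q \<otimes> p" if "p \<in> W" "q \<in> W" for p q
      using comm[of "cmap c p" "cmap c q"] that cA by (auto simp: W_def)
  qed
qed

end

section \<open>Left invariant Berwald (alpha, beta)-metrics\<close>

text \<open>Supplies the matrix that \<open>riemannian_finsler\<close> asks for.\<close>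

lemma matrix_of_bilinear:
  fixes h :: "real^'n::finite \<Rightarrow> real^'n \<Rightarrow> real"
  assumes "\<And>u. linear (h u)" "\<And>v. linear (\<lambda>u. h u v)"
  shows "h y y = y \<bullet> ((\<chi> i j. h (axis i 1) (axis j 1)) *v y)"
proof -
  have "h y y = h (\<Sum>i\<in>UNIV. y $ i *\<^sub>R axis i 1) y" using arg_cong[OF vec_expand] .
  also have "\<dots> = (\<Sum>i\<in>UNIV. y $ i * h (axis i 1) y)"
    using linear_sum[OF assms(2), of "\<lambda>i. y $ i *\<^sub>R axis i 1" UNIV] linear_scale[OF assms(2)] by simp
  also have "\<dots> = (\<Sum>i\<in>UNIV. y $ i * h (axis i 1) (\<Sum>j\<in>UNIV. y $ j *\<^sub>R axis j 1))"
    by (simp only: vec_expand[symmetric])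
  also have "\<dots> = (\<Sum>i\<in>UNIV. y $ i * (\<Sum>j\<in>UNIV. h (axis i 1) (axis j 1) * y $ j))"
    using linear_sum[OF assms(1), of _ "\<lambda>i. y $ i *\<^sub>R axis i 1" UNIV] linear_scale[OF assms(1)]
    by (simp add: mult.commute)
  finally show ?thesis by (simp add: inner_vec_def matrix_vector_mult_def)
qed

context manifold
begin

lemma metric_in_chart:
  assumes g: "riemannian_metric A g" and c: "c \<in> charts_at A p"
  defines "B \<equiv> \<lambda>u v. g p (tvec_of A c p u) (tvec_of A c p v)"
  shows "bounded_bilinear B" "B u v = B v u" "u \<noteq> 0 \<Longrightarrow> B u u > 0"
proof -
  let ?t = "tvec_of A c p"
  have p: "p \<in> (\<Union>c\<in>A. cdom c)" using charts_atD[OF c] by blast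
  have g': "g p u v = g p v u \<and> (u \<noteq> (\<lambda>c. 0) \<longrightarrow> g p u u > 0) \<and>
        (\<forall>w\<in>tangent_space A p. \<forall>r s. g p (\<lambda>c. r *\<^sub>R u c + s *\<^sub>R v c) w = r * g p u w + s * g p v w)"
    if "u \<in> tangent_space A p" "v \<in> tangent_space A p" for u v
    using g p that unfolding riemannian_metric_def by blast
  note t = tvec_of_tangent[OF c]
  have sym: "B u v = B v u" for u v using g'[OF t t] by (simp add: B_def)
  have lin: "B (r *\<^sub>R u + s *\<^sub>R v) w = r * B u w + s * B v w" for r s u v w
    unfolding B_def tvec_of_linear[OF c] using g'[OF t t] t by blast
  have l1: "linear (\<lambda>u. B u w)" for w
    using lin[of 1 _ 1 _ w] lin[of _ _ 0 0 w] by (intro linearI) simp_all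
  moreover have "linear (B w)" for w
  proof -
    have "B w = (\<lambda>u. B u w)" by (rule ext) (rule sym)
    then show ?thesis using l1[of w] by simp
  qed
  ultimately have "bilinear B" by (simp add: bilinear_def)
  then show "bounded_bilinear B" by (simp add: bilinear_conv_bounded_bilinear)
  show "B u v = B v u" by (rule sym)
  show "B u u > 0" if "u \<noteq> 0"
  proof -
    have "?t u \<noteq> (\<lambda>c. 0)" using tvec_of_self[OF c, of u] that by metis
    then show ?thesis using g'[OF t t] by (simp add: B_def)
  qed
qed

lemma finsler_in_chart:
  assumes F: "finsler_metric A F" and c: "c \<in> A"
  shows "local_finsler (local_expr A F c) (cimg c)"
proof
  show "open (cimg c)" by (rule cimg_open[OF c])
  show "smooth_on (cimg c \<times> (UNIV - {0})) (local_expr A F c)"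
    using F c unfolding finsler_metric_def by blast
  show "local_expr A F c (x, t *\<^sub>R y) = t * local_expr A F c (x, y)" if x: "x \<in> cimg c" and "t > 0" for x y t
  proof -
    have ch: "c \<in> charts_at A (cinv c x)" using c x by (simp add: charts_at_def)
    have "cinv c x \<in> (\<Union>c\<in>A. cdom c)" using c cinv_in[OF x] by blast
    then have "F (cinv c x) (\<lambda>d. t *\<^sub>R tvec_of A c (cinv c x) y d) = t * F (cinv c x) (tvec_of A c (cinv c x) y)"
      using F tvec_of_tangent[OF ch] \<open>t > 0\<close> unfolding finsler_metric_def by blast
    then show ?thesis by (simp add: local_expr_def tvec_of_scale[OF ch])
  qed
  show "(\<Sum>i\<in>UNIV. \<Sum>j\<in>UNIV. fund (local_expr A F c) i j (x, y) * w $ i * w $ j) > 0"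
    if "x \<in> cimg c" "y \<noteq> 0" "w \<noteq> 0" for x y w
    using F c that unfolding finsler_metric_def by blast
qed

end

section \<open>Left invariant metrics and the brackets at the identity\<close>

context lie_group_chart
begin

text \<open>The dependence of the metric on the point sits entirely in the coframe.\<close>

lemma finsler_coframe:
  assumes F: "left_invariant_finsler G A F" and x: "x \<in> cimg c"
  shows "local_expr A F c (x, y) = local_expr A F c (base, coframe x y)"
proof -
  let ?p = "cinv c x"
  have p: "?p \<in> carrier G" by (rule cinv_carrier[OF cA x])
  have ch: "c \<in> charts_at A ?p" by (rule cinv_chart[OF cA x])
  have "F ?p (tvec_of A c ?p y) = F \<one> (tangent_map A (lt (inv ?p)) ?p (tvec_of A c ?p y))"
    using F p tvec_of_tangent[OF ch] unfolding left_invariant_finsler_def by blast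
  also have "tangent_map A (lt (inv ?p)) ?p (tvec_of A c ?p y) = tvec_of A c \<one> (coframe x y)"
    using tangent_map_tvec_of[OF lt_differentiable _ ch, of "inv ?p" c y] p c_at_one topspace_carrier
    by (simp add: coframe_def)
  finally show ?thesis by (simp add: local_expr_def)
qed

text \<open>The coefficients r and s of the bracket are the same at all points, so r u + s v = 0 at
  the identity is carried to every point by the linear map \<open>frame x\<close>.\<close>

lemma flat_from_base:
  assumes G1: "\<And>u v. \<exists>r s. \<forall>p\<in>carrier G. lie_bracket A (left_field u) (left_field v) p =
      (\<lambda>c. r *\<^sub>R left_field u p c + s *\<^sub>R left_field v p c)"
    and zero: "\<And>u v. dcoframe base u v = dcoframe base v u" and x: "x \<in> nbhd"
  shows "FD (\<lambda>x. frame x v) x (frame x u) = FD (\<lambda>x. frame x u) x (frame x v)"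
proof -
  obtain r s where rs: "\<And>p. p \<in> carrier G \<Longrightarrow> lie_bracket A (left_field u) (left_field v) p =
      (\<lambda>c. r *\<^sub>R left_field u p c + s *\<^sub>R left_field v p c)" using G1 by blast
  have xc: "x \<in> cimg c" using nbhd_cimg[OF x] .
  have "r *\<^sub>R u + s *\<^sub>R v = 0"
    using fun_cong[OF rs[OF one_closed], of c] left_field_chart[OF base_in] zero[of u v]
    by (simp add: lie_bracket_base frame_base)
  then have "frame x (r *\<^sub>R u + s *\<^sub>R v) = 0" using linear_0[OF frame_linear[OF xc]] by simp
  moreover have "lie_bracket A (left_field u) (left_field v) (cinv c x) c = frame x (r *\<^sub>R u + s *\<^sub>R v)"
    using fun_cong[OF rs[OF cinv_carrier[OF cA xc]], of c] frame_linear[OF xc]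
    by (simp add: left_field_chart[OF xc] linear_add linear_scale)
  ultimately show ?thesis by (simp add: lie_bracket_left_field[OF xc])
qed

text \<open>The length of X is constant, so \<beta>/\<alpha> obeys one bound on the whole group, and
  a formula for \<phi> on the range belonging to the identity is valid at every point.\<close>

lemma left_invariant_norm:
  assumes g: "left_invariant_riemannian G A g" and X: "left_invariant_field G A X" and p: "p \<in> carrier G"
  shows "g p (X p) (X p) = g \<one> (X \<one>) (X \<one>)"
proof -
  have "X p \<in> tangent_space A p"
    using X p topspace_eq topspace_carrier unfolding left_invariant_field_def vector_field_def by blast
  then have "g p (X p) (X p) = g \<one> (tangent_map A (lt (inv p)) p (X p)) (tangent_map A (lt (inv p)) p (X p))"
    using g p unfolding left_invariant_riemannian_def by blast
  moreover have "X (inv p \<otimes> p) = tangent_map A (lt (inv p)) p (X p)"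
    using X p unfolding left_invariant_field_def by blast
  ultimately show ?thesis using p by simp
qed

lemma brackets_vanish_at_base:
  assumes g: "left_invariant_riemannian G A g" and X: "left_invariant_field G A X"
    and ab: "alpha_beta_metric A g X F" and F: "left_invariant_finsler G A F"
    and berwald: "berwald_type A F" and non_riem: "\<not> riemannian_finsler A F"
    and G1: "\<And>u v. \<exists>r s. \<forall>p\<in>carrier G. lie_bracket A (left_field u) (left_field v) p =
      (\<lambda>c. r *\<^sub>R left_field u p c + s *\<^sub>R left_field v p c)"
  shows "dcoframe base u v = dcoframe base v u"
proof -
  have rg: "riemannian_metric A g" and fm: "finsler_metric A F" using ab by (auto simp: alpha_beta_metric_def)
  obtain b0 \<phi> where smooth: "smooth_on {-b0<..<b0} \<phi>"
    and pos: "\<And>s. s \<in> {-b0<..<b0} \<Longrightarrow> \<phi> s > 0"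
    and conv: "\<And>s b. \<bar>s\<bar> \<le> b \<Longrightarrow> b < b0 \<Longrightarrow> \<phi> s - s * deriv \<phi> s + (b\<^sup>2 - s\<^sup>2) * deriv (deriv \<phi>) s > 0"
    and small: "\<And>p. p \<in> (\<Union>c\<in>A. cdom c) \<Longrightarrow> sqrt (g p (X p) (X p)) < b0"
    and F_eq: "\<And>p v. p \<in> (\<Union>c\<in>A. cdom c) \<Longrightarrow> v \<in> tangent_space A p - {\<lambda>c. 0} \<Longrightarrow>
           F p v = sqrt (g p v v) * \<phi> (g p (X p) v / sqrt (g p v v))"
    using ab unfolding alpha_beta_metric_def by (elim conjE exE) (rule that, assumption, blast+)
  define B where "B p d u v = g p (tvec_of A d p u) (tvec_of A d p v)" for p and d :: "('a, 'n) chart" and u v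
  have X_tan: "X p \<in> tangent_space A p" if "p \<in> (\<Union>c\<in>A. cdom c)" for p
    using X that unfolding left_invariant_field_def vector_field_def by blast
  have in_dom: "p \<in> (\<Union>c\<in>A. cdom c)" if "d \<in> charts_at A p" for p and d :: "('a, 'n) chart"
    using charts_atD[OF that] by blast
  have BX: "B p d (X p d) (X p d) = g p (X p) (X p)" "B p d (X p d) y = g p (X p) (tvec_of A d p y)"
    if "d \<in> charts_at A p" for p d y
    unfolding B_def tangent_eq_tvec_of[OF X_tan[OF in_dom[OF that]] that, symmetric] by (rule refl)+
  have norm: "alpha_beta_norm (B p d) (X p d) \<phi> b0" if d: "d \<in> charts_at A p" for p d
  proof (rule alpha_beta_norm.intro)
    show "bounded_bilinear (B p d)" unfolding B_def by (rule metric_in_chart(1)[OF rg d])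
    show "B p d u v = B p d v u" for u v unfolding B_def by (rule metric_in_chart(2)[OF rg d])
    show "B p d u u > 0" if "u \<noteq> 0" for u unfolding B_def by (rule metric_in_chart(3)[OF rg d that])
    show "\<phi> differentiable (at s)" if "\<bar>s\<bar> < b0" for s
      using that by (intro smooth_on_differentiable[OF smooth]) auto
    show "\<phi> s > 0" if "\<bar>s\<bar> < b0" for s using that by (intro pos) auto
    show "\<phi> s - s * deriv \<phi> s > 0" if "\<bar>s\<bar> < b0" for s using conv[of s "\<bar>s\<bar>"] that by simp
    show "sqrt (B p d (X p d) (X p d)) < b0" unfolding BX(1)[OF d] by (rule small[OF in_dom[OF d]])
  qed
  have F_norm: "F p (tvec_of A d p y) = sqrt (B p d y y) * \<phi> (alpha_beta_norm.ratio (B p d) (X p d) y)"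
    if d: "d \<in> charts_at A p" and y: "y \<noteq> 0" for p d y
  proof -
    have "tvec_of A d p y \<noteq> (\<lambda>c. 0)" using tvec_of_self[OF d, of y] y by metis
    then have "F p (tvec_of A d p y) = sqrt (B p d y y) * \<phi> (g p (X p) (tvec_of A d p y) / sqrt (B p d y y))"
      unfolding B_def using tvec_of_tangent[OF d] by (intro F_eq[OF in_dom[OF d]]) blast
    then show ?thesis by (simp add: alpha_beta_norm.ratio_def[OF norm[OF d]] BX[OF d])
  qed
  let ?B = "B \<one> c" and ?X = "X \<one> c"
  interpret N: alpha_beta_norm ?B ?X \<phi> b0 by (rule norm[OF c_at_one])
  interpret LF: local_finsler "local_expr A F c" "cimg c" by (rule finsler_in_chart[OF fm cA])
  \<comment> \<open>Such a formula for \<phi> would give F^2 = C (g(y, y) - k g(X, y)^2) at every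
    point, which is Riemannian.\<close>
  have non_quadratic: "\<nexists>C k. \<forall>s. \<bar>s\<bar> \<le> sqrt (?B ?X ?X) \<longrightarrow> (\<phi> s)\<^sup>2 = C * (1 - k * s\<^sup>2)"
  proof
    assume "\<exists>C k. \<forall>s. \<bar>s\<bar> \<le> sqrt (?B ?X ?X) \<longrightarrow> (\<phi> s)\<^sup>2 = C * (1 - k * s\<^sup>2)"
    then obtain C k where Ck: "\<And>s. \<bar>s\<bar> \<le> sqrt (?B ?X ?X) \<Longrightarrow> (\<phi> s)\<^sup>2 = C * (1 - k * s\<^sup>2)" by blast
    have "\<exists>Q :: real^'n^'n. \<forall>v\<in>tangent_space A p. (F p v)\<^sup>2 = v d \<bullet> (Q *v v d)"
      if dA: "d \<in> A" and pd: "p \<in> cdom d" for d p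
    proof -
      have d: "d \<in> charts_at A p" using dA pd by (simp add: charts_at_def)
      let ?C = "B p d" and ?Y = "X p d"
      interpret M: alpha_beta_norm ?C ?Y \<phi> b0 by (rule norm[OF d])
      interpret C: bounded_bilinear ?C by (rule M.bil)
      have len: "?C ?Y ?Y = ?B ?X ?X"
        unfolding BX(1)[OF d] BX(1)[OF c_at_one] by (rule left_invariant_norm[OF g X charts_carrier[OF d]])
      define h where "h u v = C * (?C u v - k * ?C ?Y u * ?C ?Y v)" for u v
      have hl: "linear (h u)" "linear (\<lambda>u. h u v)" for u v
        by (auto intro!: linearI simp: h_def C.add_left C.add_right C.scaleR_left C.scaleR_right algebra_simps)
      have "(F p v)\<^sup>2 = h (v d) (v d)" if v: "v \<in> tangent_space A p" for v
      proof (cases "v d = 0")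
        case True
        have v0: "v = (\<lambda>d. 0)" using tangent_eq_tvec_of[OF v d] unfolding True tvec_of_zero[OF d] .
        \<comment> \<open>The formula for F covers nonzero vectors only; at 0 homogeneity with t = 2
          gives F = 2 F, so F = 0.\<close>
        have "\<forall>t>0. F p (\<lambda>c. t *\<^sub>R v c) = t * F p v"
          using fm in_dom[OF d] v unfolding finsler_metric_def by blast
        then have "F p (\<lambda>c. 2 *\<^sub>R v c) = 2 * F p v" by simp
        then show ?thesis using v0 by (simp add: h_def C.zero_left C.zero_right)
      next
        case False
        let ?y = "v d"
        have y: "?C ?y ?y > 0" using M.B_pos[OF False] .
        have "F p v = sqrt (?C ?y ?y) * \<phi> (M.ratio ?y)"
          using F_norm[OF d False] unfolding tangent_eq_tvec_of[OF v d, symmetric] .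
        then have "(F p v)\<^sup>2 = ?C ?y ?y * (\<phi> (M.ratio ?y))\<^sup>2"
          using y by (simp add: power_mult_distrib)
        also have "(\<phi> (M.ratio ?y))\<^sup>2 = C * (1 - k * (M.ratio ?y)\<^sup>2)"
          using Ck M.ratio_bound[of ?y] len by simp
        also have "(M.ratio ?y)\<^sup>2 = (?C ?Y ?y)\<^sup>2 / ?C ?y ?y"
          using y by (simp add: M.ratio_def power_divide)
        also have "?C ?y ?y * (C * (1 - k * ((?C ?Y ?y)\<^sup>2 / ?C ?y ?y))) = h ?y ?y"
          using y by (simp add: h_def field_simps power2_eq_square)
        finally show ?thesis .
      qed
      then show ?thesis unfolding matrix_of_bilinear[of h, OF hl] by blast
    qed
    then have "riemannian_finsler A F" unfolding riemannian_finsler_def by blast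
    then show False using non_riem by blast
  qed
  have X0: "?X \<noteq> 0"
  proof
    assume "?X = 0"
    then have "\<forall>s. \<bar>s\<bar> \<le> sqrt (?B ?X ?X) \<longrightarrow> (\<phi> s)\<^sup>2 = (\<phi> 0)\<^sup>2 * (1 - 0 * s\<^sup>2)"
      using bounded_bilinear.zero_left[OF N.bil] by simp
    then show False using non_quadratic by blast
  qed
  have ch: "chern_christoffel (local_expr A F c) i j k (base, y) = chern_christoffel (local_expr A F c) i j k (base, y')"
    if "y \<noteq> 0" "y' \<noteq> 0" for i j k y y'
    using berwald cA base_in that unfolding berwald_type_def by blast
  obtain \<Gamma> where \<Gamma>: "\<And>u. linear (\<Gamma> u)" "\<And>u v. \<Gamma> u v = \<Gamma> v u"
    "\<And>u y. y \<noteq> 0 \<Longrightarrow> FD LF.E (base, y) (u, 0) = FD LF.E (base, y) (0, \<Gamma> u y)"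
    by (rule LF.berwald_connection[OF base_in]) (rule ch, assumption, assumption, rule that, assumption+)
  have dE: "(LF.E has_derivative FD LF.E (base, y)) (at (base, y))" if "y \<noteq> 0" for y
    using that base_in by (intro LF.deriv_smooth LF.smooth_E) auto
  \<comment> \<open>The x-derivative at \<open>base\<close> of E (x, y) = E (\<open>base\<close>,
    \<open>coframe x y\<close>).\<close>
  have invariance: "FD LF.E (base, y) (u, 0) = FD LF.E (base, y) (0, dcoframe base u y)" if y: "y \<noteq> 0" for u y
  proof -
    have "((\<lambda>x. (x, y)) has_derivative (\<lambda>h. (h, 0))) (at base)"
      by (auto intro!: derivative_eq_intros)
    from has_derivative_compose[OF this dE[OF y]]
    have 1: "((\<lambda>x. LF.E (x, y)) has_derivative (\<lambda>h. FD LF.E (base, y) (h, 0))) (at base)" .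
    have "((\<lambda>x. (base, coframe x y)) has_derivative (\<lambda>h. (0, dcoframe base h y))) (at base)"
      by (intro has_derivative_Pair has_derivative_const coframe_has_derivative base_nbhd)
    from has_derivative_compose[OF this, of LF.E "FD LF.E (base, y)"] dE[OF y]
    have "((\<lambda>x. LF.E (base, coframe x y)) has_derivative (\<lambda>h. FD LF.E (base, y) (0, dcoframe base h y))) (at base)"
      by (simp add: coframe_base)
    then have "((\<lambda>x. LF.E (x, y)) has_derivative (\<lambda>h. FD LF.E (base, y) (0, dcoframe base h y))) (at base)"
      by (rule has_derivative_transform_within_open[OF _ cimg_open[OF cA] base_in])
        (simp add: LF.E_def finsler_coframe[OF F, of _ y])
    from fun_cong[OF has_derivative_unique[OF 1 this], of u] show ?thesis .
  qed
  \<comment> \<open>Both summands reproduce the x-derivative of \<open>E\<close> when inserted as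
    vertical directions, so their difference leaves \<open>E\<close> stationary.\<close>
  define D where "D u v = \<Gamma> u v - dcoframe base u v" for u v
  have linD: "linear (D u)" "linear (\<lambda>u. D u v)" for u v
  proof -
    show "linear (D u)" unfolding D_def
      by (intro linear_compose_sub \<Gamma>(1) dcoframe_linear2[OF base_nbhd])
    have "(\<lambda>u. \<Gamma> u v) = \<Gamma> v" by (rule ext) (rule \<Gamma>(2))
    then have "linear (\<lambda>u. \<Gamma> u v)" using \<Gamma>(1)[of v] by simp
    then show "linear (\<lambda>u. D u v)" unfolding D_def
      by (intro linear_compose_sub dcoframe_linear1[OF base_nbhd])
  qed
  have iso: "N.infinitesimal_isometry (D u)" for u
    unfolding N.infinitesimal_isometry_def
  proof (intro conjI allI impI linD(1))
    fix y assume y: "(y :: real^'n) \<noteq> 0"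
    have lin: "linear (FD LF.E (base, y))" using dE[OF y] has_derivative_linear by blast
    have "FD LF.E (base, y) (0, D u y) = FD LF.E (base, y) ((0, \<Gamma> u y) - (0, dcoframe base u y))"
      by (simp add: D_def)
    also have "\<dots> = 0"
      using \<Gamma>(3)[OF y, of u] invariance[OF y, of u] by (simp only: linear_diff[OF lin])
    finally have zero: "FD LF.E (base, y) (0, D u y) = 0" .
    have "((\<lambda>y. (base, y)) has_derivative (\<lambda>h. (0, h))) (at y)"
      by (auto intro!: derivative_eq_intros)
    from has_derivative_compose[OF this dE[OF y]]
    have 1: "((\<lambda>y. LF.E (base, y)) has_derivative (\<lambda>h. FD LF.E (base, y) (0, h))) (at y)" .
    have "((\<lambda>y. LF.E (base, y)) has_derivative
      (\<lambda>z. 2 * \<phi> (N.ratio y) * ((\<phi> (N.ratio y) - N.ratio y * deriv \<phi> (N.ratio y)) * ?B y z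
       + sqrt (?B y y) * deriv \<phi> (N.ratio y) * ?B ?X z))) (at y)"
    proof (rule has_derivative_transform_within_open[OF N.square_norm_derivative[OF y]])
      show "open (- {0 :: real^'n})" by (simp add: open_Compl)
      show "y \<in> - {0}" using y by simp
      show "(sqrt (?B z z) * \<phi> (N.ratio z))\<^sup>2 = LF.E (base, z)" if "z \<in> - {0}" for z
        unfolding LF.E_def using F_norm[OF c_at_one, of z] that by (simp add: local_expr_def)
    qed
    from fun_cong[OF has_derivative_unique[OF this 1], of "D u y"] zero N.phi_pos[OF N.ratio_small[of y]]
    show "(\<phi> (N.ratio y) - N.ratio y * deriv \<phi> (N.ratio y)) * ?B y (D u y)
       + sqrt (?B y y) * deriv \<phi> (N.ratio y) * ?B ?X (D u y) = 0" by simp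
  qed
  have "\<exists>r s. D u v - D v u = r *\<^sub>R u + s *\<^sub>R v" for u v
  proof -
    obtain r s where "lie_bracket A (left_field u) (left_field v) \<one> =
      (\<lambda>c. r *\<^sub>R left_field u \<one> c + s *\<^sub>R left_field v \<one> c)" using G1[of u v] one_closed by blast
    from fun_cong[OF this, of c]
    have "dcoframe base v u - dcoframe base u v = r *\<^sub>R u + s *\<^sub>R v"
      using left_field_chart[OF base_in] by (simp add: lie_bracket_base frame_base)
    moreover have "D u v - D v u = dcoframe base v u - dcoframe base u v"
      using \<Gamma>(2)[of u v] by (simp add: D_def)
    ultimately show ?thesis by metis
  qed
  from N.brackets_vanish[OF X0 linD(2) linD(1) N.isometry_dichotomy(1)[OF iso non_quadratic]
      N.isometry_dichotomy(2)[OF iso non_quadratic] this, of u v]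
  show ?thesis using \<Gamma>(2)[of u v] by (simp add: D_def)
qed

end

theorem theorem4p3:
  fixes G :: "('a, 'm) monoid_scheme"
    and T :: "'a topology"
    and A :: "('a, 'n::finite) chart set"
  assumes "family_G1 G T A"
  shows "\<not> (\<exists>g X F.
           left_invariant_riemannian G A g \<and>
           left_invariant_field G A X \<and>
           alpha_beta_metric A g X F \<and>
           left_invariant_finsler G A F \<and>
           berwald_type A F \<and>
           \<not> riemannian_finsler A F)"
proof
  assume "\<exists>g X F.
           left_invariant_riemannian G A g \<and>
           left_invariant_field G A X \<and>
           alpha_beta_metric A g X F \<and>
           left_invariant_finsler G A F \<and>
           berwald_type A F \<and>
           \<not> riemannian_finsler A F"
  then obtain g X F where hyps: "left_invariant_riemannian G A g" "left_invariant_field G A X"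
    "alpha_beta_metric A g X F" "left_invariant_finsler G A F" "berwald_type A F" "\<not> riemannian_finsler A F"
    by blast
  have lg: "lie_group G T A" using assms by (simp add: family_G1_def)
  then interpret group G by (simp add: lie_group_def)
  interpret manifold T A using lg by unfold_locales (simp add: lie_group_def)
  have "\<one>\<^bsub>G\<^esub> \<in> topspace T" using lg by (simp add: lie_group_def)
  then obtain c where "c \<in> charts_at A \<one>\<^bsub>G\<^esub>" using charts_at_nonempty by blast
  then interpret lie_group_chart G T A c using lg by unfold_locales
  have G1: "\<exists>r s. \<forall>p\<in>carrier G. lie_bracket A (left_field u) (left_field v) p =
      (\<lambda>c. r *\<^sub>R left_field u p c + s *\<^sub>R left_field v p c)" for u v
    using assms left_field_invariant unfolding family_G1_def by blast
  obtain W where W: "openin T W" "\<one>\<^bsub>G\<^esub> \<in> W" "\<And>p q. p \<in> W \<Longrightarrow> q \<in> W \<Longrightarrow> p \<otimes>\<^bsub>G\<^esub> q = q \<otimes>\<^bsub>G\<^esub> p"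
    using flat_locally_commutative[OF flat_from_base[OF G1 brackets_vanish_at_base[OF hyps G1]]] by blast
  obtain p q where "p \<in> connected_component_of_set T \<one>\<^bsub>G\<^esub>" "q \<in> connected_component_of_set T \<one>\<^bsub>G\<^esub>"
    "p \<otimes>\<^bsub>G\<^esub> q \<noteq> q \<otimes>\<^bsub>G\<^esub> p" using assms unfolding family_G1_def by blast
  then show False using component_commutative[OF W] by blast
qed

end
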